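(* For any real numbers $\frac12\le\alpha\le\beta\le 1$ there exist a finitely generated group $\Gamma$ and a symmetric finitely supported probability measure $\mu$ on $\Gamma$ whose generating support generates $\Gamma$, such that $$\liminf_{n\to\infty}\frac{\log H_{\Gamma,\mu}(n)}{\log n}=\alpha\quad\text{and}\quad \limsup_{n\to\infty}\frac{\log H_{\Gamma,\mu}(n)}{\log n}=\beta.$$ In particular, for every $\frac12\le\beta\le1$ there is a finitely generated group with such a measure for which $\lim_n \frac{\log H_{\Gamma,\mu}(n)}{\log n}=\beta$.
   Context: For a probability measure $\nu$ on a countable group, its Shannon entropy is $H(\nu)=-\sum_\gamma \nu(\gamma)\log\nu(\gamma)$. For a probability measure $\mu$ on a group $\Gamma$, $\mu^{*n}$ denotes the $n$-fold convolution power (the law of the $n$-th step $Y_n$ of the random walk with step distribution $\mu$ started at the identity), and $H_{\Gamma,\mu}(n)=H(\mu^{*n})$ is the entropy function. *)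

theory Defs
  imports "HOL-Analysis.Analysis" "HOL-Algebra.Algebra"
begin

text \<open>Finitely supported real-valued functions on a group (carrier G), used as probability
measures. Support of a function p on the carrier.\<close>
definition fsupp :: "('a, 'b) monoid_scheme \<Rightarrow> ('a \<Rightarrow> real) \<Rightarrow> 'a set" where
  "fsupp G p = {g \<in> carrier G. p g \<noteq> 0}"

text \<open>Convolution power: law of Y_n = X_1 ... X_n with X_i i.i.d. of law mu, Y_0 = identity.
  mu^{*(n+1)}(g) = sum_h mu^{*n}(h) mu(h^{-1} g).\<close>
fun conv_pow :: "('a, 'b) monoid_scheme \<Rightarrow> ('a \<Rightarrow> real) \<Rightarrow> nat \<Rightarrow> 'a \<Rightarrow> real" where
  "conv_pow G mu 0 = (\<lambda>g. if g = \<one>\<^bsub>G\<^esub> then 1 else 0)"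
| "conv_pow G mu (Suc n) = (\<lambda>g. if g \<in> carrier G then
      (\<Sum>h\<in>fsupp G (conv_pow G mu n). conv_pow G mu n h * mu (inv\<^bsub>G\<^esub> h \<otimes>\<^bsub>G\<^esub> g)) else 0)"

text \<open>Shannon entropy of a finitely supported probability function.\<close>
definition shannon_entropy :: "('a, 'b) monoid_scheme \<Rightarrow> ('a \<Rightarrow> real) \<Rightarrow> real" where
  "shannon_entropy G p = - (\<Sum>g\<in>fsupp G p. p g * ln (p g))"

definition entropy_fun :: "('a, 'b) monoid_scheme \<Rightarrow> ('a \<Rightarrow> real) \<Rightarrow> nat \<Rightarrow> real" where
  "entropy_fun G mu n = shannon_entropy G (conv_pow G mu n)"

text \<open>Symmetric finitely supported probability measure on G whose support generates G.\<close>
definition sym_fin_prob_gen :: "('a, 'b) monoid_scheme \<Rightarrow> ('a \<Rightarrow> real) \<Rightarrow> bool" where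
  "sym_fin_prob_gen G mu \<longleftrightarrow>
     (\<forall>g\<in>carrier G. mu g \<ge> 0) \<and> (\<forall>g. g \<notin> carrier G \<longrightarrow> mu g = 0) \<and>
     finite (fsupp G mu) \<and> (\<Sum>g\<in>fsupp G mu. mu g) = 1 \<and>
     (\<forall>g\<in>carrier G. mu (inv\<^bsub>G\<^esub> g) = mu g) \<and>
     generate G (fsupp G mu) = carrier G"

definition finitely_generated_group :: "('a, 'b) monoid_scheme \<Rightarrow> bool" where
  "finitely_generated_group G \<longleftrightarrow> group G \<and>
     (\<exists>S. finite S \<and> S \<subseteq> carrier G \<and> generate G S = carrier G)"

end

theory Submission
  imports Defs "HOL-Probability.Probability_Mass_Function" "HOL-Library.Z2"
    "HOL-Computational_Algebra.Polynomial" "HOL-Real_Asymp.Real_Asymp"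
begin

text \<open>
  The group is a diagonal product of lamplighter groups over the integers, in the manner of
  Brieussel and Zheng. The \<open>s\<close>-th lamp group is SL2 over \<open>F\<^sub>2[X]/(X\<^sup>m)\<close> with
  \<open>m = m\<^sub>s\<close>; it is generated by a finite group of upper and a finite group of lower unipotent
  matrices, whose products of length up to a multiple of \<open>m\<close> behave as in a free product. Letters of
  the first kind are written at the cursor, letters of the second kind at distance \<open>k\<^sub>s\<close> from it, so
  the \<open>s\<close>-th component looks abelian until the cursor has travelled the distance \<open>k\<^sub>s\<close>.

  Lower bound: given the path of the cursor, the lamps are independent. In time
  \<open>n \<ge> (8 k\<^sub>s m\<^sub>s)\<^sup>2\<close>, the walk alternates at least a multiple of \<open>m\<^sub>s\<close> times between \<open>x - k\<^sub>s\<close> and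
  \<open>x\<close>, with probability bounded below, for each \<open>x\<close> in an interval of length of order \<open>\<surd>n\<close>. Each of
  these sites contributes entropy of order \<open>m\<^sub>s\<close>.

  Upper bound: up to a logarithmic factor the range in time \<open>n\<close> is \<open>\<surd>n\<close>. Counting configurations
  gives \<open>\<surd>n (1 + \<Sum>\<^sub>j m\<^sub>j)\<close>, where the sum is over the components with \<open>k\<^sub>j\<close> below the range. For the
  components \<open>j \<ge> s\<close>, subadditivity extends the bound \<open>\<surd>n\<close> from \<open>n\<close> of order \<open>k\<^sub>s\<^sup>2\<close> to the bound \<open>n / k\<^sub>s\<close> for all
  larger \<open>n\<close>.

  Together these determine the entropy, up to logarithmic factors, as the maximum over \<open>s\<close> of
  \<open>\<surd>n\<close> and \<open>min (n / k\<^sub>s) (\<surd>n m\<^sub>s)\<close>, and any pair of exponents is obtained from suitable \<open>k\<close> and \<open>m\<close>.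
\<close>

hide_const (open) up_ring.coeff up_ring.monom Polynomials.degree

subsection \<open>Shannon entropy of finitely supported distributions\<close>

text \<open>A step of the walk writes, moves and writes again, with letters uniform on a finite
  group. Such a law is idempotent, so at a single lamp only the alternations between the two kinds
  of letters matter. The lower bound thus becomes a question about how often the cursor travels
  between two sites, together with a decay estimate for alternating words. For the latter, the
  letters have entries divisible by \<open>X\<close>, so that a nonzero letter typically raises
  degrees, and there are 64 of them, so that zero letters are rare.

  The obstacle for the upper bound is that every step acts in infinitely many components, so
  counting them separately gives nothing. The components whose offset exceeds the range are all
  functions of one common abelian record of what was written at each cursor position; they are paid
  for once, not once each.

  The lower bound of order \<open>n / k s\<close> at times before
  \<open>64 * (k s * m s) ^ 2\<close> needs no separate study of the walk: it is subadditivity read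
  backwards from that time.\<close>

definition avg :: "'a pmf \<Rightarrow> ('a \<Rightarrow> real) \<Rightarrow> real" where
  "avg p f = (\<Sum>x\<in>set_pmf p. pmf p x * f x)"

definition Hp :: "'a pmf \<Rightarrow> real" where
  "Hp p = avg p (\<lambda>x. - ln (pmf p x))"

lemma avg_expectation:
  assumes "finite (set_pmf p)"
  shows "avg p f = measure_pmf.expectation p f"
  unfolding avg_def using integral_measure_pmf[OF assms, of p f] by auto

lemma avg_return [simp]: "avg (return_pmf x) f = f x"
  by (simp add: avg_def)

lemma avg_const: "finite (set_pmf p) \<Longrightarrow> avg p (\<lambda>_. c) = c"
  unfolding avg_def by (simp flip: sum_distrib_right add: sum_pmf_eq_1)

lemma avg_mono: "(\<And>x. x \<in> set_pmf p \<Longrightarrow> f x \<le> g x) \<Longrightarrow> avg p f \<le> avg p g"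
  unfolding avg_def by (intro sum_mono mult_left_mono) auto

lemma avg_cong: "(\<And>x. x \<in> set_pmf p \<Longrightarrow> f x = g x) \<Longrightarrow> avg p f = avg p g"
  unfolding avg_def by (intro sum.cong) auto

lemma avg_cmult: "avg p (\<lambda>x. c * f x) = c * avg p f"
  unfolding avg_def by (simp add: sum_distrib_left mult_ac)

lemma avg_add: "avg p (\<lambda>x. f x + g x) = avg p f + avg p g"
  unfolding avg_def by (simp add: sum.distrib distrib_left)

lemma avg_sum: "avg p (\<lambda>x. \<Sum>i\<in>I. f i x) = (\<Sum>i\<in>I. avg p (f i))"
  unfolding avg_def sum_distrib_left by (rule sum.swap)

lemma avg_nonneg: "(\<And>x. x \<in> set_pmf p \<Longrightarrow> 0 \<le> f x) \<Longrightarrow> 0 \<le> avg p f"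
  unfolding avg_def by (intro sum_nonneg mult_nonneg_nonneg) auto

lemma avg_bind:
  assumes "finite (set_pmf p)" "\<And>x. x \<in> set_pmf p \<Longrightarrow> finite (set_pmf (f x))"
  shows "avg (bind_pmf p f) h = avg p (\<lambda>x. avg (f x) h)"
proof -
  have "finite (set_pmf (bind_pmf p f))" using assms by auto
  then have "avg (bind_pmf p f) h = measure_pmf.expectation (bind_pmf p f) h"
    by (rule avg_expectation)
  also have "\<dots> = (\<Sum>a\<in>set_pmf p. pmf p a *\<^sub>R measure_pmf.expectation (f a) h)"
    by (rule pmf_expectation_bind[OF assms(1)]) (use assms in auto)
  also have "\<dots> = avg p (\<lambda>x. avg (f x) h)"
    unfolding avg_def[of p] using assms by (intro sum.cong) (auto simp: avg_expectation)
  finally show ?thesis .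
qed

lemma avg_map:
  assumes "finite (set_pmf p)"
  shows "avg (map_pmf g p) h = avg p (\<lambda>x. h (g x))"
  using avg_bind[OF assms, of "\<lambda>x. return_pmf (g x)" h] by (simp add: map_pmf_def)

lemma avg_pmf_of_set:
  assumes "finite A" "A \<noteq> {}"
  shows "avg (pmf_of_set A) f = (\<Sum>x\<in>A. f x) / card A"
  unfolding avg_def using assms by (simp add: sum_divide_distrib)

lemma pmf_bind_avg:
  assumes "finite (set_pmf p)"
  shows "pmf (bind_pmf p f) y = avg p (\<lambda>x. pmf (f x) y)"
  by (simp add: avg_expectation[OF assms] pmf_bind)

lemma measure_bind_avg:
  assumes "finite (set_pmf p)"
  shows "measure_pmf.prob (bind_pmf p f) A = avg p (\<lambda>x. measure_pmf.prob (f x) A)"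
proof -
  have "measure_pmf.prob (bind_pmf p f) A = (\<integral>x. measure_pmf.prob (f x) A \<partial>measure_pmf p)"
    unfolding measure_pmf_bind
    by (rule measure_pmf.measure_bind[where N = "count_space UNIV"]) (auto simp: space_subprob_algebra
        intro!: prob_space_imp_subprob_space measure_pmf.prob_space_axioms)
  then show ?thesis by (simp add: avg_expectation[OF assms])
qed

lemma Hp_nonneg: "0 \<le> Hp p"
  unfolding Hp_def
  by (intro avg_nonneg) (auto simp: pmf_le_1 intro: ln_le_zero_iff[THEN iffD2] simp: pmf_positive)

text \<open>This is \<open>ln z \<le> z - 1\<close> at \<open>z = q x / pmf p x\<close>. Any guess
  \<open>q\<close> of total mass at most 1 bounds the entropy from above; the bounds for joint laws,
  mixtures and two-level coding below differ only in the guess.\<close>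

lemma gibbs:
  assumes fin: "finite (set_pmf p)" and pos: "\<And>x. x \<in> set_pmf p \<Longrightarrow> 0 < q x"
    and le: "(\<Sum>x\<in>set_pmf p. q x) \<le> 1"
  shows "Hp p \<le> avg p (\<lambda>x. - ln (q x))"
proof -
  have "Hp p - avg p (\<lambda>x. - ln (q x)) = (\<Sum>x\<in>set_pmf p. pmf p x * ln (q x / pmf p x))"
    unfolding Hp_def avg_def sum_subtractf[symmetric]
    by (rule sum.cong) (use pos in \<open>auto simp: ln_div pmf_positive algebra_simps dest!: pos\<close>)
  also have "\<dots> \<le> (\<Sum>x\<in>set_pmf p. pmf p x * (q x / pmf p x - 1))"
    by (intro sum_mono mult_left_mono ln_le_minus_one divide_pos_pos) (auto simp: pmf_positive pos)
  also have "\<dots> = (\<Sum>x\<in>set_pmf p. q x - pmf p x)"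
    by (rule sum.cong) (auto simp: field_simps set_pmf_iff)
  also have "\<dots> \<le> 0" using le fin by (simp add: sum_subtractf sum_pmf_eq_1)
  finally show ?thesis by simp
qed

lemma pmf_le_pmf_map: "pmf p x \<le> pmf (map_pmf f p) (f x)"
proof -
  have "pmf p x = measure_pmf.prob p {x}" by (simp add: measure_pmf_single)
  also have "\<dots> \<le> measure_pmf.prob p (f -` {f x})"
    by (rule measure_pmf.finite_measure_mono) auto
  finally show ?thesis by (simp add: pmf_map)
qed

lemma Hp_map:
  assumes "finite (set_pmf p)"
  shows "Hp (map_pmf f p) = avg p (\<lambda>x. - ln (pmf (map_pmf f p) (f x)))"
  unfolding Hp_def by (rule avg_map[OF assms])

lemma Hp_map_le:
  assumes "finite (set_pmf p)"
  shows "Hp (map_pmf f p) \<le> Hp p"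
  unfolding Hp_map[OF assms] Hp_def[of p]
  by (intro avg_mono) (auto simp: pmf_positive intro!: ln_mono pmf_le_pmf_map)

lemma Hp_map_inj:
  assumes "finite (set_pmf p)" "inj_on f (set_pmf p)"
  shows "Hp (map_pmf f p) = Hp p"
  unfolding Hp_map[OF assms(1)] Hp_def[of p]
  by (intro avg_cong) (simp add: pmf_map_inj[OF assms(2)])

lemma Hp_joint_le:
  assumes fin: "finite (set_pmf p)" and inj: "inj_on (\<lambda>x. (f x, g x)) (set_pmf p)"
  shows "Hp p \<le> Hp (map_pmf f p) + Hp (map_pmf g p)"
proof -
  let ?u = "pmf (map_pmf f p)" and ?v = "pmf (map_pmf g p)"
  have pos: "0 < ?u (f x) * ?v (g x)" if "x \<in> set_pmf p" for x
    using that by (intro mult_pos_pos) (auto simp: pmf_positive)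
  have "(\<Sum>x\<in>set_pmf p. ?u (f x) * ?v (g x))
      = (\<Sum>(a,b)\<in>(\<lambda>x. (f x, g x)) ` set_pmf p. ?u a * ?v b)"
    by (simp add: sum.reindex[OF inj])
  also have "\<dots> \<le> (\<Sum>(a,b)\<in>f ` set_pmf p \<times> g ` set_pmf p. ?u a * ?v b)"
    by (rule sum_mono2) (use fin in auto)
  also have "\<dots> = (\<Sum>a\<in>set_pmf (map_pmf f p). ?u a) * (\<Sum>b\<in>set_pmf (map_pmf g p). ?v b)"
    by (simp add: sum_product sum.cartesian_product)
  also have "\<dots> = 1" using fin by (simp add: sum_pmf_eq_1)
  finally have "Hp p \<le> avg p (\<lambda>x. - ln (?u (f x) * ?v (g x)))"
    by (intro gibbs fin pos) auto
  also have "\<dots> = avg p (\<lambda>x. - ln (?u (f x)) + - ln (?v (g x)))"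
  proof (rule avg_cong)
    fix x assume "x \<in> set_pmf p"
    then have "0 < ?u (f x)" "0 < ?v (g x)" by (auto intro!: pmf_positive)
    then show "- ln (?u (f x) * ?v (g x)) = - ln (?u (f x)) + - ln (?v (g x))"
      by (simp add: ln_mult)
  qed
  finally show ?thesis unfolding avg_add Hp_map[OF fin] .
qed

lemma Hp_pair_le:
  assumes "finite (set_pmf p)" "finite (set_pmf q)"
  shows "Hp (pair_pmf p q) \<le> Hp p + Hp q"
  using Hp_joint_le[of "pair_pmf p q" fst snd] assms
  by (simp add: map_fst_pair_pmf map_snd_pair_pmf inj_on_def)

text \<open>Concavity of entropy: coding each \<open>K i\<close> by the mixture instead of its own
  law only costs more. It permits conditioning on the path of the cursor, or on one factor of a
  convolution.\<close>

lemma Hp_bind_ge: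
  assumes fin: "finite (set_pmf p)" "\<And>i. i \<in> set_pmf p \<Longrightarrow> finite (set_pmf (K i))"
  shows "avg p (\<lambda>i. Hp (K i)) \<le> Hp (bind_pmf p K)"
proof -
  have fb: "finite (set_pmf (bind_pmf p K))" using fin by auto
  have "Hp (bind_pmf p K) = avg p (\<lambda>i. avg (K i) (\<lambda>y. - ln (pmf (bind_pmf p K) y)))"
    unfolding Hp_def by (rule avg_bind) (use fin in auto)
  moreover have "Hp (K i) \<le> avg (K i) (\<lambda>y. - ln (pmf (bind_pmf p K) y))" if "i \<in> set_pmf p" for i
  proof (rule gibbs)
    show "finite (set_pmf (K i))" using fin that by auto
    show "0 < pmf (bind_pmf p K) x" if "x \<in> set_pmf (K i)" for x
      using that \<open>i \<in> set_pmf p\<close> by (intro pmf_positive) auto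
    have "(\<Sum>x\<in>set_pmf (K i). pmf (bind_pmf p K) x) \<le> (\<Sum>x\<in>set_pmf (bind_pmf p K). pmf (bind_pmf p K) x)"
      by (rule sum_mono2) (use fb that in auto)
    then show "(\<Sum>x\<in>set_pmf (K i). pmf (bind_pmf p K) x) \<le> 1"
      using fb by (simp add: sum_pmf_eq_1)
  qed
  ultimately show ?thesis by (auto intro: avg_mono)
qed

lemma Hp_ge_of_pmf_le:
  assumes fin: "finite (set_pmf p)" and "\<And>y. pmf p y \<le> B"
  shows "- ln B \<le> Hp p"
proof -
  have "- ln B = avg p (\<lambda>_. - ln B)" using fin by (simp add: avg_const)
  also have "\<dots> \<le> Hp p"
    unfolding Hp_def by (intro avg_mono) (use assms in \<open>auto simp: pmf_positive intro!: ln_mono\<close>)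
  finally show ?thesis .
qed

text \<open>The guess is half uniform on a typical set \<open>E\<close> and half uniform on a set
  \<open>S\<close> that carries everything; \<open>ln 2\<close> pays for the choice, and only
  atypical points pay \<open>ln (card S)\<close>.\<close>

lemma Hp_le_two_level:
  assumes S: "finite S" "set_pmf p \<subseteq> S" and E: "finite E" "E \<noteq> {}"
  shows "Hp p \<le> ln 2 + ln (card E) + measure_pmf.prob p (- E) * ln (card S)"
proof -
  have fin: "finite (set_pmf p)" using S finite_subset by blast
  have Sne: "S \<noteq> {}" using S set_pmf_not_empty[of p] by auto
  have cS: "1 \<le> card S" using Sne S by (simp add: Suc_le_eq card_gt_0_iff)
  have cE: "1 \<le> card E" using E by (simp add: Suc_le_eq card_gt_0_iff)
  define q where "q x = (indicator E x / card E + indicator S x / card S) / 2" for x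
  have q_ge1: "q x \<ge> 1 / (2 * card E)" if "x \<in> E" for x
    using that by (simp add: q_def field_simps)
  have q_ge2: "q x \<ge> 1 / (2 * card S)" if "x \<in> S" for x
    using that by (simp add: q_def field_simps)
  have pos: "0 < q x" if "x \<in> set_pmf p" for x
    using q_ge2[of x] that S cS by (auto intro: less_le_trans[rotated] simp: subset_iff)
  have "(\<Sum>x\<in>set_pmf p. q x) \<le> (\<Sum>x\<in>S \<union> E. q x)"
    by (rule sum_mono2) (use S E in \<open>auto simp: q_def\<close>)
  also have "\<dots> = ((\<Sum>x\<in>S \<union> E. indicator E x) / card E + (\<Sum>x\<in>S \<union> E. indicator S x) / card S) / 2"
    unfolding q_def by (simp add: sum.distrib sum_divide_distrib[symmetric])
  also have "(\<Sum>x\<in>S \<union> E. indicator E x :: real) = card E"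
    using S E by (simp add: indicator_def sum.If_cases Int_absorb1 Un_Int_distrib2)
  also have "(\<Sum>x\<in>S \<union> E. indicator S x :: real) = card S"
    using S E by (simp add: indicator_def sum.If_cases Int_absorb1 Un_Int_distrib2)
  finally have sum: "(\<Sum>x\<in>set_pmf p. q x) \<le> 1" using cS cE by simp
  have "Hp p \<le> avg p (\<lambda>x. - ln (q x))" by (rule gibbs[OF fin pos sum])
  also have "\<dots> \<le> avg p (\<lambda>x. (ln 2 + ln (card E)) + ln (card S) * indicator (- E) x)"
  proof (rule avg_mono)
    fix x assume x: "x \<in> set_pmf p"
    show "- ln (q x) \<le> (ln 2 + ln (card E)) + ln (card S) * indicator (- E) x"
    proof (cases "x \<in> E")
      case True
      have "ln (1 / (2 * card E)) \<le> ln (q x)"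
        using q_ge1[OF True] pos[OF x] cE by (intro ln_mono) auto
      then show ?thesis using True cE by (simp add: ln_div ln_mult)
    next
      case False
      have "ln (1 / (2 * card S)) \<le> ln (q x)"
        using q_ge2[of x] pos[OF x] cS S x by (intro ln_mono) auto
      moreover have "0 \<le> ln (card E)" using cE by simp
      ultimately show ?thesis using False cS by (simp add: ln_div ln_mult)
    qed
  qed
  also have "\<dots> = ln 2 + ln (card E) + ln (card S) * avg p (indicator (- E))"
    by (subst avg_add) (simp add: avg_const fin avg_cmult)
  also have "avg p (indicator (- E)) = measure_pmf.prob p (- E)"
    by (simp add: avg_expectation fin)
  finally show ?thesis by (simp add: mult.commute)
qed

subsection \<open>Random walks on groups\<close>

definition pconv :: "('a, 'b) monoid_scheme \<Rightarrow> 'a pmf \<Rightarrow> 'a pmf \<Rightarrow> 'a pmf" where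
  "pconv W p q = bind_pmf p (\<lambda>x. map_pmf (\<lambda>y. x \<otimes>\<^bsub>W\<^esub> y) q)"

fun pw :: "('a, 'b) monoid_scheme \<Rightarrow> 'a pmf \<Rightarrow> nat \<Rightarrow> 'a pmf" where
  "pw W \<mu> 0 = return_pmf \<one>\<^bsub>W\<^esub>"
| "pw W \<mu> (Suc n) = pconv W (pw W \<mu> n) \<mu>"

lemma set_pconv: "set_pmf (pconv W p q) = (\<Union>x\<in>set_pmf p. (\<lambda>y. x \<otimes>\<^bsub>W\<^esub> y) ` set_pmf q)"
  by (simp add: pconv_def)

lemma finite_set_pconv:
  "finite (set_pmf p) \<Longrightarrow> finite (set_pmf q) \<Longrightarrow> finite (set_pmf (pconv W p q))"
  by (simp add: set_pconv)

lemma finite_set_pw: "finite (set_pmf \<mu>) \<Longrightarrow> finite (set_pmf (pw W \<mu> n))"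
  by (induction n) (simp_all add: finite_set_pconv)

lemma pmf_map_eq:
  assumes "\<And>y. y \<in> set_pmf p \<Longrightarrow> f y = z \<longleftrightarrow> y = x"
  shows "pmf (map_pmf f p) z = pmf p x"
proof -
  have "(f -` {z}) \<inter> set_pmf p = {x} \<inter> set_pmf p" using assms by auto
  then show ?thesis
    unfolding pmf_map by (metis measure_Int_set_pmf measure_pmf_single)
qed

context group
begin

lemma set_pconv_carrier:
  "set_pmf p \<subseteq> carrier G \<Longrightarrow> set_pmf q \<subseteq> carrier G \<Longrightarrow> set_pmf (pconv G p q) \<subseteq> carrier G"
  by (auto simp: set_pconv)

lemma set_pw_carrier: "set_pmf \<mu> \<subseteq> carrier G \<Longrightarrow> set_pmf (pw G \<mu> n) \<subseteq> carrier G"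
  by (induction n) (simp_all add: set_pconv_carrier)

lemma pconv_assoc:
  assumes "set_pmf p \<subseteq> carrier G" "set_pmf q \<subseteq> carrier G" "set_pmf r \<subseteq> carrier G"
  shows "pconv G (pconv G p q) r = pconv G p (pconv G q r)"
proof -
  have "pconv G (pconv G p q) r
      = bind_pmf p (\<lambda>x. bind_pmf q (\<lambda>y. map_pmf (\<lambda>z. (x \<otimes> y) \<otimes> z) r))"
    by (simp add: pconv_def bind_assoc_pmf bind_map_pmf)
  also have "\<dots> = bind_pmf p (\<lambda>x. bind_pmf q (\<lambda>y. map_pmf (\<lambda>z. x \<otimes> (y \<otimes> z)) r))"
    by (intro bind_pmf_cong map_pmf_cong refl) (use assms in \<open>auto intro!: m_assoc\<close>)
  also have "\<dots> = pconv G p (pconv G q r)"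
    by (simp add: pconv_def map_bind_pmf pmf.map_comp o_def)
  finally show ?thesis .
qed

lemma pconv_one_right:
  assumes "set_pmf p \<subseteq> carrier G"
  shows "pconv G p (return_pmf \<one>) = p"
proof -
  have "pconv G p (return_pmf \<one>) = bind_pmf p return_pmf"
    unfolding pconv_def by (intro bind_pmf_cong) (use assms in auto)
  then show ?thesis by (simp add: bind_return_pmf')
qed

lemma pw_add:
  assumes "set_pmf \<mu> \<subseteq> carrier G"
  shows "pw G \<mu> (m + n) = pconv G (pw G \<mu> m) (pw G \<mu> n)"
  by (induction n) (use assms in \<open>simp_all add: pconv_one_right pconv_assoc set_pw_carrier\<close>)

lemma fsupp_pmf: "set_pmf p \<subseteq> carrier G \<Longrightarrow> fsupp G (pmf p) = set_pmf p"
  by (auto simp: fsupp_def set_pmf_iff)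

lemma conv_pow_pmf:
  assumes "finite (set_pmf \<mu>)" "set_pmf \<mu> \<subseteq> carrier G"
  shows "conv_pow G (pmf \<mu>) n = pmf (pw G \<mu> n)"
proof (induction n)
  case 0
  show ?case by (auto simp: indicator_def)
next
  case (Suc n)
  let ?p = "pw G \<mu> n"
  have sub: "set_pmf ?p \<subseteq> carrier G" by (rule set_pw_carrier[OF assms(2)])
  show ?case
  proof
    fix g
    show "conv_pow G (pmf \<mu>) (Suc n) g = pmf (pw G \<mu> (Suc n)) g"
    proof (cases "g \<in> carrier G")
      case True
      have "pmf (pw G \<mu> (Suc n)) g = (\<Sum>h\<in>set_pmf ?p. pmf ?p h * pmf (map_pmf (\<lambda>y. h \<otimes> y) \<mu>) g)"
        by (simp add: pconv_def pmf_bind_avg finite_set_pw assms avg_def)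
      also have "\<dots> = (\<Sum>h\<in>set_pmf ?p. pmf ?p h * pmf \<mu> (inv h \<otimes> g))"
      proof (intro sum.cong refl)
        fix h assume "h \<in> set_pmf ?p"
        then have h: "h \<in> carrier G" using sub by auto
        have "pmf (map_pmf (\<lambda>y. h \<otimes> y) \<mu>) g = pmf \<mu> (inv h \<otimes> g)"
        proof (rule pmf_map_eq)
          fix y assume "y \<in> set_pmf \<mu>"
          then have "y \<in> carrier G" using assms by blast
          then show "h \<otimes> y = g \<longleftrightarrow> y = inv h \<otimes> g"
            using h True by (auto simp: m_assoc[symmetric])
        qed
        then show "pmf ?p h * pmf (map_pmf (\<lambda>y. h \<otimes> y) \<mu>) g = pmf ?p h * pmf \<mu> (inv h \<otimes> g)"
          by simp
      qed
      finally show ?thesis using True by (simp add: Suc fsupp_pmf[OF sub])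
    next
      case False
      then have "g \<notin> set_pmf (pw G \<mu> (Suc n))"
        using set_pw_carrier[OF assms(2), of "Suc n"] by blast
      then show ?thesis using False by (simp add: set_pmf_iff)
    qed
  qed
qed

lemma entropy_fun_pmf:
  assumes "finite (set_pmf \<mu>)" "set_pmf \<mu> \<subseteq> carrier G"
  shows "entropy_fun G (pmf \<mu>) n = Hp (pw G \<mu> n)"
  unfolding entropy_fun_def shannon_entropy_def conv_pow_pmf[OF assms]
    fsupp_pmf[OF set_pw_carrier[OF assms(2)]] Hp_def avg_def
  by (simp add: sum_negf)

lemma countable_generate:
  assumes "S \<subseteq> carrier G" "countable S"
  shows "countable (generate G S)"
proof -
  let ?T = "S \<union> (\<lambda>x. inv x) ` S"
  let ?f = "\<lambda>xs. foldr (\<otimes>) xs \<one>"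
  have T: "?T \<subseteq> carrier G" using assms by auto
  have closed: "?f xs \<in> carrier G" if "xs \<in> lists ?T" for xs
    using that T by (induction xs) auto
  have "g \<in> ?f ` lists ?T" if "g \<in> generate G S" for g
    using that
  proof induction
    case one
    then show ?case by (intro image_eqI[of _ _ "[]"]) auto
  next
    case (incl h)
    then show ?case using assms by (intro image_eqI[of _ _ "[h]"]) auto
  next
    case (inv h)
    then show ?case using assms by (intro image_eqI[of _ _ "[inv h]"]) auto
  next
    case (eng g h)
    then obtain xs ys where xs: "xs \<in> lists ?T" "g = ?f xs" and ys: "ys \<in> lists ?T" "h = ?f ys"
      by blast
    have "?f (xs @ ys) = ?f xs \<otimes> ?f ys"
      using xs(1) closed[OF ys(1)]
    proof (induction xs)
      case (Cons x xs)
      then show ?case using T closed[of xs] closed[OF ys(1)]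
        by (simp add: subset_iff) (metis Un_iff m_assoc assms(1) inv_closed image_iff subset_iff)
    qed simp
    then show ?case using xs ys by (intro image_eqI[of _ _ "xs @ ys"]) auto
  qed
  moreover have "countable (?f ` lists ?T)"
    using assms(2) by (intro countable_image countable_lists) auto
  ultimately show ?thesis by (meson countable_subset subsetI)
qed

end

lemma pw_hom:
  assumes K: "group K" and h: "h \<in> hom K G" "h \<one>\<^bsub>K\<^esub> = \<one>\<^bsub>G\<^esub>" and \<mu>: "set_pmf \<mu> \<subseteq> carrier K"
  shows "pw G (map_pmf h \<mu>) n = map_pmf h (pw K \<mu> n)"
proof (induction n)
  case 0
  show ?case using h by simp
next
  case (Suc n)
  have "pw G (map_pmf h \<mu>) (Suc n)
      = bind_pmf (pw K \<mu> n) (\<lambda>x. map_pmf (\<lambda>y. h x \<otimes>\<^bsub>G\<^esub> h y) \<mu>)"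
    by (simp add: Suc pconv_def bind_map_pmf pmf.map_comp o_def)
  also have "\<dots> = bind_pmf (pw K \<mu> n) (\<lambda>x. map_pmf (\<lambda>y. h (x \<otimes>\<^bsub>K\<^esub> y)) \<mu>)"
    using group.set_pw_carrier[OF K \<mu>, of n] \<mu>
    by (intro bind_pmf_cong map_pmf_cong refl) (auto intro!: hom_mult[OF h(1), symmetric])
  also have "\<dots> = map_pmf h (pw K \<mu> (Suc n))"
    by (simp add: pconv_def map_bind_pmf pmf.map_comp o_def)
  finally show ?case .
qed

text \<open>The diagonal product lives on an uncountable type, whereas the group sought has carrier
  in \<open>nat\<close>. The subgroup generated by the finite support is countable, hence embeds
  into \<open>nat\<close>, and injective images preserve entropy.\<close>

lemma walk_on_nat_group:
  fixes W :: "('a, 'b) monoid_scheme"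
  assumes W: "group W" and fin: "finite (set_pmf \<mu>)" and sub: "set_pmf \<mu> \<subseteq> carrier W"
    and sym: "map_pmf (\<lambda>x. inv\<^bsub>W\<^esub> x) \<mu> = \<mu>"
  obtains G :: "nat monoid" and mu where "finitely_generated_group G" "sym_fin_prob_gen G mu"
    "\<And>n. entropy_fun G mu n = Hp (pw W \<mu> n)"
proof -
  interpret W: group W by fact
  let ?S = "set_pmf \<mu>"
  define K where "K = subgroup_generated W ?S"
  interpret K: group K unfolding K_def by (rule W.group_subgroup_generated)
  have cK: "carrier K = generate W ?S"
    unfolding K_def carrier_subgroup_generated using sub by (simp add: Int_absorb1)
  have SK: "?S \<subseteq> carrier K" unfolding cK by (auto intro: generate.incl)
  have KW: "carrier K \<subseteq> carrier W" unfolding cK by (rule W.generate_incl[OF sub])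
  define e where "e = to_nat_on (carrier K)"
  have inj: "inj_on e (carrier K)"
    unfolding e_def using W.countable_generate[OF sub] fin
    by (intro inj_on_to_nat_on) (simp add: cK countable_finite)
  define G where "G = image_group e K"
  have iso: "e \<in> iso K G"
    unfolding iso_def hom_def G_def image_group_def bij_betw_def using inj by auto
  have "group (G\<lparr>one := e \<one>\<^bsub>K\<^esub>\<rparr>)" by (rule K.iso_imp_img_group[OF iso])
  moreover have oneG: "\<one>\<^bsub>G\<^esub> = e \<one>\<^bsub>K\<^esub>" by (simp add: G_def image_group_def)
  ultimately have "group G" by (simp add: G_def image_group_def)
  then interpret G: group G .
  have hom: "e \<in> hom K G" using iso by (simp add: iso_def)
  interpret e: group_hom K G e using hom by unfold_locales
  define \<nu> where "\<nu> = map_pmf e \<mu>"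
  have finv: "finite (set_pmf \<nu>)" using fin by (simp add: \<nu>_def)
  have subv: "set_pmf \<nu> \<subseteq> carrier G" using SK by (auto simp: \<nu>_def)
  have genK: "generate K ?S = carrier K"
    unfolding K_def using W.subgroup_generated2[of ?S] carrier_subgroup_generated
    by (metis K.carrier_subgroup_generated_subset K_def SK carrier_subgroup_generated inf.absorb_iff2)
  have genG: "generate G (set_pmf \<nu>) = carrier G"
    using e.generate_img[OF SK] genK iso by (auto simp: \<nu>_def iso_def bij_betw_def)
  have inv_eq: "inv\<^bsub>K\<^esub> x = inv\<^bsub>W\<^esub> x" if "x \<in> ?S" for x
    unfolding K_def using W.inv_subgroup_generated[of x ?S] that SK
    by (simp add: K_def subset_iff)
  have "map_pmf (\<lambda>x. inv\<^bsub>G\<^esub> x) \<nu> = map_pmf (\<lambda>x. e (inv\<^bsub>W\<^esub> x)) \<mu>"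
    unfolding \<nu>_def pmf.map_comp o_def
    by (intro map_pmf_cong refl) (metis SK e.hom_inv inv_eq subsetD)
  also have "\<dots> = map_pmf e (map_pmf (\<lambda>x. inv\<^bsub>W\<^esub> x) \<mu>)" by (simp add: pmf.map_comp o_def)
  finally have symG: "map_pmf (\<lambda>x. inv\<^bsub>G\<^esub> x) \<nu> = \<nu>" by (simp add: sym \<nu>_def)
  have mu_inv: "pmf \<nu> (inv\<^bsub>G\<^esub> g) = pmf \<nu> g" if "g \<in> carrier G" for g
  proof -
    have "pmf (map_pmf (\<lambda>x. inv\<^bsub>G\<^esub> x) \<nu>) (inv\<^bsub>G\<^esub> g) = pmf \<nu> g"
      using subv that by (intro pmf_map_eq) auto
    then show ?thesis by (simp add: symG)
  qed
  have "finitely_generated_group G"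
    unfolding finitely_generated_group_def using finv subv genG G.is_group by (intro conjI exI[of _ "set_pmf \<nu>"])
  moreover have "sym_fin_prob_gen G (pmf \<nu>)"
    unfolding sym_fin_prob_gen_def G.fsupp_pmf[OF subv]
  proof (intro conjI ballI allI impI)
    show "pmf \<nu> g = 0" if "g \<notin> carrier G" for g
      using that subv by (metis pmf_eq_0_set_pmf subsetD)
  qed (use finv genG mu_inv in \<open>simp_all add: sum_pmf_eq_1\<close>)
  moreover have "entropy_fun G (pmf \<nu>) n = Hp (pw W \<mu> n)" for n
  proof -
    have "entropy_fun G (pmf \<nu>) n = Hp (pw G \<nu> n)" by (rule G.entropy_fun_pmf[OF finv subv])
    also have "pw G \<nu> n = map_pmf e (pw K \<mu> n)"
      unfolding \<nu>_def by (rule pw_hom[OF K.is_group hom oneG[symmetric] SK])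
    also have "Hp \<dots> = Hp (pw K \<mu> n)"
      by (intro Hp_map_inj finite_set_pw fin inj_on_subset[OF inj] K.set_pw_carrier[OF SK])
    also have "pw K \<mu> n = pw W \<mu> n"
      by (induction n) (simp_all add: K_def pconv_def)
    finally show ?thesis .
  qed
  ultimately show ?thesis by (rule that)
qed

subsection \<open>Random words in two subgroups\<close>

text \<open>The head of the list is the letter multiplied last, matching paths that carry their most
  recent step first.\<close>

fun word_law :: "('l, 'x) monoid_scheme \<Rightarrow> 'p set \<Rightarrow> (bool \<Rightarrow> 'p \<Rightarrow> 'l) \<Rightarrow> bool list \<Rightarrow> 'l pmf" where
  "word_law G P l [] = return_pmf \<one>\<^bsub>G\<^esub>"
| "word_law G P l (t # ts) =
     bind_pmf (word_law G P l ts) (\<lambda>g. map_pmf (\<lambda>p. g \<otimes>\<^bsub>G\<^esub> l t p) (pmf_of_set P))"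

lemma pmf_of_set_translate:
  fixes P :: "'p::ab_group_add set"
  assumes "finite P" "P \<noteq> {}" "\<And>p q. p \<in> P \<Longrightarrow> q \<in> P \<Longrightarrow> p + q \<in> P" "\<And>p. p \<in> P \<Longrightarrow> - p \<in> P" "p \<in> P"
  shows "map_pmf (\<lambda>q. p + q) (pmf_of_set P) = pmf_of_set P"
proof -
  have "bij_betw (\<lambda>q. p + q) P P"
    by (rule bij_betw_byWitness[where f' = "\<lambda>q. - p + q"])
      (use assms(3)[OF \<open>p \<in> P\<close>] assms(3)[OF assms(4)[OF \<open>p \<in> P\<close>]] in auto)
  then show ?thesis using assms by (intro map_pmf_of_set_bij_betw) auto
qed

locale two_letter_group = group G for G :: "('l, 'x) monoid_scheme" (structure) +
  fixes P :: "'p::ab_group_add set" and l :: "bool \<Rightarrow> 'p \<Rightarrow> 'l"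
  assumes finite_P: "finite P" and zero_P: "0 \<in> P"
    and add_P: "\<And>p q. p \<in> P \<Longrightarrow> q \<in> P \<Longrightarrow> p + q \<in> P" and uminus_P: "\<And>p. p \<in> P \<Longrightarrow> - p \<in> P"
    and l_closed: "\<And>t p. p \<in> P \<Longrightarrow> l t p \<in> carrier G"
    and l_add: "\<And>t p q. p \<in> P \<Longrightarrow> q \<in> P \<Longrightarrow> l t (p + q) = l t p \<otimes> l t q"
begin

abbreviation "wl \<equiv> word_law G P l"

lemma P_ne: "P \<noteq> {}"
  using zero_P by auto

lemma card_P_pos: "0 < card P"
  using finite_P P_ne by (simp add: card_gt_0_iff)

lemma l_zero: "l t 0 = \<one>"
  using l_add[of 0 0 t] zero_P l_closed[of 0 t] by (simp add: r_cancel_one')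

lemma l_uminus: "p \<in> P \<Longrightarrow> l t (- p) = inv (l t p)"
  using l_add[of "- p" p t] uminus_P l_closed l_zero by (intro inv_equality[symmetric]) auto

lemma set_wl_carrier: "set_pmf (wl ts) \<subseteq> carrier G"
  by (induction ts) (use l_closed finite_P P_ne in auto)

lemma pmf_map_mult_right:
  assumes "set_pmf p \<subseteq> carrier G" "x \<in> carrier G" "g \<in> carrier G"
  shows "pmf (map_pmf (\<lambda>h. h \<otimes> x) p) g = pmf p (g \<otimes> inv x)"
proof -
  have "((\<lambda>h. h \<otimes> x) -` {g}) \<inter> set_pmf p = {g \<otimes> inv x} \<inter> set_pmf p"
    using assms by (auto simp: m_assoc subset_iff inv_solve_right inv_solve_right')
  then show ?thesis
    unfolding pmf_map by (metis measure_Int_set_pmf measure_pmf_single)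
qed

lemma pmf_wl_Cons_inv:
  assumes "g \<in> carrier G"
  shows "pmf (wl (t # ts)) g = (\<Sum>p\<in>P. pmf (wl ts) (g \<otimes> inv (l t p))) / card P"
proof -
  have "wl (t # ts) = bind_pmf (pmf_of_set P) (\<lambda>p. map_pmf (\<lambda>g. g \<otimes> l t p) (wl ts))"
    by (simp add: map_pmf_def bind_commute_pmf[of "wl ts"])
  then have "pmf (wl (t # ts)) g = (\<Sum>p\<in>P. pmf (map_pmf (\<lambda>g. g \<otimes> l t p) (wl ts)) g) / card P"
    by (simp add: pmf_bind_pmf_of_set finite_P P_ne)
  also have "(\<Sum>p\<in>P. pmf (map_pmf (\<lambda>g. g \<otimes> l t p) (wl ts)) g) = (\<Sum>p\<in>P. pmf (wl ts) (g \<otimes> inv (l t p)))"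
    using assms by (intro sum.cong) (simp_all add: pmf_map_mult_right set_wl_carrier l_closed)
  finally show ?thesis .
qed

lemma pmf_wl_Cons:
  assumes "g \<in> carrier G"
  shows "pmf (wl (t # ts)) g = (\<Sum>p\<in>P. pmf (wl ts) (g \<otimes> l t p)) / card P"
proof -
  have "(\<Sum>p\<in>P. pmf (wl ts) (g \<otimes> inv (l t p))) = (\<Sum>p\<in>P. pmf (wl ts) (g \<otimes> l t (- p)))"
    by (simp add: l_uminus)
  also have "\<dots> = (\<Sum>p\<in>P. pmf (wl ts) (g \<otimes> l t p))"
    by (rule sum.reindex_bij_witness[of _ uminus uminus]) (auto simp: uminus_P)
  finally show ?thesis using pmf_wl_Cons_inv[OF assms, of t ts] by simp
qed

text \<open>The image of the uniform law on \<open>P\<close> under the homomorphism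
  \<open>l t\<close> is idempotent.\<close>

lemma wl_dup: "wl (t # t # ts) = wl (t # ts)"
proof -
  have "wl (t # t # ts) = bind_pmf (wl ts) (\<lambda>g. bind_pmf (pmf_of_set P)
          (\<lambda>p. map_pmf (\<lambda>q. (g \<otimes> l t p) \<otimes> l t q) (pmf_of_set P)))"
    by (simp add: bind_assoc_pmf bind_map_pmf)
  also have "\<dots> = bind_pmf (wl ts) (\<lambda>g. bind_pmf (pmf_of_set P)
          (\<lambda>p. map_pmf (\<lambda>q. g \<otimes> l t q) (map_pmf (\<lambda>q. p + q) (pmf_of_set P))))"
    unfolding pmf.map_comp o_def
    by (intro bind_pmf_cong map_pmf_cong refl)
      (use set_wl_carrier finite_P P_ne in \<open>auto simp: l_add m_assoc l_closed subset_iff\<close>)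
  also have "\<dots> = bind_pmf (wl ts) (\<lambda>g. bind_pmf (pmf_of_set P)
          (\<lambda>p. map_pmf (\<lambda>q. g \<otimes> l t q) (pmf_of_set P)))"
    by (intro bind_pmf_cong refl) (simp add: pmf_of_set_translate add_P uminus_P finite_P P_ne)
  finally show ?thesis by simp
qed

lemma wl_remdups_adj: "wl (remdups_adj ts) = wl ts"
proof (induction ts rule: remdups_adj.induct)
  case (3 x y xs)
  show ?case
  proof (cases "x = y")
    case True
    then show ?thesis using 3 wl_dup[of x xs] by simp
  next
    case False
    then show ?thesis using 3 by simp
  qed
qed simp_all

lemma pmf_wl_Cons_le:
  assumes "\<And>g. pmf (wl ts) g \<le> B"
  shows "pmf (wl (t # ts)) g \<le> B"
proof (cases "g \<in> carrier G")
  case True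
  have "(\<Sum>p\<in>P. pmf (wl ts) (g \<otimes> l t p)) \<le> (\<Sum>p\<in>P. B)"
    by (intro sum_mono assms)
  then show ?thesis using card_P_pos unfolding pmf_wl_Cons[OF True] by (simp add: field_simps)
next
  case False
  then have "pmf (wl (t # ts)) g = 0" using set_wl_carrier[of "t # ts"] by (meson pmf_eq_0_set_pmf subsetD)
  then show ?thesis using order_trans[OF pmf_nonneg assms] by simp
qed

text \<open>Drop the most recent letters until exactly \<open>T\<close> blocks remain. By
  \<open>pmf_wl_Cons_le\<close> the dropped letters only average translates, which cannot raise the
  maximal probability. This reduces long words to words short enough to avoid reduction modulo
  \<open>M\<close>.\<close>

lemma pmf_wl_le_of_long:
  assumes short: "\<And>ts g. length (remdups_adj ts) = T \<Longrightarrow> pmf (wl ts) g \<le> B"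
    and "T \<le> length (remdups_adj ts)"
  shows "pmf (wl ts) g \<le> B"
  using assms(2)
proof (induction ts arbitrary: g)
  case Nil
  then show ?case using short by simp
next
  case (Cons t ts)
  show ?case
  proof (cases "length (remdups_adj (t # ts)) = T")
    case False
    then have "T \<le> length (remdups_adj ts)"
      using Cons.prems by (cases ts) (auto split: if_splits)
    then show ?thesis by (intro pmf_wl_Cons_le Cons.IH)
  qed (rule short)
qed

end

subsection \<open>The groups SL2 over quotients of \<open>F\<^sub>2[X]\<close>\<close>

type_synonym mat2 = "bit poly \<times> bit poly \<times> bit poly \<times> bit poly"

fun mat_mult :: "mat2 \<Rightarrow> mat2 \<Rightarrow> mat2" where
  "mat_mult (a, b, c, d) (a', b', c', d') =
     (a * a' + b * c', a * b' + b * d', c * a' + d * c', c * b' + d * d')"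

fun mat_red :: "bit poly \<Rightarrow> mat2 \<Rightarrow> mat2" where
  "mat_red M (a, b, c, d) = (a mod M, b mod M, c mod M, d mod M)"

fun mat_det :: "mat2 \<Rightarrow> bit poly" where
  "mat_det (a, b, c, d) = a * d - b * c"

fun mat_adj :: "mat2 \<Rightarrow> mat2" where
  "mat_adj (a, b, c, d) = (d, - b, - c, a)"

text \<open>Classes modulo \<open>M\<close> are encoded by reduced representatives, so equality in
  the group is equality of tuples.\<close>

definition SL2 :: "bit poly \<Rightarrow> mat2 monoid" where
  "SL2 M = \<lparr>carrier = {x. mat_red M x = x \<and> mat_det x mod M = 1 mod M},
     mult = (\<lambda>x y. mat_red M (mat_mult x y)), one = mat_red M (1, 0, 0, 1)\<rparr>"

lemma mat_red_mult_left: "mat_red M (mat_mult (mat_red M x) y) = mat_red M (mat_mult x y)"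
  by (cases x; cases y) (auto intro!: mod_add_cong mod_mult_cong)

lemma mat_red_mult_right: "mat_red M (mat_mult x (mat_red M y)) = mat_red M (mat_mult x y)"
  by (cases x; cases y) (auto intro!: mod_add_cong mod_mult_cong)

lemma mat_red_idem: "mat_red M (mat_red M x) = mat_red M x"
  by (cases x) simp

lemma mat_mult_assoc: "mat_mult (mat_mult x y) z = mat_mult x (mat_mult y z)"
  by (cases x; cases y; cases z) (simp add: algebra_simps)

lemma mat_det_red: "mat_det (mat_red M x) mod M = mat_det x mod M"
  by (cases x) (auto intro!: mod_diff_cong mod_mult_cong)

lemma mat_det_mult: "mat_det (mat_mult x y) = mat_det x * mat_det y"
  by (cases x; cases y) (simp add: algebra_simps)

lemma group_SL2: "group (SL2 M)"
proof (rule groupI)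
  fix x y assume "x \<in> carrier (SL2 M)" "y \<in> carrier (SL2 M)"
  then show "x \<otimes>\<^bsub>SL2 M\<^esub> y \<in> carrier (SL2 M)"
    by (simp add: SL2_def mat_red_idem mat_det_red mat_det_mult)
      (metis mod_mult_eq mult_1)
next
  show "\<one>\<^bsub>SL2 M\<^esub> \<in> carrier (SL2 M)" by (simp add: SL2_def mod_simps)
next
  fix x y z
  show "x \<otimes>\<^bsub>SL2 M\<^esub> y \<otimes>\<^bsub>SL2 M\<^esub> z = x \<otimes>\<^bsub>SL2 M\<^esub> (y \<otimes>\<^bsub>SL2 M\<^esub> z)"
    by (simp add: SL2_def mat_red_mult_left mat_red_mult_right mat_mult_assoc)
next
  fix x assume "x \<in> carrier (SL2 M)"
  then show "\<one>\<^bsub>SL2 M\<^esub> \<otimes>\<^bsub>SL2 M\<^esub> x = x"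
    unfolding SL2_def by (cases x) (simp del: mat_red.simps add: mat_red_mult_left)
next
  fix x assume x: "x \<in> carrier (SL2 M)"
  obtain a b c d where abcd: "x = (a, b, c, d)" by (cases x)
  have det: "(a * d - b * c) mod M = 1 mod M" using x by (simp add: SL2_def abcd)
  have "mat_red M (mat_adj x) \<in> carrier (SL2 M)"
    using det by (simp add: SL2_def mat_red_idem mat_det_red abcd algebra_simps del: mat_red.simps)
  moreover have "mat_red M (mat_adj x) \<otimes>\<^bsub>SL2 M\<^esub> x = \<one>\<^bsub>SL2 M\<^esub>"
    using det by (simp add: SL2_def mat_red_mult_left abcd del: mat_red.simps)
      (simp add: algebra_simps)
  ultimately show "\<exists>y\<in>carrier (SL2 M). y \<otimes>\<^bsub>SL2 M\<^esub> x = \<one>\<^bsub>SL2 M\<^esub>" by blast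
qed

definition elem_mat :: "bit poly \<Rightarrow> bool \<Rightarrow> bit poly \<Rightarrow> mat2" where
  "elem_mat M t p = mat_red M (if t then (1, p, 0, 1) else (1, 0, p, 1))"

text \<open>The multiples of \<open>X\<close> of degree at most 6: an additive group in which every
  nonzero member has positive degree. The size 64 is dictated by the arithmetic in
  \<open>pot_step\<close>.\<close>

definition letter_polys :: "bit poly set" where
  "letter_polys = (\<lambda>xs. pCons 0 (Poly xs)) ` {xs. length xs = 6}"

lemma inj_on_Poly_length: "inj_on Poly {xs :: 'a::zero list. length xs = n}"
proof (rule inj_onI, clarsimp)
  fix xs ys :: "'a list"
  assume len: "length ys = length xs" and eq: "Poly xs = Poly ys" 
  show "xs = ys"
  proof (rule nth_equalityI)
    fix i assume "i < length xs"
    then show "xs ! i = ys ! i"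
      using arg_cong[OF eq, of "\<lambda>p. coeff p i"] len by (simp add: nth_default_def)
  qed (simp add: len)
qed

lemma card_bit: "card (UNIV :: bit set) = 2"
proof -
  have "(UNIV :: bit set) = {0, 1}" by (auto intro: bit.exhaust)
  then show ?thesis by (metis card_2_iff zero_neq_one)
qed

lemma finite_bit: "finite (UNIV :: bit set)"
  using card_bit card_ge_0_finite by force

lemma card_bit_lists: "card {xs :: bit list. length xs = n} = 2 ^ n"
  using card_lists_length_eq[OF finite_bit, of n] card_bit by simp

lemma finite_bit_lists: "finite {xs :: bit list. length xs = n}"
  using finite_lists_length_eq[OF finite_bit, of n] by simp

lemma card_letter_polys: "card letter_polys = 64"
proof -
  have "inj_on (\<lambda>xs :: bit list. pCons 0 (Poly xs)) {xs. length xs = 6}"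
    using inj_on_Poly_length[of 6] by (auto simp: inj_on_def)
  then show ?thesis by (simp add: letter_polys_def card_image card_bit_lists)
qed

lemma finite_letter_polys: "finite letter_polys"
  using card_letter_polys card_ge_0_finite by force

lemma mem_letter_polys: "p \<in> letter_polys \<longleftrightarrow> degree p \<le> 6 \<and> coeff p 0 = 0"
proof
  assume "p \<in> letter_polys"
  then obtain xs :: "bit list" where xs: "length xs = 6" "p = pCons 0 (Poly xs)"
    by (auto simp: letter_polys_def)
  have "degree p \<le> 6"
    unfolding xs by (rule degree_le) (auto simp: coeff_pCons nth_default_def xs(1) split: nat.splits)
  then show "degree p \<le> 6 \<and> coeff p 0 = 0" by (simp add: xs)
next
  assume p: "degree p \<le> 6 \<and> coeff p 0 = 0"
  have "p = pCons 0 (Poly (map (\<lambda>i. coeff p (Suc i)) [0..<6]))"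
    using p by (auto simp: poly_eq_iff coeff_pCons nth_default_def coeff_eq_0 split: nat.splits)
  then show "p \<in> letter_polys" unfolding letter_polys_def by (intro image_eqI) auto
qed

lemma two_letter_group_SL2: "two_letter_group (SL2 M) letter_polys (elem_mat M)"
proof -
  interpret group "SL2 M" by (rule group_SL2)
  show ?thesis
  proof
    show "elem_mat M t p \<in> carrier (SL2 M)" for t p
      by (simp add: SL2_def elem_mat_def mat_red_idem mat_det_red del: mat_red.simps)
    show "elem_mat M t (p + q) = elem_mat M t p \<otimes>\<^bsub>SL2 M\<^esub> elem_mat M t q" for t p q
      by (simp add: SL2_def elem_mat_def mat_red_mult_left mat_red_mult_right add.commute
          del: mat_red.simps)
  qed (auto simp: mem_letter_polys finite_letter_polys degree_add_le)
qed

section \<open>Growth of degrees in a matrix row under random letters\<close>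

definition dg :: "bit poly \<Rightarrow> nat" where
  "dg p = (if p = 0 then 0 else Suc (degree p))"

lemma dg_0 [simp]: "dg 0 = 0" and dg_1 [simp]: "dg 1 = 1"
  by (simp_all add: dg_def)

lemma dg_eq_0_iff: "dg p = 0 \<longleftrightarrow> p = 0"
  by (simp add: dg_def)

lemma dg_uminus: "dg (- p) = dg p"
  by (simp add: dg_def)

lemma dg_add_le: "dg (p + q) \<le> max (dg p) (dg q)"
  using degree_add_le_max[of p q] by (auto simp: dg_def)

lemma dg_diff_le: "dg (p - q) \<le> max (dg p) (dg q)"
  using dg_add_le[of p "- q"] by (simp add: dg_uminus)

lemma dg_add_eq: "dg p < dg q \<Longrightarrow> dg (p + q) = dg q"
  using degree_add_eq_right[of p q] by (auto simp: dg_def add_eq_0_iff split: if_splits)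

lemma dg_mult: "p \<noteq> 0 \<Longrightarrow> x \<noteq> 0 \<Longrightarrow> dg (p * x) = degree p + dg x"
  by (simp add: dg_def degree_mult_eq)

lemma dg_mult_le: "dg (p * x) \<le> degree p + dg x"
  by (cases "p = 0 \<or> x = 0") (auto simp: dg_mult)

lemma dg_mod: "dg p \<le> degree M \<Longrightarrow> p mod M = p"
  by (auto simp: dg_def mod_poly_less split: if_splits)

lemma dg_mod_le: "dg (p mod M) \<le> dg p"
proof (cases "M = 0 \<or> dg p \<le> degree M")
  case False
  then have "dg (p mod M) \<le> degree M"
    using degree_mod_less[of M p] by (auto simp: dg_def)
  then show ?thesis using False by simp
qed (auto simp: dg_mod)

lemma degree_letter_poly: "p \<in> letter_polys \<Longrightarrow> p \<noteq> 0 \<Longrightarrow> 1 \<le> degree p"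
  by (metis One_nat_def Suc_leI gr0I leading_coeff_0_iff mem_letter_polys)

text \<open>
  Here \<open>y\<close> is the entry of a row which the next letter modifies, and \<open>x\<close> the one it fixes. The
  letter typically makes the row longer, unless the previous letter was trivial; the constant \<open>3\<close>
  pays for this case.
\<close>

definition pot :: "bit poly \<Rightarrow> bit poly \<Rightarrow> real" where
  "pot x y = (if dg y \<le> dg x then (9/10) ^ dg x else 3 * (9/10) ^ dg y)"

lemma pot_nonneg: "0 \<le> pot x y"
  by (simp add: pot_def)

lemma pot_le: "pot x y \<le> 3"
proof -
  have "(9/10 :: real) ^ n \<le> 1" for n by (simp add: power_le_one)
  from this[of "dg x"] this[of "dg y"] show ?thesis unfolding pot_def by auto
qed

lemma pot_swap_le:
  assumes "dg y \<le> dg x"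
  shows "pot y x \<le> 3 * (9/10) ^ dg x"
  using assms by (cases "dg y = dg x") (auto simp: pot_def)

text \<open>After the letter, \<open>y + p * x\<close> becomes the entry that stays fixed and
  \<open>x\<close> the one modified next, because the kinds alternate; hence the swapped arguments.
  The average of the potential over the 64 letters contracts by 19/20.\<close>

lemma pot_step:
  assumes "x \<noteq> 0 \<or> y \<noteq> 0"
  shows "(\<Sum>p\<in>letter_polys. pot (y + p * x) x) \<le> 64 * ((19/20) * pot x y)"
proof -
  consider "dg y \<le> dg x" "x \<noteq> 0" | "dg x < dg y" "x = 0" | "dg x < dg y" "x \<noteq> 0"
    using assms dg_eq_0_iff[of y] by fastforce
  then show ?thesis
  proof cases
    case 1
    \<comment> \<open>A nonzero letter lengthens the row and gains 9/10; only the zero letter may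
      pay the constant 3. The balance is 64 * 0.9 + 3 = 60.6 against 64 * 0.95 = 60.8; with 32
      letters it would fail.\<close>
    have "pot (y + p * x) x \<le> (9/10) ^ (dg x + 1) + (if p = 0 then 3 * (9/10) ^ dg x else 0)"
      if "p \<in> letter_polys" for p
    proof (cases "p = 0")
      case True
      then show ?thesis using pot_swap_le[OF 1(1)] by (simp add: add_increasing del: power_Suc)
    next
      case False
      have "dg (p * x) \<ge> dg x + 1"
        using degree_letter_poly[OF that False] dg_mult[OF False 1(2)] by simp
      moreover from this have "dg (y + p * x) = dg (p * x)" using 1 by (intro dg_add_eq) simp
      ultimately have "pot (y + p * x) x = (9/10) ^ dg (p * x)" by (simp add: pot_def)
      also have "\<dots> \<le> (9/10) ^ (dg x + 1)"
        using \<open>dg (p * x) \<ge> dg x + 1\<close> by (intro power_decreasing) auto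
      finally show ?thesis using False by simp
    qed
    then have "(\<Sum>p\<in>letter_polys. pot (y + p * x) x)
        \<le> (\<Sum>p\<in>letter_polys. (9/10) ^ (dg x + 1) + (if p = 0 then 3 * (9/10) ^ dg x else 0))"
      by (rule sum_mono)
    also have "\<dots> = 64 * (9/10) ^ (dg x + 1) + 3 * (9/10) ^ dg x"
      by (simp add: sum.distrib card_letter_polys finite_letter_polys mem_letter_polys sum.delta)
    also have "\<dots> \<le> 64 * ((19/20) * pot x y)" using 1 by (simp add: pot_def)
    finally show ?thesis .
  next
    case 2
    then show ?thesis by (simp add: pot_def card_letter_polys)
  next
    case 3
    \<comment> \<open>Letters in \<open>?B\<close> cancel almost all of \<open>y\<close>. Two of
      them would differ by a nonzero multiple of \<open>X\<close>, so there is at most one. Any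
      other letter shortens the longer entry by at most 6, which costs at most
      \<open>(10/9) ^ 6 < 19/10\<close>.\<close>
    let ?B = "{p \<in> letter_polys. dg (y + p * x) \<le> dg x}"
    have pow: "(9/10 :: real) ^ n \<le> 19/10 * (9/10) ^ dg y" if "dg y \<le> n + 6" for n
    proof -
      have "(9/10 :: real) ^ (n + 6) \<le> (9/10) ^ dg y" using that by (intro power_decreasing) auto
      moreover have "(9/10 :: real) ^ n * 1 \<le> (9/10) ^ n * (19/10 * (9/10) ^ 6)"
        by (intro mult_left_mono) (simp_all add: power_divide)
      then have "(9/10 :: real) ^ n \<le> 19/10 * (9/10) ^ (n + 6)" by (simp add: power_add mult_ac)
      ultimately show ?thesis by linarith
    qed
    have bound: "pot (y + p * x) x \<le> 19/10 * (9/10) ^ dg y * (1 + 2 * indicator ?B p)"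
      if p: "p \<in> letter_polys" for p
    proof -
      have "dg y \<le> max (dg (y + p * x)) (dg (p * x))"
        using dg_diff_le[of "y + p * x" "p * x"] by simp
      moreover have "dg (p * x) \<le> 6 + dg x"
        using dg_mult_le[of p x] p by (simp add: mem_letter_polys)
      ultimately have y: "dg y \<le> max (dg (y + p * x)) (6 + dg x)" by linarith
      show ?thesis
      proof (cases "p \<in> ?B")
        case True
        then have "pot (y + p * x) x \<le> 3 * (9/10) ^ dg x" by (intro pot_swap_le) auto
        moreover have "(9/10 :: real) ^ dg x \<le> 19/10 * (9/10) ^ dg y"
          using y True by (intro pow) auto
        ultimately show ?thesis using True by simp
      next
        case False
        then have "pot (y + p * x) x = (9/10) ^ dg (y + p * x)" using p by (simp add: pot_def)
        also have "\<dots> \<le> 19/10 * (9/10) ^ dg y" using y False p by (intro pow) auto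
        finally show ?thesis using False by simp
      qed
    qed
    have "p = p'" if "p \<in> ?B" "p' \<in> ?B" for p p'
    proof (rule ccontr)
      assume "p \<noteq> p'"
      then have "p - p' \<noteq> 0" by simp
      moreover have "p - p' \<in> letter_polys"
        using that by (auto simp: mem_letter_polys intro!: degree_diff_le)
      ultimately have "dg ((p - p') * x) \<ge> 1 + dg x"
        using 3 degree_letter_poly[of "p - p'"] by (simp add: dg_mult)
      moreover have "(p - p') * x = (y + p * x) - (y + p' * x)" by (simp add: algebra_simps)
      moreover have "dg ((y + p * x) - (y + p' * x)) \<le> dg x"
        using dg_diff_le[of "y + p * x" "y + p' * x"] that by auto
      ultimately show False by simp
    qed
    then have cB: "card ?B \<le> 1"
      using finite_letter_polys by (simp add: card_le_Suc0_iff_eq)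
    have "(\<Sum>p\<in>letter_polys. pot (y + p * x) x)
        \<le> (\<Sum>p\<in>letter_polys. 19/10 * (9/10) ^ dg y * (1 + 2 * indicator ?B p))"
      by (rule sum_mono) (rule bound)
    also have "\<dots> = 19/10 * (9/10) ^ dg y * (64 + 2 * card ?B)"
    proof -
      have "(\<Sum>p\<in>letter_polys. indicator ?B p :: real) = card ?B"
        using finite_letter_polys by (simp add: indicator_def sum.If_cases Int_def)
      then have "(\<Sum>p\<in>letter_polys. 1 + 2 * indicator ?B p :: real) = 64 + 2 * card ?B"
        by (simp add: sum_distrib_left[symmetric] sum.distrib card_letter_polys)
      then show ?thesis by (simp only: sum_distrib_left[symmetric])
    qed
    also have "\<dots> \<le> 19/10 * (9/10) ^ dg y * 66" using cB by (intro mult_left_mono) auto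
    also have "\<dots> \<le> 64 * ((19/20) * pot x y)" using 3 by (simp add: pot_def)
    finally show ?thesis .
  qed
qed

lemma SL2_mult_elem:
  "(a, b, c, d) \<otimes>\<^bsub>SL2 M\<^esub> elem_mat M True p = (a mod M, (b + p * a) mod M, c mod M, (d + p * c) mod M)"
  "(a, b, c, d) \<otimes>\<^bsub>SL2 M\<^esub> elem_mat M False p = ((a + p * b) mod M, b mod M, (c + p * d) mod M, d mod M)"
  by (simp_all add: SL2_def elem_mat_def mat_red_mult_right algebra_simps del: mat_red.simps)
    (simp_all add: algebra_simps)

abbreviation "SL2_law M \<equiv> word_law (SL2 M) letter_polys (elem_mat M)"

text \<open>A letter raises the degrees in the first row by at most 6, and reduction modulo
  \<open>M\<close> never raises them.\<close>

lemma dg_SL2_law: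
  assumes "(a, b, c, d) \<in> set_pmf (SL2_law M ts)"
  shows "max (dg a) (dg b) \<le> 1 + 6 * length ts"
  using assms
proof (induction ts arbitrary: a b c d)
  case Nil
  then show ?case using dg_mod_le[of 1 M] by (simp add: SL2_def)
next
  case (Cons t ts)
  interpret two_letter_group "SL2 M" letter_polys "elem_mat M" by (rule two_letter_group_SL2)
  obtain h p where h: "h \<in> set_pmf (SL2_law M ts)" "p \<in> letter_polys"
    "(a, b, c, d) = h \<otimes>\<^bsub>SL2 M\<^esub> elem_mat M t p"
  proof -
    have "set_pmf (SL2_law M (t # ts))
        = (\<Union>g\<in>set_pmf (SL2_law M ts). (\<lambda>p. g \<otimes>\<^bsub>SL2 M\<^esub> elem_mat M t p) ` letter_polys)"
      using finite_letter_polys P_ne by simp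
    then show thesis using Cons.prems that by blast
  qed
  obtain a' b' c' d' where "h = (a', b', c', d')" by (cases h)
  note g = h[unfolded this]
  have IH: "dg a' \<le> 1 + 6 * length ts" "dg b' \<le> 1 + 6 * length ts" using Cons.IH[OF g(1)] by auto
  have "dg ((u + p * v) mod M) \<le> 6 + (1 + 6 * length ts)"
    if "dg u \<le> 1 + 6 * length ts" "dg v \<le> 1 + 6 * length ts" for u v
    using dg_mod_le[of "u + p * v" M] dg_add_le[of u "p * v"] dg_mult_le[of p v] that g(2)
    unfolding mem_letter_polys by linarith
  moreover have "dg (u mod M) \<le> 6 + (1 + 6 * length ts)" if "dg u \<le> 1 + 6 * length ts" for u
    using dg_mod_le[of u M] that by linarith
  ultimately show ?case using g(3) IH by (cases t) (auto simp: SL2_mult_elem)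
qed

text \<open>By \<open>pmf_wl_Cons\<close> the word can be undone letter by letter from the target
  matrix. Typical letters lengthen its first row, so arriving at the row \<open>(1, 0)\<close> of
  the identity is exponentially unlikely. The last hypothesis leaves room for all letters, so no
  reduction modulo \<open>M\<close> occurs on the way. The factor 10/9 normalises the potential at
  the identity, where it is at least 9/10.\<close>

lemma SL2_law_le_pot:
  assumes "distinct_adj ts" "ts = [] \<or> hd ts = t" "(a, b, c, d) \<in> carrier (SL2 M)" "0 < degree M"
    and "max (dg a) (dg b) + 6 * length ts \<le> degree M"
  shows "pmf (SL2_law M ts) (a, b, c, d)
           \<le> 10/9 * ((19/20) ^ length ts * (if t then pot a b else pot b a))"
  using assms
proof (induction ts arbitrary: t a b c d)
  case Nil
  have "1 mod M = 1" using Nil by (intro dg_mod) simp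
  then have one: "\<one>\<^bsub>SL2 M\<^esub> = (1, 0, 0, 1)" by (simp add: SL2_def)
  show ?case
  proof (cases "(a, b, c, d) = (1, 0, 0, 1)")
    case True
    then show ?thesis by (simp add: one pot_def)
  next
    case False
    then have "pmf (SL2_law M []) (a, b, c, d) = 0" by (simp add: one)
    then show ?thesis using pot_nonneg by simp
  qed
next
  case (Cons s ts)
  interpret two_letter_group "SL2 M" letter_polys "elem_mat M" by (rule two_letter_group_SL2)
  have st: "s = t" using Cons.prems by simp
  have ts: "distinct_adj ts" "ts = [] \<or> hd ts = (\<not> t)"
    using Cons.prems(1) st by (auto simp: distinct_adj_Cons)
  have "a \<noteq> 0 \<or> b \<noteq> 0"
  proof (rule ccontr)
    assume "\<not> ?thesis"
    then have "1 mod M = 0" using Cons.prems by (simp add: SL2_def)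
    moreover have "1 mod M = 1" using Cons.prems by (intro dg_mod) simp
    ultimately show False by simp
  qed
  define x y where "x = (if t then a else b)" and "y = (if t then b else a)"
  have xy: "x \<noteq> 0 \<or> y \<noteq> 0" using \<open>a \<noteq> 0 \<or> b \<noteq> 0\<close> by (auto simp: x_def y_def)
  have step: "pmf (SL2_law M ts) ((a, b, c, d) \<otimes>\<^bsub>SL2 M\<^esub> elem_mat M t p)
      \<le> 10/9 * ((19/20) ^ length ts * pot (y + p * x) x)" if p: "p \<in> letter_polys" for p
  proof -
    have "dg (y + p * x) \<le> max (dg a) (dg b) + 6"
      using dg_add_le[of y "p * x"] dg_mult_le[of p x] p
      by (simp add: mem_letter_polys x_def y_def split: if_splits)
    then have deg: "max (dg x) (dg (y + p * x)) + 6 * length ts \<le> degree M"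
      using Cons.prems(5) by (auto simp: x_def)
    then have m: "(y + p * x) mod M = y + p * x" "x mod M = x" by (auto intro!: dg_mod)
    obtain c' d' where eq: "(a, b, c, d) \<otimes>\<^bsub>SL2 M\<^esub> elem_mat M t p
        = (if t then x else y + p * x, if t then y + p * x else x, c', d')"
      using m by (cases t) (auto simp: SL2_mult_elem x_def y_def)
    have mem: "(a, b, c, d) \<otimes>\<^bsub>SL2 M\<^esub> elem_mat M t p \<in> carrier (SL2 M)"
      using Cons.prems p by (intro m_closed l_closed)
    show ?thesis
      using Cons.IH[OF ts mem[unfolded eq] Cons.prems(4)] deg unfolding eq by (cases t) auto
  qed
  have "pmf (SL2_law M (s # ts)) (a, b, c, d)
      = (\<Sum>p\<in>letter_polys. pmf (SL2_law M ts) ((a, b, c, d) \<otimes>\<^bsub>SL2 M\<^esub> elem_mat M t p)) / 64"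
    unfolding st using pmf_wl_Cons[OF Cons.prems(3)] by (simp add: card_letter_polys)
  also have "\<dots> \<le> (\<Sum>p\<in>letter_polys. 10/9 * ((19/20) ^ length ts * pot (y + p * x) x)) / 64"
    by (intro divide_right_mono sum_mono step) auto
  also have "\<dots> = 10/9 * ((19/20) ^ length ts * (\<Sum>p\<in>letter_polys. pot (y + p * x) x)) / 64"
    by (simp add: sum_distrib_left)
  also have "\<dots> \<le> 10/9 * ((19/20) ^ length ts * (64 * ((19/20) * pot x y))) / 64"
    using pot_step[OF xy] by (intro divide_right_mono mult_left_mono) auto
  finally show ?case unfolding st x_def y_def by (cases t) (simp_all add: mult_ac)
qed

text \<open>Rows reached by \<open>T\<close> letters have \<open>dg\<close> at most
  \<open>1 + 6 * T\<close>, and undoing the letters needs room for another \<open>6 * T\<close>;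
  hence the condition \<open>12 * T < degree M\<close>. The constant 4 covers 10/9 times the maximum
  3 of the potential.\<close>

lemma SL2_law_le:
  assumes "12 * T < degree M" "T \<le> length (remdups_adj ts)"
  shows "pmf (SL2_law M ts) g \<le> 4 * (19/20) ^ T"
proof -
  interpret two_letter_group "SL2 M" letter_polys "elem_mat M" by (rule two_letter_group_SL2)
  show ?thesis
  proof (rule pmf_wl_le_of_long[OF _ assms(2)])
    fix ts :: "bool list" and g
    assume len: "length (remdups_adj ts) = T"
    let ?ts = "remdups_adj ts"
    show "pmf (SL2_law M ts) g \<le> 4 * (19/20) ^ T"
    proof (cases "g \<in> set_pmf (SL2_law M ?ts)")
      case True
      obtain a b c d where g: "g = (a, b, c, d)" by (cases g)
      have "max (dg a) (dg b) + 6 * length ?ts \<le> degree M"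
        using dg_SL2_law[OF True[unfolded g]] assms(1) len by linarith
      then have "pmf (SL2_law M ?ts) g
          \<le> 10/9 * ((19/20) ^ length ?ts * (if hd ?ts then pot a b else pot b a))"
        unfolding g using True set_wl_carrier[of ?ts] assms(1) g
        by (intro SL2_law_le_pot) auto
      also have "\<dots> \<le> 10/9 * ((19/20) ^ length ?ts * 3)"
        using pot_le by (intro mult_left_mono) auto
      also have "\<dots> \<le> 4 * (19/20) ^ T" by (simp add: len)
      finally show ?thesis by (simp add: wl_remdups_adj)
    next
      case False
      then show ?thesis by (simp add: wl_remdups_adj pmf_eq_0_set_pmf[symmetric])
    qed
  qed
qed

lemma carrier_SL2:
  assumes "0 < m"
  shows "finite (carrier (SL2 (monom 1 m)))" and "card (carrier (SL2 (monom 1 m))) \<le> 2 ^ (4 * m)"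
proof -
  let ?Q = "Poly ` {xs :: bit list. length xs = m}"
  have "p \<in> ?Q" if "p mod monom 1 m = p" for p :: "bit poly"
  proof -
    have "degree p < m"
      using that assms degree_mod_less'[of "monom 1 m :: bit poly" p] degree_monom_eq[of "1::bit" m]
      by (cases "p = 0") auto
    then have "p = Poly (map (coeff p) [0..<m])"
      by (auto simp: poly_eq_iff nth_default_def coeff_eq_0)
    then show ?thesis by (intro image_eqI) auto
  qed
  then have sub: "carrier (SL2 (monom 1 m)) \<subseteq> ?Q \<times> ?Q \<times> ?Q \<times> ?Q"
    by (auto simp: SL2_def)
  have fin: "finite (?Q \<times> ?Q \<times> ?Q \<times> ?Q)" by (simp add: finite_bit_lists)
  show "finite (carrier (SL2 (monom 1 m)))" using sub fin by (rule finite_subset)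
  have "card ?Q = 2 ^ m"
    unfolding card_image[OF inj_on_Poly_length] by (rule card_bit_lists)
  then have "card (?Q \<times> ?Q \<times> ?Q \<times> ?Q) = 2 ^ (4 * m)"
    by (simp add: card_cartesian_product power_mult[symmetric] power_add[symmetric])
  then show "card (carrier (SL2 (monom 1 m))) \<le> 2 ^ (4 * m)"
    using card_mono[OF fin sub] by simp
qed

subsection \<open>Simple random walk on the integers\<close>

text \<open>Paths are lists of steps, the most recent step first.\<close>

fun srw :: "nat \<Rightarrow> int list pmf" where
  "srw 0 = return_pmf []"
| "srw (Suc n) = bind_pmf (srw n) (\<lambda>xs. map_pmf (\<lambda>e. e # xs) (pmf_of_set {1, -1}))"

lemma finite_set_srw: "finite (set_pmf (srw n))"
  by (induction n) auto

lemma avg_srw_Suc: "avg (srw (Suc n)) F = avg (srw n) (\<lambda>xs. (F (1 # xs) + F (- 1 # xs)) / 2)"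
proof -
  have "avg (srw (Suc n)) F
      = avg (srw n) (\<lambda>xs. avg (map_pmf (\<lambda>e. e # xs) (pmf_of_set {1, -1})) F)"
    unfolding srw.simps by (rule avg_bind) (auto simp: finite_set_srw)
  also have "\<dots> = avg (srw n) (\<lambda>xs. (F (1 # xs) + F (- 1 # xs)) / 2)"
    by (simp add: avg_map avg_pmf_of_set)
  finally show ?thesis .
qed

text \<open>\<open>foldr\<close> processes a path from its oldest step. \<open>srw\<close> is built
  by adding the newest step; conditioning on the first step instead is what the recursion for
  hitting probabilities needs.\<close>

lemma avg_srw_foldr_Suc:
  "avg (srw (Suc n)) (\<lambda>xs. \<phi> (foldr U xs s))
     = (avg (srw n) (\<lambda>xs. \<phi> (foldr U xs (U 1 s))) + avg (srw n) (\<lambda>xs. \<phi> (foldr U xs (U (- 1) s)))) / 2"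
proof (induction n arbitrary: \<phi>)
  case 0
  show ?case by (simp add: avg_srw_Suc del: srw.simps(2))
next
  case (Suc n)
  let ?\<psi> = "\<lambda>s. (\<phi> (U 1 s) + \<phi> (U (- 1) s)) / 2"
  have 1: "avg (srw (Suc (Suc n))) (\<lambda>xs. \<phi> (foldr U xs s)) = avg (srw (Suc n)) (\<lambda>xs. ?\<psi> (foldr U xs s))"
    by (subst avg_srw_Suc) simp
  have 2: "avg (srw n) (\<lambda>xs. ?\<psi> (foldr U xs s')) = avg (srw (Suc n)) (\<lambda>xs. \<phi> (foldr U xs s'))" for s'
    by (subst avg_srw_Suc) simp
  show ?case unfolding 1 Suc.IH[of ?\<psi>] 2 ..
qed

subsubsection \<open>Hitting probabilities\<close>

text \<open>The probability that simple random walk climbs by \<open>D\<close> within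
  \<open>n\<close> steps, through its first-step recursion.\<close>

fun hit :: "nat \<Rightarrow> int \<Rightarrow> real" where
  "hit 0 D = (if D \<le> 0 then 1 else 0)"
| "hit (Suc n) D = (if D \<le> 0 then 1 else (hit n (D + 1) + hit n (D - 1)) / 2)"

lemma hit_nonneg: "0 \<le> hit n D"
  by (induction n arbitrary: D) auto

lemma hit_le_1: "hit n D \<le> 1"
proof (induction n arbitrary: D)
  case (Suc n)
  from Suc[of "D + 1"] Suc[of "D - 1"] show ?case by simp
qed simp

lemma hit_nonpos [simp]: "D \<le> 0 \<Longrightarrow> hit n D = 1"
  by (cases n) auto

text \<open>
  The right-hand side is the expected exit time from \<open>(-D, D)\<close>, and the factor of \<open>n\<close> on the left
  bounds the probability of having stayed inside.
\<close>

lemma hit_two_sided: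
  assumes "\<bar>x\<bar> \<le> D"
  shows "real n * (1 - hit n (D - x) - hit n (D + x)) \<le> real_of_int (D ^ 2 - x ^ 2)"
  using assms
proof (induction n arbitrary: x)
  case 0
  then show ?case using abs_le_square_iff[of x D] by (simp del: of_int_diff of_int_power)
next
  case (Suc n)
  show ?case
  proof (cases "\<bar>x\<bar> = D")
    case True
    then have "D - x \<le> 0 \<or> D + x \<le> 0" by linarith
    then have "1 - hit (Suc n) (D - x) - hit (Suc n) (D + x) \<le> 0"
      using hit_nonneg[of "Suc n" "D - x"] hit_nonneg[of "Suc n" "D + x"]
        hit_nonpos[of "D - x" "Suc n"] hit_nonpos[of "D + x" "Suc n"] by (auto simp del: hit.simps)
    then have "real (Suc n) * (1 - hit (Suc n) (D - x) - hit (Suc n) (D + x)) \<le> 0"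
      by (intro mult_nonneg_nonpos) auto
    also have "0 \<le> real_of_int (D ^ 2 - x ^ 2)" using True by (metis diff_self order_refl power2_abs of_int_0)
    finally show ?thesis .
  next
    case False
    then have x: "\<bar>x\<bar> < D" using Suc.prems by simp
    let ?g = "\<lambda>n x. 1 - hit n (D - x) - hit n (D + x)"
    have g: "?g (Suc n) x = (?g n (x + 1) + ?g n (x - 1)) / 2"
      using x by (simp add: field_simps)
    have le1: "?g (Suc n) x \<le> 1"
      using hit_nonneg[of "Suc n" "D - x"] hit_nonneg[of "Suc n" "D + x"] by linarith
    have "real (Suc n) * ?g (Suc n) x = real n * ?g (Suc n) x + ?g (Suc n) x"
      by (simp add: distrib_right del: hit.simps)
    also have "\<dots> = (real n * ?g n (x + 1) + real n * ?g n (x - 1)) / 2 + ?g (Suc n) x"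
      unfolding g by (simp add: algebra_simps add_divide_distrib)
    also have "\<dots> \<le> (real_of_int (D ^ 2 - (x + 1) ^ 2) + real_of_int (D ^ 2 - (x - 1) ^ 2)) / 2 + 1"
      using Suc.IH[of "x + 1"] Suc.IH[of "x - 1"] x le1
      by (intro add_mono divide_right_mono) auto
    also have "\<dots> = real_of_int (D ^ 2 - x ^ 2)"
      by (simp add: power2_eq_square field_simps)
    finally show ?thesis .
  qed
qed

lemma hit_ge:
  assumes "0 < n" "0 \<le> D"
  shows "(1 - real_of_int D ^ 2 / n) / 2 \<le> hit n D"
  using hit_two_sided[of 0 D n] assms by (simp add: field_simps)

subsubsection \<open>Alternating visits to two sites\<close>

text \<open>Records the kind of letter that the site \<open>x\<close> receives: the first kind with
  the cursor at \<open>x\<close>, the second with the cursor at \<open>x - k\<close>.\<close>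

definition visit :: "int \<Rightarrow> int \<Rightarrow> int \<Rightarrow> bool list \<Rightarrow> bool list" where
  "visit k x c ts = (if c = x then True # ts else if c + k = x then False # ts else ts)"

fun visits :: "int \<Rightarrow> int \<Rightarrow> int list \<Rightarrow> bool list" where
  "visits k x [] = visit k x 0 []"
| "visits k x (e # xs) = visit k x (sum_list (e # xs)) (visits k x xs)"

abbreviation "alt ts \<equiv> length (remdups_adj ts)"

lemma alt_Cons: "alt (t # ts) = (if ts \<noteq> [] \<and> hd ts = t then alt ts else Suc (alt ts))"
  by (cases ts) auto

definition vstep :: "int \<Rightarrow> int \<Rightarrow> int \<Rightarrow> int \<times> bool list \<Rightarrow> int \<times> bool list" where
  "vstep k x e s = (fst s + e, visit k x (fst s + e) (snd s))"

lemma foldr_vstep: "foldr (vstep k x) xs (0, visit k x 0 []) = (sum_list xs, visits k x xs)"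
  by (induction xs) (simp_all add: vstep_def add.commute)

lemma alt_foldr_vstep: "alt (snd s) \<le> alt (snd (foldr (vstep k x) xs s))"
  by (induction xs) (auto simp: vstep_def visit_def alt_Cons)

text \<open>Reflect the walk whenever it reaches its current target, alternately \<open>x\<close>
  and \<open>x - k\<close>: the alternations become progress of one simple random walk towards a
  distant level. \<open>D\<close> bounds the remaining distance, namely to the next target plus
  \<open>k\<close> for each further alternation. The two disjuncts are heading up to
  \<open>x\<close> and heading down to \<open>x - k\<close>.\<close>

lemma alt_visits_ge_hit_aux:
  assumes "0 < k"
    and "((snd s = [] \<or> \<not> hd (snd s)) \<and> fst s < x \<and> (x - fst s) + k * (int T - 1 - int (alt (snd s))) \<le> D)
       \<or> (snd s \<noteq> [] \<and> hd (snd s) \<and> x - k < fst s \<and> (fst s - (x - k)) + k * (int T - 1 - int (alt (snd s))) \<le> D)"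
  shows "hit n D \<le> avg (srw n) (\<lambda>xs. of_bool (T \<le> alt (snd (foldr (vstep k x) xs s))))"
  using assms(2)
proof (induction n arbitrary: s D)
  case (0 s D)
  show ?case
  proof (cases "T \<le> alt (snd s)")
    case False
    then have "0 \<le> k * (int T - 1 - int (alt (snd s)))" using assms(1) by simp
    then have "0 < D" using 0 by linarith
    then show ?thesis by simp
  qed simp
next
  case (Suc n s D)
  show ?case
  proof (cases "T \<le> alt (snd s)")
    case True
    then have "T \<le> alt (snd (foldr (vstep k x) xs s))" for xs
      using alt_foldr_vstep le_trans by blast
    then show ?thesis using hit_le_1 by (simp add: avg_const finite_set_srw del: srw.simps hit.simps)
  next
    case False
    let ?K = "\<lambda>a. k * (int T - 1 - int a)"
    define P where "P s = avg (srw n) (\<lambda>xs. of_bool (T \<le> alt (snd (foldr (vstep k x) xs s))))" for s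
    obtain c ts where s: "s = (c, ts)" by (cases s)
    have K: "0 \<le> ?K (alt ts)" using False s assms(1) by simp
    have KS: "?K (Suc a) = ?K a - k" for a by (simp add: algebra_simps)
    have Kmono: "?K (alt ts') \<le> ?K (alt ts)" if "alt ts \<le> alt ts'" for ts'
      using that assms(1) by simp
    have "0 < D" using Suc.prems K s by auto
    have "(hit n (D + 1) + hit n (D - 1)) / 2 \<le> (P (vstep k x 1 s) + P (vstep k x (- 1) s)) / 2"
      using Suc.prems
    proof
      assume B: "(snd s = [] \<or> \<not> hd (snd s)) \<and> fst s < x \<and> (x - fst s) + ?K (alt (snd s)) \<le> D"
      have "hit n (D - 1) \<le> P (vstep k x 1 s)"
      proof (cases "c + 1 = x")
        case True
        have "alt (True # ts) = Suc (alt ts)" using B s by (auto simp: alt_Cons)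
        then show ?thesis using B s True KS[of "alt ts"] assms(1)
          unfolding P_def by (intro Suc.IH) (auto simp: vstep_def visit_def)
      next
        case F: False
        show ?thesis using B s F assms(1) Kmono[of "False # ts"]
          unfolding P_def by (intro Suc.IH) (auto simp: vstep_def visit_def alt_Cons algebra_simps)
      qed
      moreover have "hit n (D + 1) \<le> P (vstep k x (- 1) s)"
        using B s assms(1) Kmono[of "False # ts"]
        unfolding P_def by (intro Suc.IH) (auto simp: vstep_def visit_def alt_Cons algebra_simps)
      ultimately show ?thesis
        by (subst add.commute) (intro divide_right_mono add_mono; simp)
    next
      assume A: "snd s \<noteq> [] \<and> hd (snd s) \<and> x - k < fst s \<and> (fst s - (x - k)) + ?K (alt (snd s)) \<le> D"
      have "hit n (D - 1) \<le> P (vstep k x (- 1) s)"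
      proof (cases "c - 1 = x - k")
        case True
        have "alt (False # ts) = Suc (alt ts)" using A s by (auto simp: alt_Cons)
        then show ?thesis using A s True KS[of "alt ts"] assms(1)
          unfolding P_def by (intro Suc.IH) (auto simp: vstep_def visit_def)
      next
        case F: False
        show ?thesis using A s F assms(1)
          unfolding P_def by (intro Suc.IH) (auto simp: vstep_def visit_def alt_Cons algebra_simps)
      qed
      moreover have "hit n (D + 1) \<le> P (vstep k x 1 s)"
        using A s assms(1)
        unfolding P_def by (intro Suc.IH) (auto simp: vstep_def visit_def alt_Cons algebra_simps)
      ultimately show ?thesis by (intro divide_right_mono add_mono) simp_all
    qed
    then show ?thesis
      using \<open>0 < D\<close>
        avg_srw_foldr_Suc[of n "\<lambda>s. of_bool (T \<le> alt (snd s))" "vstep k x" s]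
      by (simp add: P_def del: srw.simps)
  qed
qed

lemma alt_visits_ge:
  assumes "0 < k" "0 < x" "0 < n"
  shows "(1 - (real_of_int (x + k * T)) ^ 2 / n) / 2 \<le> avg (srw n) (\<lambda>xs. of_bool (T \<le> alt (visits k x xs)))"
proof -
  have "(1 - (real_of_int (x + k * T)) ^ 2 / n) / 2 \<le> hit n (x + k * T)"
    using assms by (intro hit_ge) auto
  also have "\<dots> \<le> avg (srw n) (\<lambda>xs. of_bool (T \<le> alt (snd (foldr (vstep k x) xs (0, visit k x 0 [])))))"
    using assms by (intro alt_visits_ge_hit_aux) (auto simp: visit_def algebra_simps)
  finally show ?thesis by (simp add: foldr_vstep)
qed

subsubsection \<open>Confinement\<close>

fun stays :: "int \<Rightarrow> int list \<Rightarrow> bool" where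
  "stays r [] = True"
| "stays r (e # xs) = (stays r xs \<and> \<bar>sum_list (e # xs)\<bar> \<le> r)"

text \<open>For the position \<open>S\<close> of the walk,
  \<open>cosh (\<theta> * S) / cosh \<theta> ^ n\<close> is a martingale. \<open>F\<close> freezes
  its numerator at \<open>cosh (\<theta> * r)\<close> upon exit; the true value there is at least as
  large, so freezing only lowers the mean.\<close>

lemma exit_cosh:
  fixes \<theta> :: real
  assumes "0 \<le> \<theta>" "0 \<le> r"
  shows "avg (srw n) (\<lambda>xs. of_bool (\<not> stays r xs)) * cosh (\<theta> * r) \<le> cosh \<theta> ^ n"
proof -
  define F where "F xs = (if stays r xs then cosh (\<theta> * real_of_int (sum_list xs)) else cosh (\<theta> * r))" for xs
  have F_le: "F (e # xs) \<le> cosh (\<theta> * real_of_int (e + sum_list xs))" if "stays r xs" for e xs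
  proof (cases "stays r (e # xs)")
    case False
    then have "\<theta> * r \<le> \<theta> * \<bar>real_of_int (e + sum_list xs)\<bar>"
      using that assms by (intro mult_left_mono) auto
    then have "cosh (\<theta> * r) \<le> cosh (\<bar>\<theta> * real_of_int (e + sum_list xs)\<bar>)"
      using assms by (subst cosh_real_nonneg_le_iff) (auto simp: abs_mult)
    then show ?thesis using False by (simp add: F_def)
  qed (simp add: F_def)
  have "avg (srw n) F \<le> cosh \<theta> ^ n"
  proof (induction n)
    case 0
    show ?case by (simp add: F_def)
  next
    case (Suc n)
    have "(F (1 # xs) + F (- 1 # xs)) / 2 \<le> cosh \<theta> * F xs" for xs
    proof (cases "stays r xs")
      case True
      have "(F (1 # xs) + F (- 1 # xs)) / 2
          \<le> (cosh (\<theta> + \<theta> * sum_list xs) + cosh (\<theta> * sum_list xs - \<theta>)) / 2"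
        using F_le[OF True, of 1] F_le[OF True, of "- 1"] by (simp add: algebra_simps)
      also have "\<dots> = cosh \<theta> * cosh (\<theta> * sum_list xs)"
        by (simp add: cosh_add cosh_diff algebra_simps)
      finally show ?thesis using True by (simp add: F_def)
    next
      case False
      then show ?thesis using cosh_real_ge_1[of \<theta>] by (simp add: F_def)
    qed
    then have "avg (srw (Suc n)) F \<le> avg (srw n) (\<lambda>xs. cosh \<theta> * F xs)"
      unfolding avg_srw_Suc by (intro avg_mono)
    also have "\<dots> \<le> cosh \<theta> ^ Suc n" using Suc cosh_real_ge_1[of \<theta>] by (simp add: avg_cmult)
    finally show ?case .
  qed
  moreover have "avg (srw n) (\<lambda>xs. cosh (\<theta> * r) * of_bool (\<not> stays r xs)) \<le> avg (srw n) F"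
    by (intro avg_mono) (auto simp: F_def)
  ultimately show ?thesis unfolding avg_cmult by (simp add: mult.commute)
qed

lemma cosh_le: "0 \<le> x \<Longrightarrow> x \<le> 1 \<Longrightarrow> cosh x \<le> 1 + x ^ 2" for x :: real
proof -
  assume x: "0 \<le> x" "x \<le> 1"
  have "exp (- x) \<le> 1 / (1 + x)"
    using x exp_ge_add_one_self[of x] by (simp add: exp_minus field_simps)
  also have "\<dots> \<le> 1 - x + x ^ 2"
    using x by (simp add: field_simps power2_eq_square)
  finally show ?thesis using exp_bound[OF x] by (simp add: cosh_field_def)
qed

text \<open>Take \<open>\<theta> = 1 / sqrt n\<close>, which keeps \<open>cosh \<theta> ^ n\<close>
  below \<open>exp 1 \<le> 3\<close>. The 6 is this 3 times the 2 from
  \<open>cosh y \<ge> exp y / 2\<close>.\<close>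

lemma exit_prob_le:
  assumes "0 < n" "0 \<le> r"
  shows "avg (srw n) (\<lambda>xs. of_bool (\<not> stays r xs)) \<le> 6 * exp (- (r / sqrt n))"
proof -
  define \<theta> where "\<theta> = 1 / sqrt n"
  have \<theta>: "0 \<le> \<theta>" "\<theta> \<le> 1" using assms by (auto simp: \<theta>_def)
  have "cosh \<theta> \<le> 1 + 1 / n" using cosh_le[OF \<theta>] assms by (simp add: \<theta>_def power_divide)
  also have "\<dots> \<le> exp (1 / n)" by (rule exp_ge_add_one_self)
  finally have "cosh \<theta> ^ n \<le> exp (1 / n) ^ n"
    by (intro power_mono) auto
  also have "\<dots> = exp 1" using assms by (simp flip: exp_of_nat_mult)
  also have "\<dots> \<le> 3" by (rule exp_le)
  finally have 1: "avg (srw n) (\<lambda>xs. of_bool (\<not> stays r xs)) * cosh (\<theta> * r) \<le> 3"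
    using exit_cosh[OF \<theta>(1) assms(2), of n] by linarith
  have "exp (\<theta> * r) / 2 \<le> cosh (\<theta> * r)" by (simp add: cosh_field_def)
  then have "avg (srw n) (\<lambda>xs. of_bool (\<not> stays r xs)) * (exp (\<theta> * r) / 2) \<le> 3"
    using 1 by (smt (verit) avg_nonneg mult_left_mono of_bool_def)
  then show ?thesis by (simp add: \<theta>_def exp_minus field_simps)
qed

section \<open>Convolutions: inversion, entropy and size of the support\<close>

lemma (in group) map_inv_pconv:
  assumes "set_pmf p \<subseteq> carrier G" "set_pmf q \<subseteq> carrier G"
  shows "map_pmf (\<lambda>x. inv x) (pconv G p q) = pconv G (map_pmf (\<lambda>x. inv x) q) (map_pmf (\<lambda>x. inv x) p)"
proof -
  have "map_pmf (\<lambda>x. inv x) (pconv G p q) = bind_pmf p (\<lambda>x. bind_pmf q (\<lambda>y. return_pmf (inv (x \<otimes> y))))"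
    by (simp add: pconv_def map_bind_pmf pmf.map_comp o_def map_pmf_def[of _ q])
  also have "\<dots> = bind_pmf p (\<lambda>x. bind_pmf q (\<lambda>y. return_pmf (inv y \<otimes> inv x)))"
    by (intro bind_pmf_cong refl) (use assms in \<open>auto simp: inv_mult_group subset_iff\<close>)
  also have "\<dots> = bind_pmf q (\<lambda>y. bind_pmf p (\<lambda>x. return_pmf (inv y \<otimes> inv x)))"
    by (rule bind_commute_pmf)
  finally show ?thesis by (simp add: pconv_def map_pmf_def bind_assoc_pmf bind_return_pmf)
qed

lemma Hp_pconv_le:
  assumes "finite (set_pmf p)" "finite (set_pmf q)"
  shows "Hp (pconv W p q) \<le> Hp p + Hp q"
proof -
  have "pconv W p q = map_pmf (\<lambda>(x, y). x \<otimes>\<^bsub>W\<^esub> y) (pair_pmf p q)"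
    by (simp add: pconv_def pair_pmf_def map_bind_pmf map_pmf_def bind_assoc_pmf bind_return_pmf)
  then have "Hp (pconv W p q) \<le> Hp (pair_pmf p q)"
    using assms by (simp add: Hp_map_le)
  also have "\<dots> \<le> Hp p + Hp q" by (rule Hp_pair_le[OF assms])
  finally show ?thesis .
qed

text \<open>Given the second factor, the product is an injective image of the first, so concavity
  applies. This makes entropy monotone in time.\<close>

lemma (in group) Hp_pconv_ge:
  assumes "finite (set_pmf p)" "finite (set_pmf q)" "set_pmf p \<subseteq> carrier G" "set_pmf q \<subseteq> carrier G"
  shows "Hp p \<le> Hp (pconv G p q)"
proof -
  have eq: "pconv G p q = bind_pmf q (\<lambda>y. map_pmf (\<lambda>x. x \<otimes> y) p)"
    unfolding pconv_def map_pmf_def by (rule bind_commute_pmf)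
  have "inj_on (\<lambda>x. x \<otimes> y) (set_pmf p)" if "y \<in> set_pmf q" for y
    using assms that by (auto intro!: inj_onI simp: subset_iff)
  then have "Hp p = avg q (\<lambda>y. Hp (map_pmf (\<lambda>x. x \<otimes> y) p))"
    using assms by (subst avg_cong[where g = "\<lambda>_. Hp p"]) (auto simp: avg_const Hp_map_inj)
  also have "\<dots> \<le> Hp (pconv G p q)"
    unfolding eq using assms by (intro Hp_bind_ge) auto
  finally show ?thesis .
qed

lemma card_set_pconv:
  assumes "finite (set_pmf p)" "finite (set_pmf q)"
  shows "card (set_pmf (pconv W p q)) \<le> card (set_pmf p) * card (set_pmf q)"
proof -
  have "set_pmf (pconv W p q) = (\<lambda>(x, y). x \<otimes>\<^bsub>W\<^esub> y) ` (set_pmf p \<times> set_pmf q)"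
    by (auto simp: set_pconv)
  then show ?thesis
    using card_image_le[of "set_pmf p \<times> set_pmf q"] assms by (simp add: card_cartesian_product)
qed

lemma card_set_pw: "finite (set_pmf \<mu>) \<Longrightarrow> card (set_pmf (pw W \<mu> n)) \<le> card (set_pmf \<mu>) ^ n"
proof (induction n)
  case (Suc n)
  have "card (set_pmf (pw W \<mu> (Suc n))) \<le> card (set_pmf (pw W \<mu> n)) * card (set_pmf \<mu>)"
    using card_set_pconv[OF finite_set_pw Suc.prems] Suc.prems by simp
  also have "\<dots> \<le> card (set_pmf \<mu>) ^ n * card (set_pmf \<mu>)" using Suc by simp
  finally show ?case by (simp add: mult.commute)
qed simp

lemma prod_split_two:
  fixes F :: "'a \<Rightarrow> 'b::comm_monoid_mult"
  assumes "finite A" "c \<noteq> d"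
  shows "prod F A = (if c \<in> A then F c else 1) * (if d \<in> A then F d else 1) * prod F (A - {c, d})"
proof -
  have "prod F A = prod F (A \<inter> {c, d}) * prod F (A - {c, d})"
    using assms(1) by (subst prod.union_disjoint[symmetric]) (auto intro!: prod.cong)
  moreover have "prod F (A \<inter> {c, d}) = (if c \<in> A then F c else 1) * (if d \<in> A then F d else 1)"
    using assms(2) by (cases "c \<in> A"; cases "d \<in> A") (auto simp: Int_insert_right)
  ultimately show ?thesis by simp
qed

subsection \<open>Diagonal products of lamplighter groups\<close>

text \<open>
  An element consists of the position of the cursor and, for each \<open>s\<close>, a lamp configuration with
  values in \<open>\<Gamma> s\<close>. The generators act simultaneously in all components: a pair of letters \<open>(p, q)\<close>
  multiplies the lamp at the cursor by \<open>l s True p\<close> and the lamp at distance \<open>k s\<close> from the cursor by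
  \<open>l s False q\<close>.
\<close>

locale diagonal_product =
  fixes \<Gamma> :: "nat \<Rightarrow> 'l monoid" and P :: "'p::ab_group_add set"
    and l :: "nat \<Rightarrow> bool \<Rightarrow> 'p \<Rightarrow> 'l" and k :: "nat \<Rightarrow> nat"
  assumes two_letter: "\<And>s. two_letter_group (\<Gamma> s) P (l s)" and k_pos: "\<And>s. 0 < k s"
begin

sublocale \<Gamma>: two_letter_group "\<Gamma> s" P "l s" for s
  by (rule two_letter)

text \<open>The semidirect product of the integers with all lamp configurations in all components:
  the second configuration is shifted to the cursor of the first. The finitely generated group is
  cut out of it only in \<open>walk_on_nat_group\<close>.\<close>

definition W :: "(int \<times> (nat \<Rightarrow> int \<Rightarrow> 'l)) monoid" where
  "W = \<lparr>carrier = {w. \<forall>s x. snd w s x \<in> carrier (\<Gamma> s)},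
     mult = (\<lambda>v w. (fst v + fst w, \<lambda>s x. snd v s x \<otimes>\<^bsub>\<Gamma> s\<^esub> snd w s (x - fst v))),
     one = (0, \<lambda>s x. \<one>\<^bsub>\<Gamma> s\<^esub>)\<rparr>"

lemma group_W: "group W"
proof (rule groupI)
  fix w assume w: "w \<in> carrier W"
  define v where "v = (- fst w, \<lambda>s x. inv\<^bsub>\<Gamma> s\<^esub> (snd w s (x + fst w)))"
  have "v \<in> carrier W" "v \<otimes>\<^bsub>W\<^esub> w = \<one>\<^bsub>W\<^esub>"
    using w by (auto simp: v_def W_def)
  then show "\<exists>v\<in>carrier W. v \<otimes>\<^bsub>W\<^esub> w = \<one>\<^bsub>W\<^esub>" by blast
qed (auto simp: W_def \<Gamma>.m_assoc algebra_simps)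

sublocale W: group W
  by (rule group_W)

definition put :: "nat \<Rightarrow> int \<Rightarrow> 'p \<times> 'p \<Rightarrow> int \<Rightarrow> 'l" where
  "put s c pq x = (if x = c then l s True (fst pq)
     else if x = c + int (k s) then l s False (snd pq) else \<one>\<^bsub>\<Gamma> s\<^esub>)"

definition lam :: "'p \<times> 'p \<Rightarrow> int \<times> (nat \<Rightarrow> int \<Rightarrow> 'l)" where
  "lam pq = (0, \<lambda>s. put s 0 pq)"

definition shift :: "int \<Rightarrow> int \<times> (nat \<Rightarrow> int \<Rightarrow> 'l)" where
  "shift e = (e, \<lambda>s x. \<one>\<^bsub>\<Gamma> s\<^esub>)"

abbreviation "U \<equiv> pmf_of_set (P \<times> P)"

definition \<eta> :: "(int \<times> (nat \<Rightarrow> int \<Rightarrow> 'l)) pmf" where "\<eta> = map_pmf lam U"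
definition \<xi> :: "(int \<times> (nat \<Rightarrow> int \<Rightarrow> 'l)) pmf" where "\<xi> = map_pmf shift (pmf_of_set {1, -1})"
text \<open>Writing both before and after the move makes the step law symmetric.\<close>

definition \<mu> :: "(int \<times> (nat \<Rightarrow> int \<Rightarrow> 'l)) pmf" where "\<mu> = pconv W \<eta> (pconv W \<xi> \<eta>)"

lemma P_ne: "P \<noteq> {}" and finite_P: "finite P"
  using \<Gamma>.P_ne \<Gamma>.finite_P by blast+

lemma set_U: "set_pmf U = P \<times> P"
  using P_ne finite_P by simp

lemma put_closed: "pq \<in> P \<times> P \<Longrightarrow> put s c pq x \<in> carrier (\<Gamma> s)"
  by (auto simp: put_def \<Gamma>.l_closed)

lemma lam_closed: "pq \<in> P \<times> P \<Longrightarrow> lam pq \<in> carrier W"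
  by (simp add: lam_def W_def put_closed)

lemma shift_closed: "shift e \<in> carrier W"
  by (simp add: shift_def W_def)

lemma lam_add:
  "pq \<in> P \<times> P \<Longrightarrow> pq' \<in> P \<times> P \<Longrightarrow> lam (pq + pq') = lam pq \<otimes>\<^bsub>W\<^esub> lam pq'"
  by (auto simp: lam_def W_def put_def \<Gamma>.l_add fun_eq_iff)

lemma set_\<eta>: "set_pmf \<eta> \<subseteq> carrier W" and set_\<xi>: "set_pmf \<xi> \<subseteq> carrier W"
  by (auto simp: \<eta>_def \<xi>_def set_U lam_closed[simplified] shift_closed)

lemma finite_\<eta>: "finite (set_pmf \<eta>)" and finite_\<xi>: "finite (set_pmf \<xi>)"
  by (auto simp: \<eta>_def \<xi>_def set_U finite_P)

lemma set_\<mu>: "set_pmf \<mu> \<subseteq> carrier W"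
  unfolding \<mu>_def by (intro W.set_pconv_carrier set_\<eta> set_\<xi>)

lemma finite_\<mu>: "finite (set_pmf \<mu>)"
  unfolding \<mu>_def by (intro finite_set_pconv finite_\<eta> finite_\<xi>)

lemma \<eta>_idem: "pconv W \<eta> \<eta> = \<eta>"
proof -
  have "pconv W \<eta> \<eta> = bind_pmf U (\<lambda>pq. map_pmf (\<lambda>pq'. lam pq \<otimes>\<^bsub>W\<^esub> lam pq') U)"
    by (simp add: pconv_def \<eta>_def bind_map_pmf pmf.map_comp o_def)
  also have "\<dots> = bind_pmf U (\<lambda>pq. map_pmf lam (map_pmf (\<lambda>pq'. pq + pq') U))"
    unfolding pmf.map_comp o_def
    by (intro bind_pmf_cong map_pmf_cong refl) (simp add: lam_add set_U)
  also have "\<dots> = bind_pmf U (\<lambda>pq. map_pmf lam U)"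
    by (intro bind_pmf_cong refl arg_cong[where f = "map_pmf lam"] pmf_of_set_translate)
      (auto simp: finite_P P_ne set_U \<Gamma>.add_P \<Gamma>.uminus_P)
  finally show ?thesis by (simp add: \<eta>_def)
qed

lemma inv_\<eta>: "map_pmf (\<lambda>x. inv\<^bsub>W\<^esub> x) \<eta> = \<eta>"
proof -
  have lam0: "lam 0 = \<one>\<^bsub>W\<^esub>"
    by (auto simp: lam_def W_def put_def \<Gamma>.l_zero fun_eq_iff)
  have "inv\<^bsub>W\<^esub> (lam pq) = lam (- pq)" if pq: "pq \<in> P \<times> P" for pq
  proof -
    have m: "- pq \<in> P \<times> P" using pq by (auto simp: \<Gamma>.uminus_P)
    have "lam (- pq) \<otimes>\<^bsub>W\<^esub> lam pq = \<one>\<^bsub>W\<^esub>"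
      using lam_add[OF m pq] lam0 by simp
    then show ?thesis using lam_closed[OF pq] lam_closed[OF m] by (intro W.inv_equality)
  qed
  then have "map_pmf (\<lambda>x. inv\<^bsub>W\<^esub> x) \<eta> = map_pmf lam (map_pmf uminus U)"
    unfolding \<eta>_def pmf.map_comp o_def by (intro map_pmf_cong refl) (simp add: set_U)
  also have "map_pmf uminus U = U"
    using finite_P P_ne
    by (intro map_pmf_of_set_bij_betw bij_betw_byWitness[where f' = uminus]) (auto simp: \<Gamma>.uminus_P)
  finally show ?thesis by (simp add: \<eta>_def)
qed

lemma inv_\<xi>: "map_pmf (\<lambda>x. inv\<^bsub>W\<^esub> x) \<xi> = \<xi>"
proof -
  have "inv\<^bsub>W\<^esub> (shift e) = shift (- e)" for e
    by (intro W.inv_equality) (auto simp: shift_def W_def)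
  then have "map_pmf (\<lambda>x. inv\<^bsub>W\<^esub> x) \<xi> = map_pmf shift (map_pmf uminus (pmf_of_set {1, -1}))"
    by (simp add: \<xi>_def pmf.map_comp o_def)
  also have "map_pmf uminus (pmf_of_set {1, -1 :: int}) = pmf_of_set {1, -1}"
    by (intro map_pmf_of_set_bij_betw bij_betw_byWitness[where f' = uminus]) auto
  finally show ?thesis by (simp add: \<xi>_def)
qed

lemma inv_\<mu>: "map_pmf (\<lambda>x. inv\<^bsub>W\<^esub> x) \<mu> = \<mu>"
  unfolding \<mu>_def
  by (simp add: W.map_inv_pconv W.set_pconv_carrier W.pconv_assoc set_\<eta> set_\<xi> inv_\<eta> inv_\<xi>)

section \<open>Laws along a given path of the cursor\<close>

definition act :: "int \<Rightarrow> 'p \<times> 'p \<Rightarrow> int \<times> (nat \<Rightarrow> int \<Rightarrow> 'l) \<Rightarrow> int \<times> (nat \<Rightarrow> int \<Rightarrow> 'l)" where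
  "act e pq w = (fst w + e, \<lambda>s x. snd w s x \<otimes>\<^bsub>\<Gamma> s\<^esub> put s (fst w + e) pq x)"

lemma act_eq:
  assumes "w \<in> carrier W" "pq \<in> P \<times> P"
  shows "act e pq w = w \<otimes>\<^bsub>W\<^esub> (shift e \<otimes>\<^bsub>W\<^esub> lam pq)"
  using assms by (auto simp: act_def W_def shift_def lam_def put_def fun_eq_iff \<Gamma>.l_closed algebra_simps)

fun path_law :: "int list \<Rightarrow> (int \<times> (nat \<Rightarrow> int \<Rightarrow> 'l)) pmf" where
  "path_law [] = map_pmf (\<lambda>pq. act 0 pq \<one>\<^bsub>W\<^esub>) U"
| "path_law (e # xs) = bind_pmf (path_law xs) (\<lambda>w. map_pmf (\<lambda>pq. act e pq w) U)"

lemma act_closed: "w \<in> carrier W \<Longrightarrow> pq \<in> P \<times> P \<Longrightarrow> act e pq w \<in> carrier W"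
  by (auto simp: act_def W_def put_closed)

lemma set_path_law: "set_pmf (path_law xs) \<subseteq> carrier W"
  by (induction xs) (auto simp: set_U act_closed[simplified])

lemma finite_path_law: "finite (set_pmf (path_law xs))"
  by (induction xs) (auto simp: set_U finite_P)

lemma fst_path_law: "w \<in> set_pmf (path_law xs) \<Longrightarrow> fst w = sum_list xs"
  by (induction xs arbitrary: w) (auto simp: act_def W_def)

lemma path_law_Nil: "path_law [] = \<eta>"
proof -
  have "act 0 pq \<one>\<^bsub>W\<^esub> = lam pq" if "pq \<in> P \<times> P" for pq
    using that by (auto simp: act_def lam_def W_def fun_eq_iff put_closed)
  then show ?thesis unfolding path_law.simps \<eta>_def by (intro map_pmf_cong refl) (simp add: set_U)
qed

definition L :: "nat \<Rightarrow> (int \<times> (nat \<Rightarrow> int \<Rightarrow> 'l)) pmf" where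
  "L n = bind_pmf (srw n) path_law"

lemma set_L: "set_pmf (L n) \<subseteq> carrier W"
  using set_path_law by (auto simp: L_def)

lemma finite_L: "finite (set_pmf (L n))"
  by (auto simp: L_def finite_set_srw finite_path_law)

lemma L_Suc: "L (Suc n) = pconv W (L n) (pconv W \<xi> \<eta>)"
proof -
  let ?S = "pmf_of_set {1, -1 :: int}"
  have "L (Suc n) = bind_pmf (srw n) (\<lambda>xs. bind_pmf ?S (\<lambda>e. bind_pmf (path_law xs) (\<lambda>w. map_pmf (\<lambda>pq. act e pq w) U)))"
    by (simp add: L_def bind_assoc_pmf bind_map_pmf)
  also have "\<dots> = bind_pmf (srw n) (\<lambda>xs. bind_pmf (path_law xs) (\<lambda>w. bind_pmf ?S (\<lambda>e. map_pmf (\<lambda>pq. act e pq w) U)))"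
    by (subst bind_commute_pmf) (rule refl)
  also have "\<dots> = bind_pmf (L n) (\<lambda>w. bind_pmf ?S (\<lambda>e. map_pmf (\<lambda>pq. act e pq w) U))"
    by (simp add: L_def bind_assoc_pmf)
  also have "\<dots> = bind_pmf (L n) (\<lambda>w. bind_pmf ?S (\<lambda>e. map_pmf (\<lambda>pq. w \<otimes>\<^bsub>W\<^esub> (shift e \<otimes>\<^bsub>W\<^esub> lam pq)) U))"
    using set_L by (intro bind_pmf_cong map_pmf_cong refl act_eq) (auto simp: set_U)
  also have "\<dots> = pconv W (L n) (pconv W \<xi> \<eta>)"
    by (simp add: pconv_def \<xi>_def \<eta>_def bind_map_pmf map_bind_pmf pmf.map_comp o_def)
  finally show ?thesis .
qed

lemma L_\<eta>: "pconv W (L n) \<eta> = L n"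
proof (cases n)
  case 0
  have "L 0 = \<eta>" by (simp add: L_def bind_return_pmf path_law_Nil del: path_law.simps)
  then show ?thesis using 0 \<eta>_idem by simp
next
  case (Suc m)
  then show ?thesis
    by (simp add: L_Suc W.pconv_assoc W.set_pconv_carrier set_L set_\<eta> set_\<xi> \<eta>_idem)
qed

text \<open>Adjacent factors \<open>\<eta>\<close> of consecutive steps merge, leaving one fresh
  pair of letters at each cursor position, the initial one included. At time 0 the two laws are the
  point mass at the identity and \<open>\<eta>\<close>, hence \<open>Suc n\<close>.\<close>

lemma pw_eq_L: "pw W \<mu> (Suc n) = L (Suc n)"
proof (induction n)
  case 0
  have "L 0 = \<eta>" by (simp add: L_def bind_return_pmf path_law_Nil del: path_law.simps)
  moreover have "pw W \<mu> (Suc 0) = \<mu>"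
    using set_\<mu> by (simp add: pconv_def bind_return_pmf) (intro map_pmf_idI, auto)
  ultimately show ?case by (simp add: L_Suc \<mu>_def)
next
  case (Suc n)
  have "pw W \<mu> (Suc (Suc n)) = pconv W (L (Suc n)) (pconv W \<eta> (pconv W \<xi> \<eta>))"
    using Suc by (simp add: \<mu>_def)
  also have "\<dots> = pconv W (pconv W (L (Suc n)) \<eta>) (pconv W \<xi> \<eta>)"
    by (simp add: W.pconv_assoc W.set_pconv_carrier set_L set_\<eta> set_\<xi>)
  finally show ?case by (simp only: L_\<eta> L_Suc[symmetric])
qed

end

context diagonal_product
begin

subsubsection \<open>Lower bound\<close>

definition put_law :: "nat \<Rightarrow> int \<Rightarrow> (int \<Rightarrow> 'l) pmf \<Rightarrow> (int \<Rightarrow> 'l) pmf" where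
  "put_law s c D = bind_pmf D (\<lambda>f. map_pmf (\<lambda>pq x. f x \<otimes>\<^bsub>\<Gamma> s\<^esub> put s c pq x) U)"

fun lamp_law :: "nat \<Rightarrow> int list \<Rightarrow> (int \<Rightarrow> 'l) pmf" where
  "lamp_law s [] = put_law s 0 (return_pmf (\<lambda>_. \<one>\<^bsub>\<Gamma> s\<^esub>))"
| "lamp_law s (e # xs) = put_law s (sum_list (e # xs)) (lamp_law s xs)"

lemma map_path_law: "map_pmf (\<lambda>w. snd w s) (path_law xs) = lamp_law s xs"
proof (induction xs)
  case Nil
  show ?case
    by (simp add: put_law_def bind_return_pmf pmf.map_comp o_def act_def W_def)
next
  case (Cons e xs)
  have "map_pmf (\<lambda>w. snd w s) (path_law (e # xs))
      = bind_pmf (path_law xs) (\<lambda>w. map_pmf (\<lambda>pq x. snd w s x \<otimes>\<^bsub>\<Gamma> s\<^esub> put s (fst w + e) pq x) U)"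
    by (simp add: map_bind_pmf pmf.map_comp o_def act_def)
  also have "\<dots> = bind_pmf (path_law xs)
      (\<lambda>w. map_pmf (\<lambda>pq x. snd w s x \<otimes>\<^bsub>\<Gamma> s\<^esub> put s (sum_list (e # xs)) pq x) U)"
    by (intro bind_pmf_cong refl) (auto dest!: fst_path_law simp: add.commute)
  also have "\<dots> = lamp_law s (e # xs)"
    by (simp add: put_law_def flip: Cons.IH) (simp add: bind_map_pmf)
  finally show ?case .
qed

lemma set_lamp_law:
  assumes "f \<in> set_pmf (lamp_law s xs)"
  shows "f x \<in> carrier (\<Gamma> s)"
proof -
  obtain w where w: "w \<in> set_pmf (path_law xs)" "f = snd w s"
    using assms unfolding map_path_law[symmetric] set_map_pmf by (rule imageE)
  have "w \<in> carrier W" using w(1) set_path_law by blast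
  then show ?thesis unfolding w(2) by (simp add: W_def)
qed

lemma finite_lamp_law: "finite (set_pmf (lamp_law s xs))"
  unfolding map_path_law[symmetric] set_map_pmf by (intro finite_imageI finite_path_law)

abbreviation "site_law s \<equiv> word_law (\<Gamma> s) P (l s)"

text \<open>Given the path of the cursor, the lamps at different sites are independent.\<close>

lemma pmf_put_law_le:
  assumes car: "\<And>f x. f \<in> set_pmf D \<Longrightarrow> f x \<in> carrier (\<Gamma> s)" and finD: "finite (set_pmf D)"
    and le: "\<And>f. (\<And>x. f x \<in> carrier (\<Gamma> s)) \<Longrightarrow> pmf D f \<le> (\<Prod>x\<in>A. pmf (site_law s (\<tau> x)) (f x))"
    and A: "finite A" and f: "\<And>x. f x \<in> carrier (\<Gamma> s)"
  shows "pmf (put_law s c D) f \<le> (\<Prod>x\<in>A. pmf (site_law s (visit (k s) x c (\<tau> x))) (f x))"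
proof -
  let ?d = "c + int (k s)"
  have cd: "c \<noteq> ?d" using k_pos[of s] by simp
  define F where "F pq x = pmf (site_law s (\<tau> x)) (f x \<otimes>\<^bsub>\<Gamma> s\<^esub> inv\<^bsub>\<Gamma> s\<^esub> (put s c pq x))" for pq x
  define R where "R = (\<Prod>x\<in>A - {c, ?d}. pmf (site_law s (\<tau> x)) (f x))"
  define S where "S p = (if c \<in> A then pmf (site_law s (\<tau> c)) (f c \<otimes>\<^bsub>\<Gamma> s\<^esub> inv\<^bsub>\<Gamma> s\<^esub> (l s True p)) else 1)" for p
  define T where "T q = (if ?d \<in> A then pmf (site_law s (\<tau> ?d)) (f ?d \<otimes>\<^bsub>\<Gamma> s\<^esub> inv\<^bsub>\<Gamma> s\<^esub> (l s False q)) else 1)" for q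
  \<comment> \<open>Only the sites \<open>c\<close> and \<open>?d\<close> receive letters, namely
    the independent \<open>p\<close> and \<open>q\<close>; so the double sum over letters
    factorises.\<close>
  have F: "(\<Prod>x\<in>A. F (p, q) x) = S p * T q * R" for p q
  proof -
    have "(\<Prod>x\<in>A - {c, ?d}. F (p, q) x) = R"
      unfolding R_def F_def using f by (intro prod.cong) (auto simp: put_def)
    then show ?thesis
      unfolding prod_split_two[OF A cd, of "F (p, q)"] using cd by (simp add: F_def S_def T_def put_def)
  qed
  have map: "pmf (map_pmf (\<lambda>g x. g x \<otimes>\<^bsub>\<Gamma> s\<^esub> put s c pq x) D) f \<le> (\<Prod>x\<in>A. F pq x)"
    if pq: "pq \<in> P \<times> P" for pq
  proof -
    have "pmf (map_pmf (\<lambda>g x. g x \<otimes>\<^bsub>\<Gamma> s\<^esub> put s c pq x) D) f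
        = pmf D (\<lambda>x. f x \<otimes>\<^bsub>\<Gamma> s\<^esub> inv\<^bsub>\<Gamma> s\<^esub> (put s c pq x))"
    proof (rule pmf_map_eq)
      fix g assume g: "g \<in> set_pmf D"
      have "g x \<otimes>\<^bsub>\<Gamma> s\<^esub> put s c pq x = f x \<longleftrightarrow> g x = f x \<otimes>\<^bsub>\<Gamma> s\<^esub> inv\<^bsub>\<Gamma> s\<^esub> (put s c pq x)" for x
        using car[OF g, of x] put_closed[OF pq, of s c x] f[of x]
        by (metis \<Gamma>.inv_solve_right')
      then show "(\<lambda>x. g x \<otimes>\<^bsub>\<Gamma> s\<^esub> put s c pq x) = f
          \<longleftrightarrow> g = (\<lambda>x. f x \<otimes>\<^bsub>\<Gamma> s\<^esub> inv\<^bsub>\<Gamma> s\<^esub> (put s c pq x))"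
        by (simp add: fun_eq_iff)
    qed
    also have "\<dots> \<le> (\<Prod>x\<in>A. F pq x)"
      unfolding F_def by (intro le) (use f put_closed[OF pq] in simp)
    finally show ?thesis .
  qed
  have "put_law s c D = bind_pmf U (\<lambda>pq. map_pmf (\<lambda>g x. g x \<otimes>\<^bsub>\<Gamma> s\<^esub> put s c pq x) D)"
    unfolding put_law_def map_pmf_def by (rule bind_commute_pmf)
  then have "pmf (put_law s c D) f
      = (\<Sum>pq\<in>P \<times> P. pmf (map_pmf (\<lambda>g x. g x \<otimes>\<^bsub>\<Gamma> s\<^esub> put s c pq x) D) f) / card (P \<times> P)"
    using P_ne finite_P by (simp add: pmf_bind_pmf_of_set)
  also have "\<dots> \<le> (\<Sum>pq\<in>P \<times> P. \<Prod>x\<in>A. F pq x) / card (P \<times> P)"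
    by (intro divide_right_mono sum_mono map) auto
  also have "(\<Sum>pq\<in>P \<times> P. \<Prod>x\<in>A. F pq x) = (\<Sum>p\<in>P. \<Sum>q\<in>P. S p * T q * R)"
    by (simp add: sum.cartesian_product F[symmetric] case_prod_beta)
  also have "\<dots> = (\<Sum>p\<in>P. S p) * (\<Sum>q\<in>P. T q) * R"
    unfolding sum_product by (simp add: sum_distrib_right)
  also have "\<dots> / card (P \<times> P) = ((\<Sum>p\<in>P. S p) / card P) * ((\<Sum>q\<in>P. T q) / card P) * R"
    by (simp add: card_cartesian_product)
  also have "(\<Sum>p\<in>P. S p) / card P = (if c \<in> A then pmf (site_law s (True # \<tau> c)) (f c) else 1)"
    using \<Gamma>.pmf_wl_Cons_inv[OF f] \<Gamma>.card_P_pos by (simp add: S_def del: word_law.simps)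
  also have "(\<Sum>q\<in>P. T q) / card P = (if ?d \<in> A then pmf (site_law s (False # \<tau> ?d)) (f ?d) else 1)"
    using \<Gamma>.pmf_wl_Cons_inv[OF f] \<Gamma>.card_P_pos by (simp add: T_def del: word_law.simps)
  also have "R = (\<Prod>x\<in>A - {c, ?d}. pmf (site_law s (visit (k s) x c (\<tau> x))) (f x))"
    unfolding R_def by (intro prod.cong) (auto simp: visit_def)
  also have "(if c \<in> A then pmf (site_law s (True # \<tau> c)) (f c) else 1)
      * (if ?d \<in> A then pmf (site_law s (False # \<tau> ?d)) (f ?d) else 1) * \<dots>
      = (\<Prod>x\<in>A. pmf (site_law s (visit (k s) x c (\<tau> x))) (f x))"
    unfolding prod_split_two[OF A cd, of "\<lambda>x. pmf (site_law s (visit (k s) x c (\<tau> x))) (f x)"]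
    using cd by (simp add: visit_def del: word_law.simps)
  finally show ?thesis .
qed

text \<open>An inequality, because the sites outside the finite set \<open>A\<close> are dropped;
  they could only contribute factors at most 1.\<close>

lemma pmf_lamp_law_le:
  assumes "finite A" "\<And>x. f x \<in> carrier (\<Gamma> s)"
  shows "pmf (lamp_law s xs) f \<le> (\<Prod>x\<in>A. pmf (site_law s (visits (k s) x xs)) (f x))"
  using assms(2)
proof (induction xs arbitrary: f)
  case Nil
  have "pmf (return_pmf (\<lambda>_. \<one>\<^bsub>\<Gamma> s\<^esub>)) f \<le> (\<Prod>x\<in>A. pmf (site_law s []) (f x))" for f :: "int \<Rightarrow> 'l"
    by (cases "f = (\<lambda>_. \<one>\<^bsub>\<Gamma> s\<^esub>)") (auto simp: indicator_def intro: prod_nonneg)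
  then show ?case
    unfolding lamp_law.simps visits.simps using assms(1) Nil
    by (intro pmf_put_law_le) auto
next
  case (Cons e xs)
  show ?case
    unfolding lamp_law.simps visits.simps
    by (rule pmf_put_law_le) (use assms(1) Cons in \<open>auto intro: set_lamp_law finite_lamp_law\<close>)
qed

text \<open>Given the path, each site with at least \<open>T\<close> alternations contributes a
  factor \<open>B\<close> to the maximal probability of a configuration, hence \<open>- ln B\<close>
  to the entropy. Concavity then averages over paths. A single component \<open>s\<close>
  suffices.\<close>

lemma Hp_L_ge:
  assumes B: "\<And>ts g. T \<le> alt ts \<Longrightarrow> pmf (site_law s ts) g \<le> B" and pos: "0 < B"
  shows "(\<Sum>x\<in>{1..int r}. avg (srw n) (\<lambda>xs. of_bool (T \<le> alt (visits (k s) x xs)))) * (- ln B) \<le> Hp (L n)"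
proof -
  define N where "N xs = (\<Sum>x\<in>{1..int r}. of_bool (T \<le> alt (visits (k s) x xs)) :: nat)" for xs
  have pmf_le: "pmf (lamp_law s xs) f \<le> B ^ N xs" for xs f
  proof (cases "f \<in> set_pmf (lamp_law s xs)")
    case True
    have "pmf (lamp_law s xs) f \<le> (\<Prod>x\<in>{1..int r}. pmf (site_law s (visits (k s) x xs)) (f x))"
      using True by (intro pmf_lamp_law_le set_lamp_law) auto
    also have "\<dots> \<le> (\<Prod>x\<in>{1..int r}. B ^ of_bool (T \<le> alt (visits (k s) x xs)))"
      by (intro prod_mono) (auto simp: B pmf_le_1)
    also have "\<dots> = B ^ N xs" unfolding N_def by (rule power_sum[symmetric])
    finally show ?thesis .
  qed (use pos in \<open>simp add: pmf_eq_0_set_pmf[symmetric]\<close>)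
  have "real (N xs) * (- ln B) \<le> Hp (lamp_law s xs)" for xs
  proof -
    have "- ln (B ^ N xs) \<le> Hp (lamp_law s xs)"
      by (rule Hp_ge_of_pmf_le[OF finite_lamp_law pmf_le])
    then show ?thesis using pos by (simp add: ln_realpow)
  qed
  then have "avg (srw n) (\<lambda>xs. (- ln B) * real (N xs)) \<le> avg (srw n) (\<lambda>xs. Hp (lamp_law s xs))"
    by (intro avg_mono) (simp add: mult.commute)
  also have "\<dots> \<le> Hp (bind_pmf (srw n) (lamp_law s))"
    by (intro Hp_bind_ge finite_lamp_law finite_set_srw)
  also have "bind_pmf (srw n) (lamp_law s) = map_pmf (\<lambda>w. snd w s) (L n)"
    by (simp add: L_def map_bind_pmf map_path_law)
  also have "Hp \<dots> \<le> Hp (L n)" by (intro Hp_map_le finite_L)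
  finally show ?thesis
    unfolding avg_cmult N_def of_nat_sum of_nat_of_bool avg_sum by (simp only: mult.commute)
qed

subsubsection \<open>Upper bound\<close>

definition proj :: "nat set \<Rightarrow> int \<times> (nat \<Rightarrow> int \<Rightarrow> 'l) \<Rightarrow> int \<times> (nat \<Rightarrow> int \<Rightarrow> 'l)" where
  "proj I w = (fst w, \<lambda>s x. if s \<in> I then snd w s x else \<one>\<^bsub>\<Gamma> s\<^esub>)"

definition H :: "nat set \<Rightarrow> nat \<Rightarrow> real" where
  "H I n = Hp (map_pmf (proj I) (pw W \<mu> n))"

lemma proj_closed: "w \<in> carrier W \<Longrightarrow> proj I w \<in> carrier W"
  by (simp add: proj_def W_def)

lemma map_proj_pconv: "map_pmf (proj I) (pconv W p q) = pconv W (map_pmf (proj I) p) (map_pmf (proj I) q)"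
proof -
  have "proj I (v \<otimes>\<^bsub>W\<^esub> w) = proj I v \<otimes>\<^bsub>W\<^esub> proj I w" for v w
    by (auto simp: proj_def W_def fun_eq_iff)
  then show ?thesis by (simp add: pconv_def map_bind_pmf bind_map_pmf pmf.map_comp o_def)
qed

lemma H_nonneg: "0 \<le> H I n"
  by (simp add: H_def Hp_nonneg)

lemma finite_map_pw: "finite (set_pmf (map_pmf (proj I) (pw W \<mu> n)))"
  by (simp add: finite_set_pw finite_\<mu>)

lemma set_map_pw: "set_pmf (map_pmf (proj I) (pw W \<mu> n)) \<subseteq> carrier W"
  using proj_closed W.set_pw_carrier[OF set_\<mu>, of n] unfolding set_map_pmf image_subset_iff by blast

lemma H_0: "H I 0 = 0"
  by (simp add: H_def Hp_def)

lemma H_add: "H I (m + n) \<le> H I m + H I n"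
  unfolding H_def W.pw_add[OF set_\<mu>] map_proj_pconv by (intro Hp_pconv_le finite_map_pw)

lemma H_mult: "H I (j * n) \<le> real j * H I n"
proof (induction j)
  case (Suc j)
  have "H I (Suc j * n) \<le> H I n + H I (j * n)" using H_add[of I n "j * n"] by simp
  then show ?case using Suc by (simp add: distrib_right)
qed (simp add: H_0)

lemma H_le_H_add: "H I m \<le> H I (m + n)"
  unfolding H_def W.pw_add[OF set_\<mu>] map_proj_pconv
  by (intro W.Hp_pconv_ge finite_map_pw set_map_pw)

lemma H_mono: "m \<le> n \<Longrightarrow> H I m \<le> H I n"
  using H_le_H_add[of I m "n - m"] by simp

text \<open>Cover time \<open>n\<close> by \<open>n div m + 1\<close> blocks of length
  \<open>m\<close>; the factor 2 absorbs the rounding. This carries upper bounds to later times and,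
  read backwards, lower bounds to earlier ones.\<close>

lemma H_le_of_le:
  assumes "0 < m" "m \<le> n"
  shows "H I n \<le> 2 * (real n / real m) * H I m"
proof -
  have "n < Suc (n div m) * m" using assms(1) by (simp add: dividend_less_div_times add.commute)
  then have "H I n \<le> H I (Suc (n div m) * m)" by (intro H_mono) simp
  also have "\<dots> \<le> real (Suc (n div m)) * H I m" by (rule H_mult)
  also have "real (Suc (n div m)) \<le> 2 * (real n / real m)"
  proof -
    have "real (n div m) \<le> real n / real m" using assms(1)
      by (simp add: pos_le_divide_eq) (metis div_times_less_eq_dividend of_nat_le_iff of_nat_mult)
    moreover have "1 \<le> real n / real m" using assms by simp
    ultimately show ?thesis by simp
  qed
  finally show ?thesis using H_nonneg[of I m] by (simp add: mult_right_mono)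
qed

lemma H_split: "Hp (pw W \<mu> n) \<le> H I n + H (- I) n"
  unfolding H_def
proof (rule Hp_joint_le)
  show "finite (set_pmf (pw W \<mu> n))" by (simp add: finite_set_pw finite_\<mu>)
  show "inj_on (\<lambda>x. (proj I x, proj (- I) x)) (set_pmf (pw W \<mu> n))"
  proof (rule inj_onI)
    fix v w assume "(proj I v, proj (- I) v) = (proj I w, proj (- I) w)"
    then have "fst v = fst w" "\<And>s x. snd v s x = snd w s x"
      by (auto simp: proj_def fun_eq_iff split: if_splits)
    then show "v = w" by (auto simp: prod_eq_iff)
  qed
qed

text \<open>
  The elements reached along paths of range at most \<open>r\<close>. In the components with \<open>k s > 2 * r\<close> the
  letters of the two kinds never meet, so these components are all determined by the same function
  \<open>u\<close>, which records the product of the letters written at each position of the cursor.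
\<close>

definition far_lamps :: "nat \<Rightarrow> (int \<Rightarrow> 'p \<times> 'p) \<Rightarrow> nat \<Rightarrow> int \<Rightarrow> 'l" where
  "far_lamps r u s x = (if \<bar>x\<bar> \<le> int r then l s True (fst (u x))
     else if \<bar>x - int (k s)\<bar> \<le> int r then l s False (snd (u (x - int (k s)))) else \<one>\<^bsub>\<Gamma> s\<^esub>)"

definition confined :: "nat \<Rightarrow> int \<times> (nat \<Rightarrow> int \<Rightarrow> 'l) \<Rightarrow> bool" where
  "confined r w \<longleftrightarrow> w \<in> carrier W \<and> \<bar>fst w\<bar> \<le> int r \<and> (\<exists>u. (\<forall>x. u x \<in> P \<times> P) \<and>
     (\<forall>s. if k s \<le> 2 * r then \<forall>x. x \<notin> {- int r..3 * int r} \<longrightarrow> snd w s x = \<one>\<^bsub>\<Gamma> s\<^esub>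
          else snd w s = far_lamps r u s))"

lemma confined_act:
  assumes w: "confined r w" and e: "\<bar>fst w + e\<bar> \<le> int r" and pq: "pq \<in> P \<times> P"
  shows "confined r (act e pq w)"
proof -
  let ?c = "fst w + e"
  obtain u where u: "\<And>x. u x \<in> P \<times> P"
    and near: "\<And>s x. k s \<le> 2 * r \<Longrightarrow> x \<notin> {- int r..3 * int r} \<Longrightarrow> snd w s x = \<one>\<^bsub>\<Gamma> s\<^esub>"
    and far: "\<And>s. \<not> k s \<le> 2 * r \<Longrightarrow> snd w s = far_lamps r u s"
    using w unfolding confined_def by (metis (full_types))
  define u' where "u' = u(?c := u ?c + pq)"
  have u': "u' x \<in> P \<times> P" for x
    using u[of x] u[of ?c] pq by (auto simp: u'_def mem_Times_iff \<Gamma>.add_P)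
  have "snd (act e pq w) s x = \<one>\<^bsub>\<Gamma> s\<^esub>" if "k s \<le> 2 * r" "x \<notin> {- int r..3 * int r}" for s x
    using near[OF that] that e by (auto simp: act_def put_def)
  moreover have "snd (act e pq w) s = far_lamps r u' s" if s: "\<not> k s \<le> 2 * r" for s
  proof
    fix x
    have uP: "fst (u x) \<in> P" "snd (u x) \<in> P" "fst pq \<in> P" "snd pq \<in> P" for x
      using u[of x] pq by (auto simp: mem_Times_iff)
    have "far_lamps r u s x \<otimes>\<^bsub>\<Gamma> s\<^esub> put s ?c pq x = far_lamps r u' s x"
      using e s uP by (auto simp: far_lamps_def put_def u'_def \<Gamma>.l_closed \<Gamma>.l_add)
    then show "snd (act e pq w) s x = far_lamps r u' s x"
      by (simp add: act_def far[OF s])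
  qed
  moreover have "act e pq w \<in> carrier W" using w pq by (simp add: confined_def act_closed)
  ultimately show ?thesis
    unfolding confined_def using e u' by (auto simp: act_def)
qed

lemma confined_path_law:
  assumes "stays (int r) xs" "w \<in> set_pmf (path_law xs)"
  shows "confined r w"
  using assms
proof (induction xs arbitrary: w)
  case Nil
  have "confined r \<one>\<^bsub>W\<^esub>"
    unfolding confined_def
    by (auto simp: W_def far_lamps_def zero_prod_def \<Gamma>.zero_P \<Gamma>.l_zero fun_eq_iff intro!: exI[of _ "\<lambda>_. 0"])
  moreover have "fst \<one>\<^bsub>W\<^esub> = 0" by (simp add: W_def)
  ultimately show ?case using Nil by (auto simp: set_U intro!: confined_act)
next
  case (Cons e xs)
  obtain v pq where v: "v \<in> set_pmf (path_law xs)" "pq \<in> P \<times> P" "w = act e pq v"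
    using Cons.prems(2) by (auto simp: set_U)
  have "fst v = sum_list xs" using v(1) by (rule fst_path_law)
  then show ?case
    unfolding v(3) using Cons.prems(1) Cons.IH[OF _ v(1)] v(2)
    by (intro confined_act) (auto simp: add.commute)
qed

text \<open>Decodes an element from the cursor \<open>z\<close>, the common record \<open>u\<close>
  and the near lamps \<open>F\<close>. Near components have offset at most \<open>2 * r\<close>, so
  their lamps lie between \<open>- r\<close> and \<open>3 * r\<close>. All far components, possibly
  infinitely many, read from \<open>u\<close>, which keeps the number of codes finite when the near
  components are finite in number and have finite lamp groups.\<close>

definition build :: "nat set \<Rightarrow> nat \<Rightarrow> int \<times> (int \<Rightarrow> 'p \<times> 'p) \<times> (nat \<Rightarrow> int \<Rightarrow> 'l) \<Rightarrow> int \<times> (nat \<Rightarrow> int \<Rightarrow> 'l)" where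
  "build I r = (\<lambda>(z, u, F). (z, \<lambda>s x. if s \<notin> I then \<one>\<^bsub>\<Gamma> s\<^esub>
     else if k s \<le> 2 * r then (if x \<in> {- int r..3 * int r} then F s x else \<one>\<^bsub>\<Gamma> s\<^esub>)
     else far_lamps r u s x))"

definition build_dom :: "nat set \<Rightarrow> nat \<Rightarrow> (int \<times> (int \<Rightarrow> 'p \<times> 'p) \<times> (nat \<Rightarrow> int \<Rightarrow> 'l)) set" where
  "build_dom J r = {- int r..int r} \<times> PiE {- int r..int r} (\<lambda>_. P \<times> P)
     \<times> PiE J (\<lambda>s. PiE {- int r..3 * int r} (\<lambda>_. carrier (\<Gamma> s)))"

lemma confined_build:
  assumes "confined r w" "J = {s \<in> I. k s \<le> 2 * r}"
  shows "proj I w \<in> build I r ` build_dom J r"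
proof -
  obtain u where u: "\<And>x. u x \<in> P \<times> P"
    and near: "\<And>s x. k s \<le> 2 * r \<Longrightarrow> x \<notin> {- int r..3 * int r} \<Longrightarrow> snd w s x = \<one>\<^bsub>\<Gamma> s\<^esub>"
    and far: "\<And>s. \<not> k s \<le> 2 * r \<Longrightarrow> snd w s = far_lamps r u s"
    using assms(1) unfolding confined_def by (metis (full_types))
  define u' where "u' = restrict u {- int r..int r}"
  define F where "F = restrict (\<lambda>s. restrict (snd w s) {- int r..3 * int r}) J"
  have far': "far_lamps r u' s x = far_lamps r u s x" for s x
    by (auto simp: far_lamps_def u'_def)
  have "(fst w, u', F) \<in> build_dom J r"
    using u assms(1) unfolding build_dom_def u'_def F_def confined_def
    by (auto simp: W_def)
  moreover have "proj I w = build I r (fst w, u', F)"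
    using near far far' by (auto simp: proj_def build_def F_def assms(2) fun_eq_iff)
  ultimately show ?thesis by blast
qed

lemma card_build_dom:
  assumes "finite J" "\<And>s. s \<in> J \<Longrightarrow> finite (carrier (\<Gamma> s))"
  shows "finite (build_dom J r)"
    and "card (build_dom J r) = (2 * r + 1) * ((card P ^ 2) ^ (2 * r + 1) * (\<Prod>s\<in>J. card (carrier (\<Gamma> s)) ^ (4 * r + 1)))"
proof -
  have c: "card {- int r..int r} = 2 * r + 1" "card {- int r..3 * int r} = 4 * r + 1" by auto
  show "finite (build_dom J r)"
    unfolding build_dom_def using assms finite_P by (intro finite_cartesian_product finite_PiE) auto
  have u: "card (PiE {- int r..int r} (\<lambda>_. P \<times> P)) = (card P ^ 2) ^ (2 * r + 1)"
    by (subst card_PiE, simp) (simp only: prod_constant c card_cartesian_product power2_eq_square)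
  have F: "card (PiE J (\<lambda>s. PiE {- int r..3 * int r} (\<lambda>_. carrier (\<Gamma> s))))
      = (\<Prod>s\<in>J. card (carrier (\<Gamma> s)) ^ (4 * r + 1))"
    by (subst card_PiE[OF assms(1)]) (simp only: card_PiE[OF finite_atLeastAtMost_int] prod_constant c)
  show "card (build_dom J r) = (2 * r + 1) * ((card P ^ 2) ^ (2 * r + 1) * (\<Prod>s\<in>J. card (carrier (\<Gamma> s)) ^ (4 * r + 1)))"
    unfolding build_dom_def card_cartesian_product u F c ..
qed

text \<open>A crude count of words, paid only on the unlikely event that the cursor leaves the
  interval, or where a linear bound is good enough.\<close>

lemma ln_card_set_pw: "ln (card (set_pmf (map_pmf (proj I) (pw W \<mu> n)))) \<le> n * ln (2 * card P ^ 4)"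
proof -
  let ?p = "map_pmf (proj I) (pw W \<mu> n)"
  have \<eta>: "card (set_pmf \<eta>) \<le> card P ^ 2"
    unfolding \<eta>_def using card_image_le[of "P \<times> P" lam] finite_P
    by (simp add: set_U card_cartesian_product power2_eq_square)
  have \<xi>: "card (set_pmf \<xi>) \<le> 2"
    unfolding \<xi>_def using card_image_le[of "{1, -1 :: int}" shift] by simp
  have "card (set_pmf \<mu>) \<le> card (set_pmf \<eta>) * (card (set_pmf \<xi>) * card (set_pmf \<eta>))"
    unfolding \<mu>_def
    by (rule order_trans[OF card_set_pconv mult_left_mono[OF card_set_pconv]])
      (simp_all add: finite_set_pconv finite_\<eta> finite_\<xi>)
  also have "\<dots> \<le> card P ^ 2 * (2 * card P ^ 2)"
    using \<eta> \<xi> by (intro mult_mono) auto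
  finally have \<mu>: "card (set_pmf \<mu>) \<le> 2 * card P ^ 4" by (simp add: power2_eq_square power4_eq_xxxx mult_ac)
  have "card (set_pmf ?p) \<le> card (set_pmf (pw W \<mu> n))"
    using card_image_le[OF finite_set_pw[OF finite_\<mu>]] by simp
  also have "\<dots> \<le> card (set_pmf \<mu>) ^ n" by (rule card_set_pw[OF finite_\<mu>])
  also have "\<dots> \<le> (2 * card P ^ 4) ^ n" by (intro power_mono \<mu>) simp
  finally have "real (card (set_pmf ?p)) \<le> real ((2 * card P ^ 4) ^ n)"
    by (simp only: of_nat_le_iff)
  moreover have "0 < card (set_pmf ?p)"
    unfolding card_gt_0_iff by (intro conjI finite_map_pw set_pmf_not_empty)
  ultimately have "ln (real (card (set_pmf ?p))) \<le> ln (real ((2 * card P ^ 4) ^ n))"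
    by (intro ln_mono) simp_all
  also have "\<dots> = n * ln (2 * card P ^ 4)"
    unfolding of_nat_power by (rule ln_realpow)
  finally show ?thesis .
qed

lemma H_le_linear: "H I n \<le> ln 2 + n * ln (2 * card P ^ 4)"
proof -
  let ?p = "map_pmf (proj I) (pw W \<mu> n)"
  have "Hp ?p \<le> ln 2 + ln (card (set_pmf ?p)) + measure_pmf.prob ?p (- set_pmf ?p) * ln (card (set_pmf ?p))"
    by (rule Hp_le_two_level[OF finite_map_pw order_refl finite_map_pw set_pmf_not_empty])
  also have "measure_pmf.prob ?p (- set_pmf ?p) = 0"
    unfolding measure_pmf_zero_iff by blast
  finally show ?thesis using ln_card_set_pw[of I n] by (simp add: H_def)
qed

text \<open>Two-level coding whose typical set consists of the decoded elements. The last summand is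
  the exit probability times the crude count.\<close>

lemma H_le:
  assumes n: "0 < n" and J: "J = {s \<in> I. k s \<le> 2 * r}" "finite J"
    and fin: "\<And>s. s \<in> J \<Longrightarrow> finite (carrier (\<Gamma> s))"
  shows "H I n \<le> ln 2 + ln (2 * r + 1) + 2 * (2 * r + 1) * ln (card P)
     + (4 * r + 1) * (\<Sum>s\<in>J. ln (card (carrier (\<Gamma> s))))
     + 6 * exp (- (r / sqrt n)) * (n * ln (2 * card P ^ 4))"
proof -
  let ?p = "map_pmf (proj I) (L n)"
  let ?E = "build I r ` build_dom J r"
  let ?D = "build_dom J r"
  have p: "map_pmf (proj I) (pw W \<mu> n) = ?p"
    using n pw_eq_L[of "n - 1"] by simp
  have cP: "1 \<le> card P" using \<Gamma>.card_P_pos by simp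
  have c\<Gamma>: "1 \<le> card (carrier (\<Gamma> s))" if "s \<in> J" for s
    using fin[OF that] \<Gamma>.one_closed[of s] by (metis One_nat_def Suc_leI card_gt_0_iff empty_iff)
  have finD: "finite ?D" by (rule card_build_dom(1)[OF J(2)]) (rule fin)
  have card_D: "card ?D = (2 * r + 1) * ((card P ^ 2) ^ (2 * r + 1) * (\<Prod>s\<in>J. card (carrier (\<Gamma> s)) ^ (4 * r + 1)))"
    by (rule card_build_dom(2)[OF J(2)]) (rule fin)
  have finE: "finite ?E" using finD by simp
  have q: "0 < card (carrier (\<Gamma> s))" if "s \<in> J" for s using c\<Gamma>[OF that] by simp
  have "0 < (\<Prod>s\<in>J. card (carrier (\<Gamma> s)) ^ (4 * r + 1))"
    by (intro prod_pos zero_less_power q)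
  moreover have "0 < (card P ^ 2) ^ (2 * r + 1)"
    using cP by (intro zero_less_power) simp
  ultimately have cD: "0 < card ?D"
    unfolding card_D by (intro mult_pos_pos) simp_all
  have neE: "?E \<noteq> {}" using cD by auto
  have prob: "measure_pmf.prob ?p (- ?E) \<le> 6 * exp (- (r / sqrt n))"
  proof -
    have "?p = bind_pmf (srw n) (\<lambda>xs. map_pmf (proj I) (path_law xs))"
      by (simp add: L_def map_bind_pmf)
    then have "measure_pmf.prob ?p (- ?E)
        = avg (srw n) (\<lambda>xs. measure_pmf.prob (map_pmf (proj I) (path_law xs)) (- ?E))"
      by (simp add: measure_bind_avg finite_set_srw del: measure_map_pmf)
    also have "\<dots> \<le> avg (srw n) (\<lambda>xs. of_bool (\<not> stays (int r) xs))"
    proof (rule avg_mono)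
      fix xs
      show "measure_pmf.prob (map_pmf (proj I) (path_law xs)) (- ?E) \<le> of_bool (\<not> stays (int r) xs)"
      proof (cases "stays (int r) xs")
        case True
        then have "set_pmf (map_pmf (proj I) (path_law xs)) \<inter> - ?E = {}"
          using confined_build[OF confined_path_law[OF True] J(1)] by auto
        then have "measure_pmf.prob (map_pmf (proj I) (path_law xs)) (- ?E) = 0"
          by (simp only: measure_pmf_zero_iff)
        then show ?thesis by (simp only: of_bool_def) simp
      next
        case False
        then show ?thesis using measure_pmf.prob_le_1 by (simp del: measure_map_pmf)
      qed
    qed
    also have "\<dots> \<le> 6 * exp (- (r / sqrt n))" using exit_prob_le[of n "int r"] n by simp
    finally show ?thesis .
  qed
  have fp: "finite (set_pmf ?p)" by (simp add: finite_L)
  have cS: "ln (card (set_pmf ?p)) \<le> n * ln (2 * card P ^ 4)"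
    unfolding p[symmetric] by (rule ln_card_set_pw)
  have "Hp ?p \<le> ln 2 + ln (card ?E) + measure_pmf.prob ?p (- ?E) * ln (card (set_pmf ?p))"
    by (rule Hp_le_two_level[OF fp order_refl finE neE])
  also have "\<dots> \<le> ln 2 + ln (card ?D) + 6 * exp (- (r / sqrt n)) * (n * ln (2 * card P ^ 4))"
  proof (intro add_mono order_refl)
    show "ln (card ?E) \<le> ln (card ?D)"
      using card_image_le[OF finD] neE finE by (intro ln_mono) (auto simp: card_gt_0_iff)
    show "measure_pmf.prob ?p (- ?E) * ln (card (set_pmf ?p))
        \<le> 6 * exp (- (r / sqrt n)) * (n * ln (2 * card P ^ 4))"
      using fp set_pmf_not_empty[of ?p]
      by (intro mult_mono prob cS) (auto simp: Suc_le_eq card_gt_0_iff simp del: set_map_pmf)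
  qed
  also have "ln (card ?D) = ln (2 * r + 1) + 2 * (2 * r + 1) * ln (card P)
     + (4 * r + 1) * (\<Sum>s\<in>J. ln (card (carrier (\<Gamma> s))))"
  proof -
    have pos: "0 < real (card (carrier (\<Gamma> s)))" if "s \<in> J" for s using c\<Gamma>[OF that] by simp
    have pos1: "0 < real (2 * r + 1)" by simp
    have pos2: "0 < (real (card P) ^ 2) ^ (2 * r + 1)" using cP by (intro zero_less_power) simp
    have pos3: "0 < (\<Prod>s\<in>J. real (card (carrier (\<Gamma> s))) ^ (4 * r + 1))"
      by (intro prod_pos zero_less_power pos)
    have "ln (card ?D) = ln (real (2 * r + 1)) + (ln ((real (card P) ^ 2) ^ (2 * r + 1))
        + ln (\<Prod>s\<in>J. real (card (carrier (\<Gamma> s))) ^ (4 * r + 1)))"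
      unfolding card_D of_nat_mult of_nat_power of_nat_prod
      unfolding ln_mult_pos[OF pos1 mult_pos_pos[OF pos2 pos3]] ln_mult_pos[OF pos2 pos3] ..
    also have "ln ((real (card P) ^ 2) ^ (2 * r + 1)) = 2 * (2 * r + 1) * ln (card P)"
      using cP by (simp add: ln_realpow flip: power_mult del: power_Suc)
    also have "ln (\<Prod>s\<in>J. real (card (carrier (\<Gamma> s))) ^ (4 * r + 1))
        = (\<Sum>s\<in>J. (4 * r + 1) * ln (card (carrier (\<Gamma> s))))"
      using pos by (subst ln_prod) (auto simp: J(2) ln_realpow simp del: power_Suc intro!: sum.cong)
    finally show ?thesis by (simp add: sum_distrib_left algebra_simps)
  qed
  finally show ?thesis by (simp add: H_def p add_ac)
qed

end

subsection \<open>Entropy of the diagonal product of lamplighter groups over SL2\<close>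

lemma nat_ceiling_double_bounds:
  fixes x :: real
  assumes "1 \<le> x"
  shows "2 * x \<le> real (nat \<lceil>2 * x\<rceil>)" "real (nat \<lceil>2 * x\<rceil>) \<le> 3 * x"
proof -
  have "real (nat \<lceil>2 * x\<rceil>) = of_int \<lceil>2 * x\<rceil>" using assms by (simp add: of_nat_nat)
  then show "2 * x \<le> real (nat \<lceil>2 * x\<rceil>)" "real (nat \<lceil>2 * x\<rceil>) \<le> 3 * x"
    using ceiling_correct[of "2 * x"] assms by linarith+
qed

text \<open>The bound 2048 is 16 * 128: \<open>entropy_lower\<close> uses
  \<open>T = m s div 16\<close> alternations, and \<open>T \<ge> 128\<close> lets
  \<open>T / 20\<close> absorb the constant 4 in \<open>SL2_law_le\<close>.\<close>

locale SL2_product =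
  fixes k m :: "nat \<Rightarrow> nat"
  assumes k_pos: "\<And>s. 0 < k s" and k_mono: "mono k" and m_ge: "\<And>s. 2048 \<le> m s"

sublocale SL2_product \<subseteq>
  diagonal_product "\<lambda>s. SL2 (monom 1 (m s))" letter_polys "\<lambda>s. elem_mat (monom 1 (m s))" k
  by (rule diagonal_product.intro) (simp_all add: two_letter_group_SL2 k_pos)

context SL2_product
begin

lemma m_pos: "0 < m s"
  using m_ge[of s] by simp

lemma H_UNIV: "H UNIV n = Hp (pw W \<mu> n)"
proof -
  have "proj UNIV = (\<lambda>w. w)" by (simp add: proj_def fun_eq_iff)
  then show ?thesis by (simp add: H_def)
qed

lemma H_upper:
  assumes n: "0 < n" and r: "0 < r" and J: "J = {s \<in> I. k s \<le> 2 * r}" "finite J"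
  shows "H I n \<le> 40 * real r * (1 + (\<Sum>s\<in>J. real (m s))) + 150 * (n * exp (- (r / sqrt n)))"
proof -
  let ?c = "\<lambda>s. card (carrier (SL2 (monom 1 (m s))))"
  have fin: "finite (carrier (SL2 (monom 1 (m s))))" for s by (rule carrier_SL2(1)[OF m_pos])
  have ln2: "0 < ln (2::real)" "ln (2::real) < 1" by (simp_all add: ln_2_less_1)
  have c: "ln (?c s) \<le> 4 * m s" for s
  proof -
    have "real (?c s) \<le> 2 ^ (4 * m s)"
      using carrier_SL2(2)[OF m_pos[of s]] by (metis of_nat_le_iff of_nat_numeral of_nat_power)
    moreover have "0 < ?c s" using fin[of s] \<Gamma>.one_closed[of s] by (metis card_gt_0_iff empty_iff)
    ultimately have "ln (?c s) \<le> ln (2 ^ (4 * m s))" by (intro ln_mono) auto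
    also have "\<dots> = real (4 * m s) * ln 2" by (rule ln_realpow)
    also have "\<dots> \<le> real (4 * m s) * 1" using ln2 by (intro mult_left_mono) auto
    finally show ?thesis by simp
  qed
  have 64: "ln (card letter_polys) \<le> 6"
  proof -
    have "ln (card letter_polys) = ln ((2::real) ^ 6)" by (simp add: card_letter_polys)
    also have "\<dots> = real 6 * ln 2" by (rule ln_realpow)
    finally show ?thesis using ln2 by simp
  qed
  have 25: "ln (2 * card letter_polys ^ 4) \<le> 25"
  proof -
    have "ln (2 * card letter_polys ^ 4) = ln ((2::real) ^ 25)" by (simp add: card_letter_polys)
    also have "\<dots> = real 25 * ln 2" by (rule ln_realpow)
    finally show ?thesis using ln2 by simp
  qed
  have r1: "1 \<le> real r" using r by simp
  have "H I n \<le> ln 2 + ln (2 * real r + 1) + 2 * (2 * real r + 1) * ln (card letter_polys)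
     + (4 * real r + 1) * (\<Sum>s\<in>J. ln (?c s))
     + 6 * exp (- (r / sqrt n)) * (n * ln (real (2 * card letter_polys ^ 4)))"
    by (rule H_le[OF n J fin])
  also have "\<dots> \<le> 1 + 2 * real r + 2 * (2 * real r + 1) * 6 + (5 * real r) * (\<Sum>s\<in>J. 4 * real (m s))
      + 6 * exp (- (r / sqrt n)) * (real n * 25)"
  proof (intro add_mono mult_mono)
    show "ln (2 * real r + 1) \<le> 2 * real r" using ln_le_minus_one[of "2 * real r + 1"] by simp
    show "(\<Sum>s\<in>J. ln (real (?c s))) \<le> (\<Sum>s\<in>J. 4 * real (m s))"
      using c by (intro sum_mono) simp
    show "0 \<le> (\<Sum>s\<in>J. ln (real (?c s)))"
      using fin \<Gamma>.one_closed
      by (intro sum_nonneg ln_ge_zero) (metis One_nat_def Suc_leI card_gt_0_iff empty_iff of_nat_1 of_nat_le_iff)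
  qed (use ln2 64 25 r1 in \<open>auto simp: card_letter_polys\<close>)
  also have "\<dots> \<le> 40 * real r * (1 + (\<Sum>s\<in>J. real (m s))) + 150 * (n * exp (- (r / sqrt n)))"
  proof -
    have "1 + 2 * real r + 2 * (2 * real r + 1) * 6 \<le> 40 * real r" using r1 by simp
    moreover have "(5 * real r) * (\<Sum>s\<in>J. 4 * real (m s)) = 20 * (real r * (\<Sum>s\<in>J. real (m s)))"
      by (simp add: sum_distrib_left[symmetric])
    moreover have "0 \<le> real r * (\<Sum>s\<in>J. real (m s))" by (intro mult_nonneg_nonneg sum_nonneg) auto
    ultimately show ?thesis by (simp add: algebra_simps)
  qed
  finally show ?thesis .
qed

text \<open>A radius of about \<open>2 * sqrt n0 * ln n\<close> makes the exit probability of order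
  \<open>1 / n\<^sup>2\<close>, which beats the linear count. The logarithm is that of a later time
  \<open>n\<close>, since \<open>entropy_upper\<close> uses an intermediate \<open>n0\<close> that
  may be as small as 1.\<close>

lemma H_le_log:
  fixes n n0 :: nat
  assumes n: "3 \<le> n" and n0: "1 \<le> n0" "n0 \<le> n" and J: "finite J"
    and far: "\<And>s. s \<in> I \<Longrightarrow> k s \<le> 6 * (sqrt n0 * ln n) \<Longrightarrow> s \<in> J"
  shows "H I n0 \<le> 270 * (sqrt n0 * ln n) * (1 + (\<Sum>s\<in>J. real (m s)))"
proof -
  have ln1: "1 \<le> ln n"
  proof -
    have "exp 1 \<le> real n" using exp_le n by linarith
    then show ?thesis using n by (subst ln_ge_iff) auto
  qed
  define x where "x = sqrt n0 * ln n"
  have x: "1 \<le> x" unfolding x_def using ln1 n0 mult_mono[of 1 "sqrt n0" 1 "ln n"] by simp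
  define r where "r = nat \<lceil>2 * x\<rceil>"
  have r: "2 * x \<le> real r" "real r \<le> 3 * x" unfolding r_def by (rule nat_ceiling_double_bounds[OF x])+
  have r0: "0 < r" using r x by (cases r) auto
  define J' where "J' = {s \<in> I. k s \<le> 2 * r}"
  have J'J: "J' \<subseteq> J"
  proof
    fix s assume "s \<in> J'"
    then have "s \<in> I" "real (k s) \<le> 2 * real r" by (auto simp: J'_def)
    then show "s \<in> J" using r by (intro far) (auto simp: x_def[symmetric])
  qed
  then have finJ': "finite J'" using J finite_subset by blast
  have exp: "n0 * exp (- (r / sqrt n0)) \<le> 1"
  proof -
    have "2 * ln n \<le> r / sqrt n0" using r(1) n0 unfolding x_def by (simp add: field_simps)
    then have "exp (- (r / sqrt n0)) \<le> exp (- (ln n + ln n))" by simp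
    also have "\<dots> = 1 / (real n * real n)"
    proof -
      have "exp (ln (real n)) = real n" using n by simp
      then show ?thesis unfolding exp_minus exp_add by (simp add: inverse_eq_divide)
    qed
    finally have "n0 * exp (- (r / sqrt n0)) \<le> real n * (1 / (real n * real n))"
      using n0 by (intro mult_mono) auto
    also have "\<dots> \<le> 1" using n by (simp add: field_simps)
    finally show ?thesis .
  qed
  let ?S = "1 + (\<Sum>s\<in>J. real (m s))"
  have S: "1 \<le> ?S" by (simp add: sum_nonneg)
  have "H I n0 \<le> 40 * real r * (1 + (\<Sum>s\<in>J'. real (m s))) + 150 * (n0 * exp (- (r / sqrt n0)))"
    using n0 r0 finJ' by (intro H_upper) (auto simp: J'_def)
  also have "\<dots> \<le> 40 * (3 * x) * ?S + 150 * 1"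
    using r x J J'J exp by (intro add_mono mult_mono sum_mono2) (auto intro!: add_nonneg_nonneg sum_nonneg)
  also have "150 * 1 \<le> 150 * (x * ?S)" using x S mult_mono[of 1 x 1 ?S] by simp
  finally show ?thesis unfolding x_def[symmetric] by (simp add: algebra_simps)
qed

lemma entropy_upper:
  assumes n: "3 \<le> n"
  shows "Hp (pw W \<mu> n) \<le> 8000 * ln n ^ 2 * (sqrt n * (1 + (\<Sum>j<s. real (m j))) + n / k s)"
proof -
  let ?x = "ln (real n)"
  let ?S = "1 + (\<Sum>j<s. real (m j))"
  have x: "1 \<le> ?x"
  proof -
    have "exp 1 \<le> real n" using exp_le n by linarith
    then show ?thesis using n by (subst ln_ge_iff) auto
  qed
  have ks: "0 < real (k s)" using k_pos by simp
  have near: "H {..<s} n \<le> 270 * (sqrt n * ?x) * ?S"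
    using n by (intro H_le_log) auto
  have far: "H (- {..<s}) n \<le> 270 * (sqrt n * ?x) + 7840 * ?x ^ 2 * (n / k s)"
  proof -
    have empty: "j \<in> {}" if "j \<in> - {..<s}" "real (k j) \<le> 6 * (sqrt n0 * ?x)" "6 * (sqrt n0 * ?x) < k s" for j n0 :: nat
      using that monoD[OF k_mono, of s j] by force
    consider "6 * (sqrt n * ?x) < k s" | "k s < 7 * ?x" | "k s \<le> 6 * (sqrt n * ?x)" "7 * ?x \<le> k s"
      by linarith
    then show ?thesis
    proof cases
      case 1
      \<comment> \<open>Up to time \<open>n\<close> the cursor does not reach the offset of any
        component from \<open>s\<close> on.\<close>
      have "H (- {..<s}) n \<le> 270 * (sqrt n * ?x) * (1 + (\<Sum>j\<in>{}. real (m j)))"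
        using n empty[of _ n] 1 by (intro H_le_log) auto
      then have "H (- {..<s}) n \<le> 270 * (sqrt n * ?x) + 0" by simp
      also have "\<dots> \<le> 270 * (sqrt n * ?x) + 7840 * ?x ^ 2 * (n / k s)"
        by (intro add_left_mono) simp
      finally show ?thesis .
    next
      case 2
      \<comment> \<open>Here \<open>k s\<close> is so small that the linear bound already has the
        form \<open>n / k s\<close> up to a logarithm.\<close>
      have "ln (2 * card letter_polys ^ 4) = ln ((2::real) ^ 25)" by (simp add: card_letter_polys)
      also have "\<dots> = real 25 * ln 2" by (rule ln_realpow)
      finally have 25: "ln (2 * card letter_polys ^ 4) \<le> 25" using ln_2_less_1 by simp
      have "H (- {..<s}) n \<le> ln 2 + n * ln (2 * card letter_polys ^ 4)" by (rule H_le_linear)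
      also have "\<dots> \<le> 1 * real n + real n * 25"
        using 25 n ln_2_less_1 by (intro add_mono mult_left_mono) auto
      also have "\<dots> = 26 * (n / k s) * k s" using ks by simp
      also have "\<dots> \<le> 26 * (n / k s) * (7 * ?x)" using 2 by (intro mult_left_mono) auto
      also have "\<dots> \<le> 7840 * ?x ^ 2 * (n / k s)"
      proof -
        have "182 * ?x * (n / k s) \<le> 7840 * (?x * ?x) * (n / k s)"
          using x mult_mono[of 1 ?x ?x ?x] by (intro mult_right_mono) auto
        then show ?thesis by (simp add: power2_eq_square mult_ac)
      qed
      also have "\<dots> \<le> 270 * (sqrt n * ?x) + \<dots>" using x by simp
      finally show ?thesis .
    next
      case 3
      \<comment> \<open>Up to time \<open>z ^ 2\<close> all components from \<open>s\<close> on look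
        abelian; dividing by 7 instead of 6 makes \<open>q6\<close> strict. The constants are 270 /
        7 \<le> 40 and 4 * 40 * 49 = 7840.\<close>
      define z where "z = k s / (7 * ?x)"
      have z: "1 \<le> z" "z \<le> sqrt n" using 3 x by (auto simp: z_def field_simps)
      have z2: "1 \<le> z ^ 2" "z ^ 2 \<le> n"
        using z power_mono[OF z(2), of 2] one_le_power[OF z(1), of 2] by auto
      define n0 where "n0 = nat \<lfloor>z ^ 2\<rfloor>"
      have n0': "real n0 \<le> z ^ 2" "z ^ 2 < real n0 + 1"
        using z2 by (auto simp: n0_def of_nat_nat floor_correct)
      then have n0: "1 \<le> n0" "n0 \<le> n" using z2 by linarith+
      have "z ^ 2 \<le> 2 * real n0" using n0'(2) n0(1) by linarith
      note n0 = n0 this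
      have sq: "sqrt n0 \<le> z" using n0'(1) z by (intro real_le_lsqrt) auto
      have "sqrt n0 * ?x \<le> z * ?x" using sq x by (intro mult_right_mono) auto
      also have "\<dots> = k s / 7" using x by (simp add: z_def)
      finally have q: "sqrt n0 * ?x \<le> k s / 7" .
      then have q6: "6 * (sqrt n0 * ?x) < k s" using ks by simp
      have "H (- {..<s}) n0 \<le> 270 * (sqrt n0 * ?x) * (1 + (\<Sum>j\<in>{}. real (m j)))"
        using n n0 empty[OF _ _ q6] by (intro H_le_log) auto
      then have h0: "H (- {..<s}) n0 \<le> 40 * k s" using q by simp
      have "H (- {..<s}) n \<le> 2 * (real n / real n0) * H (- {..<s}) n0"
        using n0 by (intro H_le_of_le) auto
      also have "\<dots> \<le> 2 * (real n / (z ^ 2 / 2)) * (40 * k s)"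
      proof (intro mult_mono h0 order_refl)
        show "real n / real n0 \<le> real n / (z ^ 2 / 2)"
          by (intro frac_le) (use n0 z2 in linarith)+
      qed (use H_nonneg in auto)
      also have "\<dots> = 7840 * ?x ^ 2 * (n / k s)"
        using x ks by (simp add: z_def power2_eq_square field_simps)
      also have "\<dots> \<le> 270 * (sqrt n * ?x) + \<dots>" using x by simp
      finally show ?thesis .
    qed
  qed
  have S: "1 \<le> ?S" by (simp add: sum_nonneg)
  have "Hp (pw W \<mu> n) \<le> H {..<s} n + H (- {..<s}) n" by (rule H_split)
  also have "\<dots> \<le> 270 * (sqrt n * ?x) * ?S + (270 * (sqrt n * ?x) + 7840 * ?x ^ 2 * (n / k s))"
    using near far by (rule add_mono)
  also have "\<dots> \<le> 270 * (sqrt n * ?x) * ?S + (270 * (sqrt n * ?x) * ?S + 7840 * ?x ^ 2 * (n / k s))"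
  proof (intro add_mono order_refl)
    show "270 * (sqrt n * ?x) \<le> 270 * (sqrt n * ?x) * ?S"
      using mult_left_mono[OF S, of "270 * (sqrt n * ?x)"] x by simp
  qed
  also have "\<dots> = 540 * (?x * (sqrt n * ?S)) + 7840 * ?x ^ 2 * (n / k s)" by (simp add: algebra_simps)
  also have "\<dots> \<le> 8000 * (?x ^ 2 * (sqrt n * ?S)) + 8000 * ?x ^ 2 * (n / k s)"
  proof (rule add_mono)
    have "?x * (sqrt n * ?S) \<le> ?x ^ 2 * (sqrt n * ?S)"
      using x S mult_mono[of 1 ?x ?x ?x] by (intro mult_right_mono) (auto simp: power2_eq_square)
    moreover have "0 \<le> ?x ^ 2 * (sqrt n * ?S)" using S by simp
    ultimately show "540 * (?x * (sqrt n * ?S)) \<le> 8000 * (?x ^ 2 * (sqrt n * ?S))" by linarith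
    show "7840 * ?x ^ 2 * (n / k s) \<le> 8000 * ?x ^ 2 * (n / k s)" by (intro mult_right_mono) auto
  qed
  finally show ?thesis by (simp add: distrib_left mult_ac)
qed

lemma entropy_lower:
  assumes n: "64 * (k s * m s) ^ 2 \<le> n"
  shows "1 / 30000 * (sqrt n * m s) \<le> Hp (pw W \<mu> n)"
proof -
  \<comment> \<open>\<open>12 * T < m s\<close> is the condition of \<open>SL2_law_le\<close>. Since
    \<open>k s * T \<le> sqrt n / 128\<close> and \<open>x \<le> sqrt n / 4\<close>, the distance to
    travel is at most \<open>sqrt n / 2\<close>, so each site succeeds with probability at least (1
    - 1/4) / 2 = 3/8.\<close>
  define T where "T = m s div 16"
  define r where "r = nat \<lfloor>sqrt n / 4\<rfloor>"
  have km: "8 * (real (k s) * real (m s)) \<le> sqrt n"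
  proof -
    have "(8 * (real (k s) * real (m s))) ^ 2 \<le> real n"
      using n by (simp add: power_mult_distrib flip: of_nat_mult of_nat_power)
    then show ?thesis by (rule real_le_rsqrt)
  qed
  have k1: "1 \<le> real (k s)" using k_pos[of s] by simp
  have m1: "2048 \<le> real (m s)" using m_ge[of s] by simp
  have sqrt8: "8 \<le> sqrt n" using km mult_mono[of 1 "real (k s)" 1 "real (m s)"] k1 m1 by linarith
  have n0: "0 < n" using sqrt8 by (cases n) auto
  have r: "real r \<le> sqrt n / 4" "sqrt n / 8 \<le> real r"
    using sqrt8 unfolding r_def by (simp_all add: of_nat_nat) linarith+
  have "m s < 16 * T + 16" "16 * T \<le> m s" unfolding T_def by linarith+
  then have T: "real (m s) / 32 \<le> T" "128 \<le> T" "real T \<le> real (m s) / 16" "12 * T < m s"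
    using m_ge[of s] by linarith+
  have kT: "real (k s) * real T \<le> sqrt n / 128"
    using mult_left_mono[OF T(3), of "real (k s)"] km by simp
  define B where "B = 4 * (19 / 20 :: real) ^ T"
  have B: "0 < B" by (simp add: B_def)
  have lnB: "T / 40 \<le> - ln B"
  proof -
    have "ln B = ln 4 + T * ln (19 / 20)" by (simp add: B_def ln_mult ln_realpow)
    moreover have "ln (19 / 20 :: real) \<le> - (1 / 20)" using ln_le_minus_one[of "19 / 20 :: real"] by simp
    then have "T * ln (19 / 20) \<le> real T * - (1 / 20)" by (intro mult_left_mono) auto
    moreover have "ln (4 :: real) \<le> 3" using ln_le_minus_one[of "4 :: real"] by simp
    ultimately show ?thesis using T(2) by simp
  qed
  have avg: "3 / 8 \<le> avg (srw n) (\<lambda>xs. of_bool (T \<le> alt (visits (k s) x xs)))" if "x \<in> {1..int r}" for x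
  proof -
    have "real_of_int (x + int (k s) * int T) \<le> sqrt n / 2"
    proof -
      have "real_of_int x \<le> real r" using that by (metis atLeastAtMost_iff of_int_le_iff of_int_of_nat_eq)
      then show ?thesis using r(1) kT sqrt8 by simp
    qed
    then have "(real_of_int (x + int (k s) * int T)) ^ 2 \<le> (sqrt n / 2) ^ 2"
      using that by (intro power_mono) auto
    then have "(real_of_int (x + int (k s) * int T)) ^ 2 / n \<le> 1 / 4"
      using n0 by (simp add: power_divide field_simps)
    moreover have "(1 - (real_of_int (x + int (k s) * int T)) ^ 2 / n) / 2
        \<le> avg (srw n) (\<lambda>xs. of_bool (T \<le> alt (visits (k s) x xs)))"
      using k_pos[of s] that n0 by (intro alt_visits_ge) auto
    ultimately show ?thesis by argo
  qed
  have "1 / 30000 * (sqrt n * m s) \<le> (sqrt n / 8 * (3 / 8)) * (m s / 32 / 40)"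
    by simp
  also have "\<dots> \<le> (r * (3 / 8)) * (T / 40)"
    using r(2) T(1) by (intro mult_mono divide_right_mono) auto
  also have "\<dots> \<le> (r * (3 / 8)) * (- ln B)"
    using lnB by (intro mult_left_mono) auto
  also have "\<dots> \<le> (\<Sum>x\<in>{1..int r}. avg (srw n) (\<lambda>xs. of_bool (T \<le> alt (visits (k s) x xs)))) * (- ln B)"
  proof (rule mult_right_mono)
    have "(\<Sum>x\<in>{1..int r}. 3 / 8 :: real) \<le> (\<Sum>x\<in>{1..int r}. avg (srw n) (\<lambda>xs. of_bool (T \<le> alt (visits (k s) x xs))))"
      by (intro sum_mono avg)
    then show "r * (3 / 8) \<le> (\<Sum>x\<in>{1..int r}. avg (srw n) (\<lambda>xs. of_bool (T \<le> alt (visits (k s) x xs))))"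
      by simp
    show "0 \<le> - ln B" by (rule order_trans[OF _ lnB]) simp
  qed
  also have "\<dots> \<le> Hp (L n)"
  proof (rule Hp_L_ge[OF _ B])
    fix ts :: "bool list" and g assume "T \<le> alt ts"
    then show "pmf (word_law (SL2 (monom 1 (m s))) letter_polys (elem_mat (monom 1 (m s))) ts) g \<le> B"
      unfolding B_def using T(4) by (intro SL2_law_le) (simp_all add: degree_monom_eq)
  qed
  also have "L n = pw W \<mu> n" using pw_eq_L[of "n - 1"] n0 by simp
  finally show ?thesis .
qed

text \<open>At \<open>N = 64 * (k s * m s) ^ 2\<close> the bound of \<open>entropy_lower\<close> is
  a multiple of \<open>N / k s\<close>, and by subadditivity the entropy at \<open>N\<close> is at
  most \<open>2 * N / n\<close> times that at \<open>n\<close>.\<close>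

lemma entropy_lower2:
  assumes n: "1 \<le> n" "n \<le> 64 * (k s * m s) ^ 2"
  shows "1 / 480000 * (n / k s) \<le> Hp (pw W \<mu> n)"
proof -
  let ?h = "Hp (pw W \<mu> n)"
  define q where "q = real (k s) * real (m s)"
  define N where "N = 64 * (k s * m s) ^ 2"
  have q: "0 < q" using k_pos[of s] m_pos[of s] by (simp add: q_def)
  have N: "real N = 64 * q ^ 2" by (simp add: N_def q_def)
  have sqrtN: "sqrt N = 8 * q" unfolding N using q by (simp add: real_sqrt_mult)
  have "1 / 30000 * (sqrt N * m s) \<le> Hp (pw W \<mu> N)" by (rule entropy_lower) (simp add: N_def)
  also have "\<dots> \<le> 2 * (real N / real n) * ?h"
    using H_le_of_le[of n N UNIV] n by (simp add: H_UNIV N_def)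
  finally have "1 / 30000 * (8 * q * m s) \<le> 2 * (real N / real n) * ?h" unfolding sqrtN .
  then have "1 / 30000 * (8 * q * m s) \<le> 128 * q ^ 2 / n * ?h" unfolding N by simp
  then have "1 / 30000 * (8 * m s) * n \<le> 128 * q * ?h"
    using q n by (simp add: power2_eq_square field_simps)
  then have "1 / 30000 * (8 * m s) * n \<le> 128 * (real (k s) * real (m s)) * ?h" unfolding q_def .
  then have "1 / 480000 * n \<le> real (k s) * ?h" using m_pos[of s] by (simp add: field_simps)
  then show ?thesis using k_pos[of s] by (simp add: field_simps)
qed

end

subsection \<open>Growth exponents\<close>

text \<open>Constant shifts, such as the \<open>ln 64\<close> from the factor 64 in the time
  thresholds, disappear in the limit.\<close>

lemma ratio_limit:
  fixes a p :: "nat \<Rightarrow> real"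
  assumes lim: "(\<lambda>t. a t / p t) \<longlonglongrightarrow> v" and p: "filterlim p at_top sequentially" and "0 \<le> c"
  shows "(\<lambda>t. (a t + b) / (2 * p t + c)) \<longlonglongrightarrow> v / 2"
proof -
  have "((\<lambda>y::real. y / (2 * y + c)) \<longlongrightarrow> 1 / 2) at_top" using assms(3) by real_asymp
  then have 1: "(\<lambda>t. p t / (2 * p t + c)) \<longlonglongrightarrow> 1 / 2" using p by (rule filterlim_compose)
  have "((\<lambda>y::real. b / (2 * y + c)) \<longlongrightarrow> 0) at_top" using assms(3) by real_asymp
  then have 2: "(\<lambda>t. b / (2 * p t + c)) \<longlonglongrightarrow> 0" using p by (rule filterlim_compose)
  have "(\<lambda>t. a t / p t * (p t / (2 * p t + c)) + b / (2 * p t + c)) \<longlonglongrightarrow> v * (1 / 2) + 0"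
    by (intro tendsto_intros lim 1 2)
  moreover have "eventually (\<lambda>t. a t / p t * (p t / (2 * p t + c)) + b / (2 * p t + c)
      = (a t + b) / (2 * p t + c)) sequentially"
    using filterlim_at_top_dense[THEN iffD1, OF p, rule_format, of 0]
    by eventually_elim (simp add: add_divide_distrib)
  ultimately show ?thesis by (auto simp: tendsto_cong)
qed

text \<open>The bounds valid for all large \<open>n\<close> give one inequality each; the
  subsequences \<open>r\<close> and \<open>r'\<close> give the converses.\<close>

lemma liminf_limsup_eqI:
  fixes f g g' :: "nat \<Rightarrow> real"
  assumes up: "eventually (\<lambda>n. f n \<le> g n) sequentially" "g \<longlonglongrightarrow> \<beta>"
    and lo: "eventually (\<lambda>n. g' n \<le> f n) sequentially" "g' \<longlonglongrightarrow> \<alpha>"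
    and r: "strict_mono r" "eventually (\<lambda>t. h t \<le> f (r t)) sequentially" "h \<longlonglongrightarrow> \<beta>"
    and r': "strict_mono r'" "eventually (\<lambda>t. f (r' t) \<le> h' t) sequentially" "h' \<longlonglongrightarrow> \<alpha>"
  shows "liminf (\<lambda>n. ereal (f n)) = ereal \<alpha>" and "limsup (\<lambda>n. ereal (f n)) = ereal \<beta>"
proof -
  have "ereal \<alpha> = liminf (\<lambda>n. ereal (g' n))"
    using lo(2) by (intro lim_imp_Liminf[symmetric]) auto
  also have "\<dots> \<le> liminf (\<lambda>n. ereal (f n))"
    using lo(1) by (intro Liminf_mono) (auto elim: eventually_mono)
  finally have 1: "ereal \<alpha> \<le> liminf (\<lambda>n. ereal (f n))" .
  have "liminf (\<lambda>n. ereal (f n)) \<le> liminf ((\<lambda>n. ereal (f n)) \<circ> r')"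
    by (rule liminf_subseq_mono[OF r'(1)])
  also have "\<dots> \<le> liminf (\<lambda>t. ereal (h' t))"
    using r'(2) by (intro Liminf_mono) (auto elim: eventually_mono)
  also have "\<dots> = ereal \<alpha>" using r'(3) by (intro lim_imp_Liminf) auto
  finally show "liminf (\<lambda>n. ereal (f n)) = ereal \<alpha>" using 1 by (rule antisym)
  have "limsup (\<lambda>n. ereal (f n)) \<le> limsup (\<lambda>n. ereal (g n))"
    using up(1) by (intro Limsup_mono) (auto elim: eventually_mono)
  also have "\<dots> = ereal \<beta>" using up(2) by (intro lim_imp_Limsup) auto
  finally have 2: "limsup (\<lambda>n. ereal (f n)) \<le> ereal \<beta>" .
  have "ereal \<beta> = limsup (\<lambda>t. ereal (h t))"
    using r(3) by (intro lim_imp_Limsup[symmetric]) auto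
  also have "\<dots> \<le> limsup ((\<lambda>n. ereal (f n)) \<circ> r)"
    using r(2) by (intro Limsup_mono) (auto elim: eventually_mono)
  also have "\<dots> \<le> limsup (\<lambda>n. ereal (f n))"
    by (rule limsup_subseq_mono[OF r(1)])
  finally show "limsup (\<lambda>n. ereal (f n)) = ereal \<beta>" using 2 by (intro antisym)
qed

text \<open>
  On the scale of logarithms, and up to errors of lower order, \<open>H\<close> is the maximum of
  \<open>ln n / 2 + ln (m t)\<close> and \<open>ln n - ln (k (t + 1))\<close> for \<open>n\<close> between \<open>(k t * m t)\<^sup>2\<close> and
  \<open>(k (t + 1) * m (t + 1))\<^sup>2\<close>. The quotient by \<open>ln n\<close> is largest at the end points of this interval
  and smallest where the two terms agree, which happens at \<open>(k (t + 1) * m t)\<^sup>2\<close>.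
\<close>

lemma growth_exponents:
  fixes H :: "nat \<Rightarrow> real" and k m :: "nat \<Rightarrow> nat" and C c :: real
  assumes k: "strict_mono k" "\<And>s. 2 ^ s \<le> k s" and m: "mono m" "\<And>s. 1 \<le> m s"
    and c: "0 < c" and C: "0 < C"
    and lower1: "\<And>n s. 64 * (k s * m s) ^ 2 \<le> n \<Longrightarrow> c * (sqrt n * m s) \<le> H n"
    and lower2: "\<And>n s. 1 \<le> n \<Longrightarrow> n \<le> 64 * (k s * m s) ^ 2 \<Longrightarrow> c * (n / k s) \<le> H n"
    and upper: "\<And>n s. 3 \<le> n \<Longrightarrow> H n \<le> C * ln n ^ 2 * (sqrt n * (1 + (\<Sum>j<s. real (m j))) + n / k s)"
    and limv: "(\<lambda>s. ln (k s) / (ln (k s) + ln (m s))) \<longlonglongrightarrow> 2 - 2 * \<beta>"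
    and limu: "(\<lambda>s. ln (k (Suc s)) / (ln (k (Suc s)) + ln (m s))) \<longlonglongrightarrow> 2 - 2 * \<alpha>"
  shows "liminf (\<lambda>n. ereal (ln (H n) / ln n)) = ereal \<alpha>" and "limsup (\<lambda>n. ereal (ln (H n) / ln n)) = ereal \<beta>"
proof -
  define N where "N t = 64 * (k t * m t) ^ 2" for t
  define V where "V t = 64 * (k (Suc t) * m t) ^ 2" for t
  define F where "F t x = max (x / 2 + ln (m t)) (x - ln (k (Suc t)))" for t x
  define K where "K = ln (2 * C)"
  have kpos: "0 < k s" for s using k(2)[of s] by (metis gr_zeroI le_zero_eq power_eq_0_iff zero_neq_numeral)
  have mpos: "0 < m s" for s using m(2)[of s] by simp
  have kmono: "k s \<le> k t" if "s \<le> t" for s t using k(1) that by (simp add: strict_mono_less_eq)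
  have mmono: "m s \<le> m t" if "s \<le> t" for s t using m(1) that by (simp add: monoD)
  have NV: "N t \<le> V t" "V t \<le> N (Suc t)" for t
    unfolding N_def V_def using kmono[of t "Suc t"] mmono[of t "Suc t"]
    by (auto intro!: power_mono mult_mono)
  have smN: "strict_mono N" and smV: "strict_mono V"
  proof -
    have "k t * m t < k (Suc t) * m (Suc t)" for t
      using k(1) mmono[of t "Suc t"] mpos by (intro mult_less_le_imp_less) (auto simp: strict_mono_Suc_iff)
    then show "strict_mono N"
      unfolding strict_mono_Suc_iff N_def by (auto intro!: power_strict_mono)
    have "k (Suc t) * m t < k (Suc (Suc t)) * m (Suc t)" for t
      using k(1) mmono[of t "Suc t"] mpos by (intro mult_less_le_imp_less) (auto simp: strict_mono_Suc_iff)
    then show "strict_mono V"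
      unfolding strict_mono_Suc_iff V_def by (auto intro!: power_strict_mono)
  qed
  have N_ge: "64 * 4 ^ t \<le> N t" for t
  proof -
    have "2 ^ t * 1 \<le> k t * m t" using k(2) m(2) by (intro mult_mono) auto
    then have "(2 ^ t) ^ 2 \<le> (k t * m t) ^ 2" by (intro power_mono) auto
    then show ?thesis unfolding N_def by (simp add: power2_eq_square flip: power_mult_distrib)
  qed
  have x_ge: "real t + 2 \<le> ln n" if "N t \<le> n" for t n
  proof -
    have "exp (real t + 2) = exp (real (t + 2) * 1)" by simp
    also have "\<dots> = exp 1 ^ (t + 2)" by (rule exp_of_nat_mult)
    also have "\<dots> \<le> 3 ^ (t + 2)" by (intro power_mono exp_le) auto
    also have "\<dots> = 9 * 3 ^ t" by (simp add: power_add)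
    also have "\<dots> \<le> 64 * 4 ^ t" by (intro mult_mono power_mono) auto
    also have "\<dots> \<le> real (N t)" using N_ge[of t] by (metis of_nat_le_iff of_nat_mult of_nat_numeral of_nat_power)
    also have "\<dots> \<le> real n" using that by simp
    finally show ?thesis by (metis exp_gt_zero less_le_trans ln_exp ln_mono)
  qed
  have sq: "ln (sqrt n * m t) = ln n / 2 + ln (m t)" "ln (n / k s) = ln n - ln (k s)"
    if "0 < n" for n t s :: nat
    using that mpos[of t] kpos[of s] by (simp_all add: ln_mult ln_div ln_sqrt)
  have low: "0 < H n \<and> ln c + F t (ln n) \<le> ln (H n)" if "N t \<le> n" "n \<le> N (Suc t)" for t n
  proof -
    have n: "0 < n" using x_ge[OF that(1)] by (cases n) auto
    have 1: "c * (sqrt n * m t) \<le> H n" using lower1[of t n] that by (simp add: N_def)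
    have 2: "c * (n / k (Suc t)) \<le> H n" using lower2[of n "Suc t"] that n by (simp add: N_def)
    have p1: "0 < sqrt n * m t" and p2: "0 < real n / k (Suc t)" using n mpos kpos by auto
    have H: "0 < H n" using 1 p1 c by (meson less_le_trans mult_pos_pos)
    have "ln (c * (sqrt n * m t)) \<le> ln (H n)" by (intro ln_mono 1 mult_pos_pos c p1 H)
    moreover have "ln (c * (n / k (Suc t))) \<le> ln (H n)" by (intro ln_mono 2 mult_pos_pos c p2 H)
    ultimately show ?thesis
      using H unfolding ln_mult_pos[OF c p1] ln_mult_pos[OF c p2] sq[OF n] F_def by auto
  qed
  have up: "ln (H n) \<le> K + 3 * ln (ln n) + F t (ln n)" if "N t \<le> n" "n \<le> N (Suc t)" for t n
  proof -
    let ?x = "ln (real n)"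
    have x: "real t + 2 \<le> ?x" by (rule x_ge[OF that(1)])
    have n: "0 < n" using x by (cases n) auto
    have n3: "3 \<le> n" using N_ge[of t] that(1) one_le_power[of "4::nat" t] by linarith
    have p1: "0 < sqrt n * m t" and p2: "0 < real n / k (Suc t)" using n mpos kpos by auto
    define M where "M = max (sqrt n * m t) (n / k (Suc t))"
    have M: "0 < M" using p1 by (simp add: M_def)
    have lnM: "ln M = F t ?x"
      unfolding M_def F_def sq[OF n, symmetric] using p1 p2 by (auto simp: max_def)
    have "(\<Sum>j<Suc t. real (m j)) \<le> (\<Sum>j<Suc t. real (m t))" by (intro sum_mono) (simp add: mmono)
    then have "1 + (\<Sum>j<Suc t. real (m j)) \<le> (real t + 2) * m t" using m(2)[of t] by (simp add: algebra_simps)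
    also have "\<dots> \<le> ?x * m t" using x by (intro mult_right_mono) auto
    finally have "sqrt n * (1 + (\<Sum>j<Suc t. real (m j))) \<le> sqrt n * (?x * m t)" by (intro mult_left_mono) auto
    also have "\<dots> = ?x * (sqrt n * m t)" by simp
    also have "\<dots> \<le> ?x * M" using x by (intro mult_left_mono) (auto simp: M_def)
    finally have 1: "sqrt n * (1 + (\<Sum>j<Suc t. real (m j))) \<le> ?x * M" .
    have "n / k (Suc t) \<le> 1 * M" by (simp add: M_def)
    also have "\<dots> \<le> ?x * M" using x M by (intro mult_right_mono) auto
    finally have "sqrt n * (1 + (\<Sum>j<Suc t. real (m j))) + n / k (Suc t) \<le> 2 * (?x * M)" using 1 by linarith
    then have "C * ?x ^ 2 * (sqrt n * (1 + (\<Sum>j<Suc t. real (m j))) + n / k (Suc t)) \<le> C * ?x ^ 2 * (2 * (?x * M))"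
      using C by (intro mult_left_mono) auto
    with upper[OF n3, of "Suc t"] have "H n \<le> (2 * C) * (?x ^ 3 * M)"
      by (simp add: power2_eq_square power3_eq_cube mult_ac)
    then have "ln (H n) \<le> ln ((2 * C) * (?x ^ 3 * M))" using low[OF that] by (intro ln_mono) auto
    also have "\<dots> = K + 3 * ln ?x + F t ?x"
      using C x M by (simp add: ln_mult_pos ln_realpow K_def lnM)
    finally show ?thesis .
  qed
  define p where "p t = ln (real (k t)) + ln (real (m t))" for t
  define q where "q t = ln (real (k (Suc t))) + ln (real (m t))" for t
  have lnk: "0 \<le> ln (real (k t))" and lnm: "0 \<le> ln (real (m t))" for t
    using kpos[of t] mpos[of t] by simp_all
  have lnk_ge: "real t * ln 2 \<le> ln (real (k t))" for t
  proof -
    have "ln (2 ^ t) \<le> ln (real (k t))"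
      using k(2)[of t] kpos[of t] by (intro ln_mono) (auto simp flip: of_nat_le_iff)
    then show ?thesis by (simp add: ln_realpow)
  qed
  have t_ln2: "filterlim (\<lambda>t. real t * ln 2) at_top sequentially" by real_asymp
  have p_lim: "filterlim p at_top sequentially" and q_lim: "filterlim q at_top sequentially"
  proof -
    show "filterlim p at_top sequentially"
      by (rule filterlim_at_top_mono[OF t_ln2]) (use lnk_ge lnm in \<open>auto simp: p_def intro!: always_eventually add_increasing2\<close>)
    have "real t * ln 2 \<le> q t" for t
    proof -
      have "real t * ln 2 \<le> real (Suc t) * ln 2" by (intro mult_right_mono) auto
      then show ?thesis using lnk_ge[of "Suc t"] lnm[of t] unfolding q_def by linarith
    qed
    then show "filterlim q at_top sequentially"
      by (intro filterlim_at_top_mono[OF t_ln2] always_eventually) auto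
  qed
  have lnN: "ln (real (N t)) = 2 * p t + ln 64" for t
    using kpos[of t] mpos[of t] by (simp add: N_def p_def ln_mult ln_realpow)
  have lnV: "ln (real (V t)) = 2 * q t + ln 64" for t
    using kpos[of "Suc t"] mpos[of t] by (simp add: V_def q_def ln_mult ln_realpow)
  define w where "w t = ln (real (k t)) / (2 * p t + ln 64)" for t
  have w: "w \<longlonglongrightarrow> 1 - \<beta>"
    using ratio_limit[OF limv[folded p_def] p_lim, of "ln 64" 0] by (simp add: w_def[abs_def] diff_divide_distrib)
  \<comment> \<open>Divided by \<open>x\<close>, the first term of \<open>F\<close> decreases and
    the second increases. The entries of \<open>g\<close> bound them by their quotients at the left
    and at the right end of the interval, respectively.\<close>
  define g where "g t = max (1 - ln (real (k t)) / p t / 2) (1 - w (Suc t))" for t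
  have g: "g \<longlonglongrightarrow> \<beta>"
  proof -
    have "g \<longlonglongrightarrow> max (1 - (2 - 2 * \<beta>) / 2) (1 - (1 - \<beta>))"
      unfolding g_def by (intro tendsto_intros limv[folded p_def] LIMSEQ_Suc[OF w]) auto
    then show ?thesis by (simp add: diff_divide_distrib)
  qed
  \<comment> \<open>The common quotient at \<open>x = 2 * q t\<close>, where the terms of
    \<open>F\<close> agree. To the left of that point the first term is at least this large, to the
    right the second.\<close>
  define g' where "g' t = 1 - ln (real (k (Suc t))) / q t / 2" for t
  have g': "g' \<longlonglongrightarrow> \<alpha>"
  proof -
    have "g' \<longlonglongrightarrow> 1 - (2 - 2 * \<alpha>) / 2"
      unfolding g'_def by (intro tendsto_intros limu[folded q_def]) auto
    then show ?thesis by (simp add: diff_divide_distrib)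
  qed
  have F_up: "F t (ln n) \<le> g t * ln n" if "N t \<le> n" "n \<le> N (Suc t)" "0 < p t" for t n
  proof -
    let ?x = "ln (real n)"
    have x: "0 < ?x" using x_ge[OF that(1)] by linarith
    have n: "0 < n" using x by (cases n) auto
    have "2 * p t \<le> ?x"
    proof -
      have "ln (real (N t)) \<le> ?x" using that(1) N_ge[of t] by (intro ln_mono) (auto intro: less_le_trans[of 0 "64 * 4 ^ t"])
      then show ?thesis using lnN[of t] ln_gt_zero[of "64::real"] by linarith
    qed
    then have "ln (m t) * (2 * p t) \<le> ln (m t) * ?x" using lnm[of t] by (intro mult_left_mono) auto
    then have L: "ln (m t) \<le> ln (m t) / (2 * p t) * ?x" using that(3) by (simp add: field_simps)
    have E: "1 - ln (real (k t)) / p t / 2 = 1 / 2 + ln (m t) / (2 * p t)"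
      using that(3) by (simp add: p_def field_simps)
    have "?x / 2 + ln (m t) \<le> (1 - ln (real (k t)) / p t / 2) * ?x"
      unfolding E using L by (simp add: distrib_right)
    also have "\<dots> \<le> g t * ?x" using x by (intro mult_right_mono) (auto simp: g_def)
    finally have 1: "?x / 2 + ln (m t) \<le> g t * ?x" .
    have "?x \<le> 2 * p (Suc t) + ln 64"
      unfolding lnN[symmetric] using that(2) n by (intro ln_mono) auto
    then have "w (Suc t) * ?x \<le> w (Suc t) * (2 * p (Suc t) + ln 64)"
      using lnk lnm by (intro mult_left_mono) (auto simp: w_def p_def)
    also have "\<dots> = ln (k (Suc t))"
    proof -
      have "0 < 2 * p (Suc t) + ln 64"
      proof -
        have "0 < ln (64 :: real)" by simp
        then show ?thesis
          unfolding p_def by (intro add_nonneg_pos mult_nonneg_nonneg add_nonneg_nonneg lnk lnm) simp_all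
      qed
      then show ?thesis by (simp add: w_def)
    qed
    finally have "?x - ln (k (Suc t)) \<le> (1 - w (Suc t)) * ?x" by (simp add: algebra_simps)
    also have "\<dots> \<le> g t * ?x" using x by (intro mult_right_mono) (auto simp: g_def)
    finally show ?thesis using 1 by (simp add: F_def)
  qed
  have F_low: "g' t * ln n \<le> F t (ln n)" if "N t \<le> n" "0 < q t" for t n
  proof -
    let ?x = "ln (real n)"
    have x: "0 < ?x" using x_ge[OF that(1)] by linarith
    show ?thesis
    proof (cases "?x \<le> 2 * q t")
      case True
      then have L: "ln (m t) / (2 * q t) * ?x \<le> ln (m t)"
        using that(2) lnm[of t] mult_left_mono[OF True lnm[of t]] by (simp add: field_simps)
      have E: "g' t = 1 / 2 + ln (m t) / (2 * q t)"
        using that(2) by (simp add: g'_def q_def field_simps)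
      have "g' t * ?x \<le> ?x / 2 + ln (m t)" unfolding E using L by (simp add: distrib_right)
      then show ?thesis by (simp add: F_def)
    next
      case False
      then have "2 * q t * ln (k (Suc t)) \<le> ?x * ln (k (Suc t))"
        using lnk by (intro mult_right_mono) auto
      then have "ln (k (Suc t)) \<le> ln (k (Suc t)) / q t / 2 * ?x"
        using that(2) by (simp add: field_simps)
      then have "g' t * ?x \<le> ?x - ln (k (Suc t))" by (simp add: g'_def algebra_simps)
      then show ?thesis by (simp add: F_def)
    qed
  qed
  define idx where "idx n = (LEAST t. n < N (Suc t))" for n
  have N_unbounded: "\<exists>t. n < N (Suc t)" for n
    using strict_mono_imp_increasing[OF smN, of "Suc n"] by (intro exI[of _ n]) simp
  have idx_up: "n < N (Suc (idx n))" for n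
    unfolding idx_def using N_unbounded by (rule LeastI_ex)
  have idx_low: "N (idx n) \<le> n" if "N 0 \<le> n" for n
  proof (cases "idx n")
    case (Suc i)
    then have "\<not> n < N (Suc i)" unfolding idx_def using not_less_Least[of i "\<lambda>t. n < N (Suc t)"] by simp
    then show ?thesis using Suc by simp
  qed (use that in simp)
  have idx_lim: "filterlim idx at_top sequentially"
    unfolding filterlim_at_top
  proof
    fix s
    have "s \<le> idx n" if "N s \<le> n" for n
    proof (rule ccontr)
      assume "\<not> s \<le> idx n"
      then have "N (Suc (idx n)) \<le> N s" using smN by (simp add: strict_mono_less_eq)
      then show False using idx_up[of n] that by simp
    qed
    then show "eventually (\<lambda>n. s \<le> idx n) sequentially"
      unfolding eventually_sequentially by blast
  qed
  have err1: "(\<lambda>n. (K + 3 * ln (ln (real n))) / ln (real n)) \<longlonglongrightarrow> 0" by real_asymp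
  have err2: "(\<lambda>n. ln c / ln (real n)) \<longlonglongrightarrow> 0" by real_asymp
  have pidx: "eventually (\<lambda>n. 0 < p (idx n)) sequentially"
    using filterlim_compose[OF p_lim idx_lim] by (simp add: filterlim_at_top_dense)
  have qidx: "eventually (\<lambda>n. 0 < q (idx n)) sequentially"
    using filterlim_compose[OF q_lim idx_lim] by (simp add: filterlim_at_top_dense)
  have up_ev: "eventually (\<lambda>n. ln (H n) / ln n \<le> (K + 3 * ln (ln (real n))) / ln (real n) + g (idx n)) sequentially"
    using pidx eventually_ge_at_top[of "N 0"]
  proof eventually_elim
    case (elim n)
    note n = idx_low[OF elim(2)] less_imp_le[OF idx_up[of n]]
    have x: "0 < ln (real n)" using x_ge[OF n(1)] by linarith
    have "ln (H n) \<le> K + 3 * ln (ln n) + g (idx n) * ln n"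
      using up[OF n] F_up[OF n elim(1)] by linarith
    then have "ln (H n) / ln n \<le> (K + 3 * ln (ln n) + g (idx n) * ln n) / ln n"
      using x by (intro divide_right_mono) auto
    then show ?case using x by (simp add: add_divide_distrib)
  qed
  have low_ev: "eventually (\<lambda>n. ln c / ln (real n) + g' (idx n) \<le> ln (H n) / ln n) sequentially"
    using qidx eventually_ge_at_top[of "N 0"]
  proof eventually_elim
    case (elim n)
    note n = idx_low[OF elim(2)] less_imp_le[OF idx_up[of n]]
    have x: "0 < ln (real n)" using x_ge[OF n(1)] by linarith
    have "ln c + g' (idx n) * ln n \<le> ln (H n)"
      using low[OF n] F_low[OF n(1) elim(1)] by linarith
    then have "(ln c + g' (idx n) * ln n) / ln n \<le> ln (H n) / ln n"
      using x by (intro divide_right_mono) auto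
    then show ?case using x by (simp add: add_divide_distrib)
  qed
  have up_lim: "(\<lambda>n. (K + 3 * ln (ln (real n))) / ln (real n) + g (idx n)) \<longlonglongrightarrow> \<beta>"
    using tendsto_add[OF err1 filterlim_compose[OF g idx_lim]] by simp
  have low_lim: "(\<lambda>n. ln c / ln (real n) + g' (idx n)) \<longlonglongrightarrow> \<alpha>"
    using tendsto_add[OF err2 filterlim_compose[OF g' idx_lim]] by simp
  have N_lim: "filterlim N at_top sequentially" by (rule filterlim_subseq[OF smN])
  have V_lim: "filterlim V at_top sequentially" by (rule filterlim_subseq[OF smV])
  \<comment> \<open>The upper exponent is attained along the times \<open>N t\<close>, the lower one
    along \<open>V t\<close>.\<close>
  define h where "h t = ln c / ln (real (N t)) + (1 - (ln (real (k t)) + ln 64 / 2) / (2 * p t + ln 64))" for t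
  have h_lim: "h \<longlonglongrightarrow> \<beta>"
  proof -
    have "h \<longlonglongrightarrow> 0 + (1 - (2 - 2 * \<beta>) / 2)"
      unfolding h_def
      by (intro tendsto_intros filterlim_compose[OF err2 N_lim] ratio_limit[OF limv[folded p_def] p_lim]) auto
    then show ?thesis by (simp add: diff_divide_distrib)
  qed
  have h_le: "h t \<le> ln (H (N t)) / ln (N t)" for t
  proof -
    have x: "0 < ln (real (N t))" using x_ge[of t "N t"] by linarith
    have "ln c + (ln (N t) / 2 + ln (m t)) \<le> ln (H (N t))"
      using low[of t "N t"] NV[of t] by (auto simp: F_def)
    then have "(ln c + (ln (N t) / 2 + ln (m t))) / ln (N t) \<le> ln (H (N t)) / ln (N t)"
      using x by (intro divide_right_mono) auto
    also have "(ln c + (ln (N t) / 2 + ln (m t))) / ln (N t) = h t"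
    proof -
      have "ln (N t) / 2 + ln (m t) = ln (N t) - (ln (k t) + ln 64 / 2)"
        unfolding lnN p_def by (simp add: field_simps)
      then show ?thesis
        using x unfolding h_def lnN[symmetric] by (simp add: add_divide_distrib diff_divide_distrib)
    qed
    finally show ?thesis .
  qed
  define h' where "h' t = (K + 3 * ln (ln (real (V t)))) / ln (real (V t))
      + (1 - (ln (real (k (Suc t))) + 0) / (2 * q t + ln 64))" for t
  have h'_lim: "h' \<longlonglongrightarrow> \<alpha>"
  proof -
    have "h' \<longlonglongrightarrow> 0 + (1 - (2 - 2 * \<alpha>) / 2)"
      unfolding h'_def
      by (intro tendsto_intros filterlim_compose[OF err1 V_lim] ratio_limit[OF limu[folded q_def] q_lim]) auto
    then show ?thesis by (simp add: diff_divide_distrib)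
  qed
  have h'_ge: "ln (H (V t)) / ln (V t) \<le> h' t" for t
  proof -
    have x: "0 < ln (real (V t))" using x_ge[of t "V t"] NV[of t] by linarith
    have "F t (ln (V t)) \<le> ln (V t) - ln (k (Suc t))"
      unfolding F_def lnV using ln_gt_zero[of "64::real"] by (simp add: q_def)
    then have "ln (H (V t)) \<le> K + 3 * ln (ln (V t)) + (ln (V t) - ln (k (Suc t)))"
      using up[of t "V t"] NV[of t] by linarith
    then have "ln (H (V t)) / ln (V t) \<le> (K + 3 * ln (ln (V t)) + (ln (V t) - ln (k (Suc t)))) / ln (V t)"
      using x by (intro divide_right_mono) auto
    also have "\<dots> = (K + 3 * ln (ln (V t))) / ln (V t) + (1 - ln (k (Suc t)) / ln (V t))"
      using x by (simp add: add_divide_distrib diff_divide_distrib)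
    also have "\<dots> = h' t" unfolding h'_def lnV by simp
    finally show ?thesis .
  qed
  show "liminf (\<lambda>n. ereal (ln (H n) / ln n)) = ereal \<alpha>" "limsup (\<lambda>n. ereal (ln (H n) / ln n)) = ereal \<beta>"
    by (rule liminf_limsup_eqI[OF up_ev up_lim low_ev low_lim smN always_eventually h_lim smV always_eventually h'_lim];
        use h_le h'_ge in blast)+
qed

section \<open>Integer sequences with two prescribed limiting ratios\<close>

lemma fraction_mono: "0 < (b::real) \<Longrightarrow> 0 \<le> x \<Longrightarrow> x \<le> y \<Longrightarrow> x / (x + b) \<le> y / (y + b)"
  by (simp add: field_simps mult_right_mono)

text \<open>Applied with \<open>x\<close> the ceiling of \<open>b * t\<close> plus 1: rounding and
  forced growth move the ratio by at most \<open>2 / b\<close>.\<close>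

lemma fraction_near1:
  fixes b t x :: real
  assumes "0 < b" "0 \<le> t" "b * t \<le> x" "x \<le> b * t + 2"
  shows "t / (1 + t) \<le> x / (x + b)" "x / (x + b) \<le> t / (1 + t) + 2 / b"
proof -
  have "b * t + b = b * (1 + t)" by (simp add: algebra_simps)
  then have eq: "t / (1 + t) = (b * t) / (b * t + b)" using assms(1) by simp
  have x: "0 \<le> x" using mult_nonneg_nonneg[of b t] assms by linarith
  show "t / (1 + t) \<le> x / (x + b)" unfolding eq using assms x by (intro fraction_mono) auto
  have "x / (x + b) \<le> (b * t + 2) / (b * t + 2 + b)" using assms x by (intro fraction_mono) auto
  also have "\<dots> = (b * t) / (b * t + 2 + b) + 2 / (b * t + 2 + b)" by (simp add: add_divide_distrib)
  also have "\<dots> \<le> (b * t) / (b * t + b) + 2 / b"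
    using mult_nonneg_nonneg[of b t] assms by (intro add_mono frac_le; linarith)
  finally show "x / (x + b) \<le> t / (1 + t) + 2 / b" unfolding eq .
qed

lemma fraction_near2:
  fixes a w y :: real
  assumes "0 < a" "0 \<le> w" "a * w \<le> y" "y \<le> a * w + 2"
  shows "a / (a + y) \<le> 1 / (1 + w)" "1 / (1 + w) - 2 / a \<le> a / (a + y)"
proof -
  have "0 \<le> a * w" using assms by simp
  then have "0 < a + y" "0 < 1 + w" using assms by linarith+
  then have eq: "a / (a + y) = 1 - y / (y + a)" "1 / (1 + w) = 1 - w / (1 + w)"
    by (simp_all add: field_simps)
  show "a / (a + y) \<le> 1 / (1 + w)" "1 / (1 + w) - 2 / a \<le> a / (a + y)"
    unfolding eq using fraction_near1[OF assms] by linarith+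
qed

text \<open>Alternately enlarge \<open>a\<close> until its ratio against the old \<open>b\<close> is
  about \<open>u\<close>, then enlarge \<open>b\<close> until the ratio falls back to about
  \<open>v\<close>. As \<open>v \<le> u\<close>, both adjustments are compatible with growing
  sequences, up to vanishing errors.\<close>

lemma exponent_sequences:
  fixes u v :: real
  assumes "0 \<le> v" "v \<le> u" "u \<le> 1"
  obtains a b :: "nat \<Rightarrow> nat" where "strict_mono a" "\<And>s. s \<le> a s" "mono b" "\<And>s. 11 \<le> b s"
    "(\<lambda>s. real (a s) / (real (a s) + real (b s))) \<longlonglongrightarrow> v"
    "(\<lambda>s. real (a (Suc s)) / (real (a (Suc s)) + real (b s))) \<longlonglongrightarrow> u"
proof -
  \<comment> \<open>\<open>u\<close> and \<open>v\<close> may be 0 or 1, where the divisions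
    defining \<open>t\<close> and \<open>w\<close> degenerate; a vanishing perturbation moves them
    into the open interval.\<close>
  define \<delta> where "\<delta> s = 1 / (real s + 3)" for s
  define U where "U s = (1 - 2 * \<delta> s) * u + \<delta> s" for s
  define V where "V s = (1 - 2 * \<delta> s) * v + \<delta> s" for s
  have \<delta>: "0 < \<delta> s" "2 * \<delta> s < 1" for s by (auto simp: \<delta>_def field_simps)
  have mix: "0 < (1 - 2 * \<delta> s) * x + \<delta> s \<and> (1 - 2 * \<delta> s) * x + \<delta> s < 1" if "0 \<le> x" "x \<le> 1" for s x
  proof -
    have "0 \<le> (1 - 2 * \<delta> s) * x" "(1 - 2 * \<delta> s) * x \<le> 1 - 2 * \<delta> s"
      using that \<delta>[of s] mult_left_le[of x "1 - 2 * \<delta> s"] by auto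
    then show ?thesis using \<delta>[of s] by linarith
  qed
  have U: "0 < U s" "U s < 1" and V: "0 < V s" "V s < 1" for s
    unfolding U_def V_def using mix[of u s] mix[of v s] assms by auto
  have \<delta>_lim: "\<delta> \<longlonglongrightarrow> 0" unfolding \<delta>_def by real_asymp
  have "U \<longlonglongrightarrow> (1 - 2 * 0) * u + 0" "V \<longlonglongrightarrow> (1 - 2 * 0) * v + 0"
    unfolding U_def V_def by (intro tendsto_intros \<delta>_lim)+
  then have U_lim: "U \<longlonglongrightarrow> u" and V_lim: "V \<longlonglongrightarrow> v" by simp_all
  define t where "t s = U s / (1 - U s)" for s
  define w where "w s = (1 - V s) / V s" for s
  have t: "0 \<le> t s" "t s / (1 + t s) = U s" for s
    using U[of s] by (auto simp: t_def field_simps)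
  have w: "0 \<le> w s" "1 / (1 + w s) = V s" for s
    using V[of s] by (auto simp: w_def field_simps)
  \<comment> \<open>The maximum keeps the sequences monotone, and the added 1 makes them strictly
    increasing.\<close>
  define na where "na s A B = max A (nat \<lceil>real B * t s\<rceil>) + 1" for s A B
  define nb where "nb s A B = max B (nat \<lceil>real A * w s\<rceil>) + 1" for s A B
  define ab where "ab = rec_nat (1 :: nat, 11 :: nat) (\<lambda>s (A, B). (na s A B, nb s (na s A B) B))"
  define a b where "a s = fst (ab s)" and "b s = snd (ab s)" for s
  have 0: "a 0 = 1" "b 0 = 11" by (simp_all add: a_def b_def ab_def)
  have Suc: "a (Suc s) = na s (a s) (b s)" "b (Suc s) = nb s (a (Suc s)) (b s)" for s
    by (simp_all add: a_def b_def ab_def case_prod_beta)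
  have sma: "strict_mono a" and smb: "strict_mono b"
    unfolding strict_mono_Suc_iff Suc na_def nb_def by auto
  have a_ge: "s \<le> a s" and b_ge: "s \<le> b s" for s
    using strict_mono_imp_increasing[OF sma] strict_mono_imp_increasing[OF smb] by auto
  have apos: "1 \<le> a s" and bpos: "11 \<le> b s" for s
    using strict_mono_less_eq[OF sma, of 0 s] strict_mono_less_eq[OF smb, of 0 s] 0 by auto
  define r where "r s = real (a s) / (real (a s) + real (b s))" for s
  define q where "q s = real (a (Suc s)) / (real (a (Suc s)) + real (b s))" for s
  have nat_ceil: "x \<le> real (nat \<lceil>x\<rceil>) \<and> real (nat \<lceil>x\<rceil>) \<le> x + 1" if "0 \<le> x" for x
    using that by (simp add: of_nat_nat ceiling_correct)
  have bounds: "2 / real (a s) \<le> 2 / (real s + 1) * 2" "2 / real (b s) \<le> 2 / (real s + 1) * 2" for s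
  proof -
    have "real s + 1 \<le> 2 * real (a s)" "real s + 1 \<le> 2 * real (b s)" using a_ge[of s] b_ge[of s] apos[of s] bpos[of s] by linarith+
    then show "2 / real (a s) \<le> 2 / (real s + 1) * 2" "2 / real (b s) \<le> 2 / (real s + 1) * 2"
      using apos[of s] bpos[of s] by (simp_all add: field_simps)
  qed
  define \<epsilon> where "\<epsilon> s = 2 / (real s + 1) * 2" for s
  have \<epsilon>: "\<epsilon> \<longlonglongrightarrow> 0" unfolding \<epsilon>_def by real_asymp
  have \<epsilon>': "(\<lambda>s. \<epsilon> (Suc s)) \<longlonglongrightarrow> 0" using \<epsilon> by (rule LIMSEQ_Suc)
  have r_up: "r (Suc s) \<le> V s" for s
  proof -
    have "real (a (Suc s)) * w s \<le> real (b (Suc s))"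
    proof -
      have "real (nat \<lceil>real (a (Suc s)) * w s\<rceil>) \<le> real (b (Suc s))"
        unfolding Suc(2) nb_def of_nat_le_iff by (intro trans_le_add1 max.cobounded2)
      moreover have "0 \<le> real (a (Suc s)) * w s" using w(1)[of s] by (intro mult_nonneg_nonneg) auto
      ultimately show ?thesis using nat_ceil order_trans by blast
    qed
    then have "r (Suc s) \<le> real (a (Suc s)) / (real (a (Suc s)) + real (a (Suc s)) * w s)"
      unfolding r_def using apos[of "Suc s"] w(1)[of s]
      by (intro divide_left_mono mult_pos_pos add_pos_nonneg) auto
    also have "real (a (Suc s)) + real (a (Suc s)) * w s = real (a (Suc s)) * (1 + w s)"
      by (simp add: algebra_simps)
    also have "real (a (Suc s)) / \<dots> = 1 / (1 + w s)" using apos[of "Suc s"] by simp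
    finally show ?thesis by (simp add: w)
  qed
  \<comment> \<open>If \<open>b\<close> grew only by the forced 1, the ratio stays near
    \<open>q s\<close>, which is at least \<open>U s\<close>; since \<open>v \<le> u\<close>, the
    minimum still tends to \<open>v\<close>. \<open>q_up\<close> is the mirror image.\<close>
  have r_low: "min (q s) (V s) - \<epsilon> (Suc s) \<le> r (Suc s)" for s
  proof -
    let ?A = "real (a (Suc s))"
    have A: "0 < ?A" using apos[of "Suc s"] by simp
    have e: "2 / ?A \<le> \<epsilon> (Suc s)" using bounds(1)[of "Suc s"] by (simp add: \<epsilon>_def)
    consider "b (Suc s) = b s + 1" | "b (Suc s) = nat \<lceil>?A * w s\<rceil> + 1"
      unfolding Suc(2) nb_def by linarith
    then show ?thesis
    proof cases
      case 1
      have "q s = 1 - real (b s) / (real (b s) + ?A)"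
        unfolding q_def using A by (simp add: field_simps)
      moreover have "r (Suc s) = 1 - (real (b s) + 1) / (real (b s) + 1 + ?A)"
        unfolding r_def 1 using A by (simp add: field_simps)
      moreover have "(real (b s) + 1) / (real (b s) + 1 + ?A) \<le> real (b s) / (real (b s) + ?A) + 2 / ?A"
      proof -
        have "(real (b s) + 1) / (real (b s) + 1 + ?A) = real (b s) / (real (b s) + 1 + ?A) + 1 / (real (b s) + 1 + ?A)"
          by (simp add: add_divide_distrib)
        also have "\<dots> \<le> real (b s) / (real (b s) + ?A) + 2 / ?A"
          using A by (intro add_mono divide_left_mono frac_le) auto
        finally show ?thesis .
      qed
      ultimately show ?thesis using e by linarith
    next
      case 2
      have "0 \<le> ?A * w s" using A w(1)[of s] by simp
      then have y: "?A * w s \<le> real (b (Suc s))" "real (b (Suc s)) \<le> ?A * w s + 2"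
        using nat_ceil[of "?A * w s"] unfolding 2 of_nat_add of_nat_1 by linarith+
      have "1 / (1 + w s) - 2 / ?A \<le> ?A / (?A + real (b (Suc s)))"
        by (rule fraction_near2(2)[OF A w(1) y])
      then show ?thesis using e unfolding w(2) r_def by linarith
    qed
  qed
  have q_low: "U s \<le> q s" for s
  proof -
    have "real (b s) * t s \<le> real (a (Suc s))"
    proof -
      have "real (nat \<lceil>real (b s) * t s\<rceil>) \<le> real (a (Suc s))"
        unfolding Suc(1) na_def of_nat_le_iff by (intro trans_le_add1 max.cobounded2)
      moreover have "0 \<le> real (b s) * t s" using t(1)[of s] by (intro mult_nonneg_nonneg) auto
      ultimately show ?thesis using nat_ceil order_trans by blast
    qed
    then have "(real (b s) * t s) / (real (b s) * t s + real (b s)) \<le> q s"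
      unfolding q_def using bpos[of s] t(1)[of s] by (intro fraction_mono) auto
    moreover have "real (b s) * t s + real (b s) = real (b s) * (1 + t s)"
      by (simp add: algebra_simps)
    then have "(real (b s) * t s) / (real (b s) * t s + real (b s)) = t s / (1 + t s)"
      using bpos[of s] by simp
    ultimately show ?thesis by (simp add: t)
  qed
  have q_up: "q s \<le> max (r s) (U s) + \<epsilon> s" for s
  proof -
    let ?B = "real (b s)"
    have B: "0 < ?B" using bpos[of s] by simp
    have e: "2 / ?B \<le> \<epsilon> s" using bounds(2)[of s] by (simp add: \<epsilon>_def)
    consider "a (Suc s) = a s + 1" | "a (Suc s) = nat \<lceil>?B * t s\<rceil> + 1"
      unfolding Suc(1) na_def by linarith
    then show ?thesis
    proof cases
      case 1
      have "q s = real (a s) / (real (a s) + 1 + ?B) + 1 / (real (a s) + 1 + ?B)"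
        unfolding q_def 1 by (simp add: add_divide_distrib add_ac)
      also have "\<dots> \<le> r s + 2 / ?B"
        unfolding r_def using B by (intro add_mono divide_left_mono frac_le) auto
      finally show ?thesis using e by linarith
    next
      case 2
      have "0 \<le> ?B * t s" using B t(1)[of s] by simp
      then have y: "?B * t s \<le> real (a (Suc s))" "real (a (Suc s)) \<le> ?B * t s + 2"
        using nat_ceil[of "?B * t s"] unfolding 2 of_nat_add of_nat_1 by linarith+
      have "q s \<le> t s / (1 + t s) + 2 / ?B"
        unfolding q_def by (rule fraction_near1(2)[OF B t(1) y])
      then show ?thesis using e unfolding t(2) by linarith
    qed
  qed
  have q_lim: "q \<longlonglongrightarrow> u"
  proof (rule LIMSEQ_offset[of _ 1], rule tendsto_sandwich)
    show "eventually (\<lambda>s. U (s + 1) \<le> q (s + 1)) sequentially" using q_low by simp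
    show "eventually (\<lambda>s. q (s + 1) \<le> max (V s) (U (s + 1)) + \<epsilon> (s + 1)) sequentially"
    proof (intro always_eventually allI)
      fix s
      show "q (s + 1) \<le> max (V s) (U (s + 1)) + \<epsilon> (s + 1)"
        using q_up[of "s + 1"] r_up[of s] by simp
    qed
    show "(\<lambda>s. U (s + 1)) \<longlonglongrightarrow> u" using LIMSEQ_Suc[OF U_lim] by simp
    have "(\<lambda>s. max (V s) (U (Suc s)) + \<epsilon> (Suc s)) \<longlonglongrightarrow> max v u + 0"
      by (intro tendsto_intros V_lim LIMSEQ_Suc[OF U_lim] \<epsilon>')
    then show "(\<lambda>s. max (V s) (U (s + 1)) + \<epsilon> (s + 1)) \<longlonglongrightarrow> u" using assms by (simp add: max_def)
  qed
  have r_lim: "r \<longlonglongrightarrow> v"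
  proof (rule LIMSEQ_offset[of _ 1], rule tendsto_sandwich)
    show "eventually (\<lambda>s. min (q s) (V s) - \<epsilon> (s + 1) \<le> r (s + 1)) sequentially" using r_low by simp
    show "eventually (\<lambda>s. r (s + 1) \<le> V s) sequentially" using r_up by simp
    show "V \<longlonglongrightarrow> v" by (rule V_lim)
    have "(\<lambda>s. min (q s) (V s) - \<epsilon> (Suc s)) \<longlonglongrightarrow> min u v - 0"
      by (intro tendsto_intros V_lim q_lim \<epsilon>')
    then show "(\<lambda>s. min (q s) (V s) - \<epsilon> (s + 1)) \<longlonglongrightarrow> v" using assms by (simp add: min.absorb2)
  qed
  show thesis
    by (rule that[of a b]) (use sma a_ge strict_mono_mono[OF smb] bpos r_lim q_lim in \<open>auto simp: r_def[abs_def] q_def[abs_def]\<close>)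
qed

theorem theorem1:
  fixes \<alpha> \<beta> :: real
  assumes "1/2 \<le> \<alpha>" and "\<alpha> \<le> \<beta>" and "\<beta> \<le> 1"
  shows "\<exists>(G :: nat monoid) (mu :: nat \<Rightarrow> real).
           finitely_generated_group G \<and> sym_fin_prob_gen G mu \<and>
           liminf (\<lambda>n. ereal (ln (entropy_fun G mu n) / ln (real n))) = ereal \<alpha> \<and>
           limsup (\<lambda>n. ereal (ln (entropy_fun G mu n) / ln (real n))) = ereal \<beta>"
proof -
  \<comment> \<open>At \<open>n = (k s * m s)\<^sup>2\<close> the entropy
    \<open>sqrt n * m s\<close> has exponent \<open>1 - ln k / (2 * (ln k + ln m))\<close>, so peaks
    of exponent \<beta> need the ratio \<open>2 - 2 * \<beta>\<close>. The valleys at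
    \<open>(k (Suc s) * m s)\<^sup>2\<close> likewise need \<open>2 - 2 * \<alpha>\<close>.\<close>
  obtain a b :: "nat \<Rightarrow> nat" where a: "strict_mono a" "\<And>s. s \<le> a s" and b: "mono b" "\<And>s. 11 \<le> b s"
    and limv: "(\<lambda>s. real (a s) / (real (a s) + real (b s))) \<longlonglongrightarrow> 2 - 2 * \<beta>"
    and limu: "(\<lambda>s. real (a (Suc s)) / (real (a (Suc s)) + real (b s))) \<longlonglongrightarrow> 2 - 2 * \<alpha>"
    using exponent_sequences[of "2 - 2 * \<beta>" "2 - 2 * \<alpha>"] assms by auto
  \<comment> \<open>Powers of two turn ratios of logarithms into ratios of exponents, and
    \<open>b s \<ge> 11\<close> gives \<open>m s \<ge> 2048\<close>.\<close>
  define k m :: "nat \<Rightarrow> nat" where "k s = 2 ^ a s" and "m s = 2 ^ b s" for s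
  have m_ge: "2048 \<le> m s" for s
    using power_increasing[OF b(2)[of s], of "2 :: nat"] by (simp add: m_def)
  have k: "strict_mono k" "\<And>s. 2 ^ s \<le> k s" and m: "mono m"
    using a b by (auto simp: k_def m_def strict_mono_def mono_def intro!: power_increasing)
  interpret SL2_product k m
    using strict_mono_mono[OF k(1)] m_ge by unfold_locales (auto simp: k_def)
  obtain G :: "nat monoid" and mu where G: "finitely_generated_group G" "sym_fin_prob_gen G mu"
    and ent: "\<And>n. entropy_fun G mu n = Hp (pw W \<mu> n)"
    using walk_on_nat_group[OF group_W finite_\<mu> set_\<mu> inv_\<mu>] by blast
  have ratio: "ln (real (2 ^ i)) / (ln (real (2 ^ i)) + ln (real (2 ^ j))) = real i / (real i + real j)" for i j :: nat
  proof -
    have "ln (real (2 ^ i)) / (ln (real (2 ^ i)) + ln (real (2 ^ j)))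
        = (real i * ln 2) / ((real i + real j) * ln 2)"
      by (simp add: ln_realpow distrib_right)
    then show ?thesis by simp
  qed
  have low: "1 / 480000 * (sqrt n * m s) \<le> Hp (pw W \<mu> n)" if "64 * (k s * m s) ^ 2 \<le> n" for n s
  proof -
    have "1 / 480000 * (sqrt n * m s) \<le> 1 / 30000 * (sqrt n * m s)" by (intro mult_right_mono) auto
    then show ?thesis using entropy_lower[OF that] by linarith
  qed
  have limv': "(\<lambda>s. ln (real (k s)) / (ln (real (k s)) + ln (real (m s)))) \<longlonglongrightarrow> 2 - 2 * \<beta>"
    and limu': "(\<lambda>s. ln (real (k (Suc s))) / (ln (real (k (Suc s))) + ln (real (m s)))) \<longlonglongrightarrow> 2 - 2 * \<alpha>"
    unfolding k_def m_def ratio by (rule limv, rule limu)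
  have "1 \<le> m s" for s using m_ge[of s] by simp
  note lims = growth_exponents[OF k m this _ _ low entropy_lower2 entropy_upper limv' limu']
  have "liminf (\<lambda>n. ereal (ln (entropy_fun G mu n) / ln (real n))) = ereal \<alpha>"
    "limsup (\<lambda>n. ereal (ln (entropy_fun G mu n) / ln (real n))) = ereal \<beta>"
    unfolding ent by (rule lims; simp)+
  then show ?thesis using G by blast
qed

end
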